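(* Let $\ell=0$, let $G$ be an admissible kernel of order $m$ with parameters $d>m$, $L>0$ and $T_*=\infty$, and let $F$ satisfy the structure condition of order $0$ (all as defined in the context, with associated $A$, ${\bf p}$, $|{\bf p}|$, $\langle{\bf p}\rangle_0$ and $r_0$). Assume $r_0>1$. Then, for any $q>1$, there exists $\gamma>0$ such that, if $\phi$ is a locally integrable function on $\mathbb{R}^N$ with $$\|\phi\|_{\mathcal{M}_{r_0,q}}\le\gamma,$$ then the integral equation (I) displayed in the context possesses a global-in-time solution $u$ (that is, a solution in $\mathbb{R}^N\times[0,\infty)$) satisfying, for some constant $C>0$, $$|\nabla^ju(x,t)|\le C\,t^{-\frac N{dr_0}-\frac jd}$$ for $(x,t)\in\mathbb{R}^N\times(0,\infty)$ and $j\in\{0,\dots,m\}$.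
   Context: Setting. $N\ge1$, $m\in\{0,1,2,\dots\}$, $a_0\in\mathbb{R}$. $\nabla^j=\nabla_x^j$ denotes the collection of all $j$-th order partial derivatives in $x$. $B(x,\sigma)$ is the open ball of centre $x$ and radius $\sigma$. $D_m:=\sum_{j=0}^mN^j$. Morrey norm: $\|f\|_{\mathcal{M}_{r,q}}:=\sup_{x\in\mathbb{R}^N}\sup_{\sigma>0}\sigma^{\frac Nr}\Bigl(\frac1{|B(x,\sigma)|}\int_{B(x,\sigma)}|f(y)|^q\,dy\Bigr)^{1/q}$. Integral equation (I) (case $\ell=0$): $$u(x,t)=\int_{\mathbb{R}^N}G(x,y,t)\phi(y)\,dy+a_0\int_0^t\int_{\mathbb{R}^N}G(x,y,t-s)\,F\bigl(y,s,u(y,s),\dots,\nabla^mu(y,s)\bigr)\,dy\,ds.$$ Admissible kernel of order $m$ with parameters $d>m$, $L>0$, $T_*\in(0,\infty]$: a real function $G=G(x,y,t)$ such that (i) $G\in C^{m}(\mathbb{R}^{2N}\times(0,T_* ))$; (ii) there is $C_G>0$ with $|\nabla_x^jG(x,y,t)|\le C_G\,t^{-\frac{N+j}{d}}(1+t^{-\frac1d}|x-y|)^{-N-L-j}$ for $(x,y,t)\in\mathbb{R}^{2N}\times(0,T_* )$, $j\in\{0,\dots,m\}$; (iii) $G(x,z,t)=\int_{\mathbb{R}^N}G(x,y,t-s)G(y,z,s)\,dy$ for $x,z\in\mathbb{R}^N$, $0<s<t<T_*$. Structure condition of order $0$ on $F$ (with $\ell=0$): (i) $F$ is a continuous real function on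 $\mathbb{R}^N\times[0,\infty)\times\mathbb{R}^{D_m}$; (ii) there exist $J\subset\{0,\dots,m\}$, ${\bf p}=\{p_j\}_{j\in J}\subset(0,\infty)$ and $A>-1$ such that $|{\bf p}|:=\sum_{j\in J}p_j>1$ and $|F(x,t,z_0,\dots,z_m)|\le t^A\prod_{j\in J}|z_j|^{p_j}$ for $(x,t)\in\mathbb{R}^N\times[0,\infty)$, $z_j\in\mathbb{R}^{N^j}$; (iii) with $\langle{\bf p}\rangle_0:=\sum_{j\in J}j\,p_j$, one has $d(1+A)>\langle{\bf p}\rangle_0$. Define $r_0:=\dfrac{N(|{\bf p}|-1)}{d(1+A)-\langle{\bf p}\rangle_0}$. Solution: $u$ is a solution of (I) in $\mathbb{R}^N\times[0,T)$, $0<T\le\infty$, if for every $\tau\in(0,T)$ and $j\in\{0,\dots,m\}$, $\nabla_x^ju$ exists and is bounded and continuous on $\mathbb{R}^N\times(\tau,T)$, and $u$ satisfies (I) for all $(x,t)\in\mathbb{R}^N\times(0,T)$. *)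

theory Defs
  imports "HOL-Analysis.Analysis"
begin

section \<open>Iterated partial derivatives\<close>

text \<open>\<open>pderivs [v\<^sub>1, \<dots>, v\<^sub>k] f\<close> is the iterated directional derivative
  \<open>\<partial>\<^sub>v\<^sub>1 (\<partial>\<^sub>v\<^sub>2 (\<dots> (\<partial>\<^sub>v\<^sub>k f)))\<close>; it is only meaningful where \<open>pderivs_exist\<close> holds.\<close>

primrec pderivs :: "'v::real_normed_vector list \<Rightarrow> ('v \<Rightarrow> real) \<Rightarrow> 'v \<Rightarrow> real" where
  "pderivs [] f = f"
| "pderivs (v # vs) f = (\<lambda>x. deriv (\<lambda>h. pderivs vs f (x + h *\<^sub>R v)) 0)"

primrec pderivs_exist :: "'v::real_normed_vector list \<Rightarrow> ('v \<Rightarrow> real) \<Rightarrow> 'v set \<Rightarrow> bool" where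
  "pderivs_exist [] f S \<longleftrightarrow> True"
| "pderivs_exist (v # vs) f S \<longleftrightarrow> pderivs_exist vs f S \<and>
     (\<forall>x\<in>S. (\<lambda>h. pderivs vs f (x + h *\<^sub>R v)) field_differentiable (at 0))"

text \<open>The class \<open>C\<^sup>k(S)\<close>, intended for open \<open>S\<close>.\<close>

definition Ck_on :: "nat \<Rightarrow> ('v::euclidean_space \<Rightarrow> real) \<Rightarrow> 'v set \<Rightarrow> bool" where
  "Ck_on k f S \<longleftrightarrow> (\<forall>vs. set vs \<subseteq> Basis \<and> length vs \<le> k \<longrightarrow>
     pderivs_exist vs f S \<and> continuous_on S (pderivs vs f))"

text \<open>On \<open>\<real>\<^sup>N\<close> with \<open>N = CARD('n)\<close>, the \<open>N\<^sup>j\<close> partial derivatives of order \<open>j\<close> are indexed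
  by the words of length \<open>j\<close> over the coordinate indices.\<close>

abbreviation dirs :: "'n list \<Rightarrow> (real^'n::finite) list" where
  "dirs \<alpha> \<equiv> map (\<lambda>i. axis i 1) \<alpha>"

text \<open>\<open>\<real>\<^bsup>D\<^sub>m\<^esup>\<close>, \<open>D\<^sub>m = \<Sum>j\<le>m. N\<^sup>j\<close>, consists of the families of reals indexed by the words of length at
  most \<open>m\<close>, extended by \<open>0\<close> to longer words. Its topology as a subspace of the product topology
  on functions is the Euclidean one. The component \<open>z\<^sub>j \<in> \<real>\<^bsup>N^j\<^esup>\<close> is the restriction of \<open>z\<close> to
  words of length \<open>j\<close>.\<close>

definition jet_space :: "nat \<Rightarrow> ('n::finite list \<Rightarrow> real) set" where
  "jet_space m = {z. \<forall>\<alpha>. m < length \<alpha> \<longrightarrow> z \<alpha> = 0}"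

definition jet :: "nat \<Rightarrow> (real^'n::finite \<Rightarrow> real) \<Rightarrow> real^'n \<Rightarrow> 'n list \<Rightarrow> real" where
  "jet m f x = (\<lambda>\<alpha>. if length \<alpha> \<le> m then pderivs (dirs \<alpha>) f x else 0)"

definition block_norm :: "nat \<Rightarrow> ('n::finite list \<Rightarrow> real) \<Rightarrow> real" where
  "block_norm j z = L2_set z {\<alpha>. length \<alpha> = j}"

definition grad_norm :: "nat \<Rightarrow> (real^'n::finite \<Rightarrow> real) \<Rightarrow> real^'n \<Rightarrow> real" where
  "grad_norm j f x = block_norm j (\<lambda>\<alpha>. pderivs (dirs \<alpha>) f x)"


section \<open>Morrey norm\<close>

definition locally_integrable :: "('v::euclidean_space \<Rightarrow> real) \<Rightarrow> bool" where
  "locally_integrable f \<longleftrightarrow> (\<forall>K. compact K \<longrightarrow> f absolutely_integrable_on K)"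

text \<open>Intended for exponents \<open>a > 0\<close> only.\<close>

definition ennreal_powr :: "ennreal \<Rightarrow> real \<Rightarrow> ennreal" where
  "ennreal_powr y a = (if y = \<infinity> then \<infinity> else ennreal (enn2real y powr a))"

definition morrey_norm :: "real \<Rightarrow> real \<Rightarrow> (real^'n::finite \<Rightarrow> real) \<Rightarrow> ennreal" where
  "morrey_norm r q f = (SUP x. SUP \<sigma>\<in>{0<..}.
     ennreal (\<sigma> powr (real CARD('n) / r)) *
     ennreal_powr ((\<integral>\<^sup>+y\<in>ball x \<sigma>. ennreal (\<bar>f y\<bar> powr q) \<partial>lebesgue) /
                   emeasure lebesgue (ball x \<sigma>)) (1 / q))"


section \<open>Kernel, nonlinearity and solutions\<close>

definition admissible_kernel ::
    "nat \<Rightarrow> real \<Rightarrow> real \<Rightarrow> ereal \<Rightarrow> (real^'n::finite \<Rightarrow> real^'n \<Rightarrow> real \<Rightarrow> real) \<Rightarrow> bool" where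
  "admissible_kernel m d L Tmax G \<longleftrightarrow>
     real m < d \<and> 0 < L \<and> 0 < Tmax \<and>
     Ck_on m (\<lambda>(x, y, t). G x y t) {(x, y, t). 0 < t \<and> ereal t < Tmax} \<and>
     (\<exists>C>0. \<forall>x y t. \<forall>j\<le>m. 0 < t \<and> ereal t < Tmax \<longrightarrow>
        grad_norm j (\<lambda>x. G x y t) x \<le>
          C * t powr (- (real CARD('n) + real j) / d) *
          (1 + t powr (- 1 / d) * norm (x - y)) powr (- real CARD('n) - L - real j)) \<and>
     (\<forall>x z s t. 0 < s \<and> s < t \<and> ereal t < Tmax \<longrightarrow>
        G x z t = (\<integral>y. G x y (t - s) * G y z s \<partial>lebesgue))"

text \<open>The growth bound is imposed for \<open>t > 0\<close>. At \<open>t = 0\<close> the factor \<open>t\<^sup>A\<close> is infinite for \<open>A < 0\<close>, and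
  for \<open>A \<ge> 0\<close> (with \<open>0\<^sup>0 = 1\<close>) the bound there follows by continuity of \<open>F\<close>; the library
  convention \<open>0 powr A = 0\<close> would instead force \<open>F\<close> to vanish at \<open>t = 0\<close>.\<close>

definition structure_condition ::
    "nat \<Rightarrow> real \<Rightarrow> nat set \<Rightarrow> (nat \<Rightarrow> real) \<Rightarrow> real \<Rightarrow>
     (real^'n::finite \<Rightarrow> real \<Rightarrow> ('n list \<Rightarrow> real) \<Rightarrow> real) \<Rightarrow> bool" where
  "structure_condition m d J p A F \<longleftrightarrow>
     continuous_on (UNIV \<times> {0..} \<times> jet_space m) (\<lambda>(x, t, z). F x t z) \<and>
     J \<subseteq> {0..m} \<and> (\<forall>j\<in>J. 0 < p j) \<and> - 1 < A \<and> 1 < (\<Sum>j\<in>J. p j) \<and>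
     (\<forall>x t. \<forall>z\<in>jet_space m. 0 < t \<longrightarrow>
        \<bar>F x t z\<bar> \<le> t powr A * (\<Prod>j\<in>J. block_norm j z powr p j)) \<and>
     (\<Sum>j\<in>J. real j * p j) < d * (1 + A)"

definition crit_exponent :: "nat \<Rightarrow> real \<Rightarrow> nat set \<Rightarrow> (nat \<Rightarrow> real) \<Rightarrow> real \<Rightarrow> real" where
  "crit_exponent N d J p A =
     real N * ((\<Sum>j\<in>J. p j) - 1) / (d * (1 + A) - (\<Sum>j\<in>J. real j * p j))"

text \<open>Besides the equation, existence of each integral occurring in it is required, since the
  Bochner integral of a non-integrable function is \<open>0\<close> by convention.\<close>

definition satisfies_integral_eq ::
    "nat \<Rightarrow> real \<Rightarrow> (real^'n::finite \<Rightarrow> real^'n \<Rightarrow> real \<Rightarrow> real) \<Rightarrow>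
     (real^'n \<Rightarrow> real \<Rightarrow> ('n list \<Rightarrow> real) \<Rightarrow> real) \<Rightarrow> (real^'n \<Rightarrow> real) \<Rightarrow>
     (real^'n \<Rightarrow> real \<Rightarrow> real) \<Rightarrow> real^'n \<Rightarrow> real \<Rightarrow> bool" where
  "satisfies_integral_eq m a0 G F \<phi> u x t \<longleftrightarrow>
     (let H = (\<lambda>s y. G x y (t - s) * F y s (jet m (\<lambda>y'. u y' s) y)) in
       integrable lebesgue (\<lambda>y. G x y t * \<phi> y) \<and>
       (\<forall>s\<in>{0<..<t}. integrable lebesgue (H s)) \<and>
       set_integrable lebesgue {0<..<t} (\<lambda>s. \<integral>y. H s y \<partial>lebesgue) \<and>
       u x t = (\<integral>y. G x y t * \<phi> y \<partial>lebesgue) +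
               a0 * (LINT s:{0<..<t}|lebesgue. \<integral>y. H s y \<partial>lebesgue))"

definition is_solution ::
    "nat \<Rightarrow> real \<Rightarrow> (real^'n::finite \<Rightarrow> real^'n \<Rightarrow> real \<Rightarrow> real) \<Rightarrow>
     (real^'n \<Rightarrow> real \<Rightarrow> ('n list \<Rightarrow> real) \<Rightarrow> real) \<Rightarrow> (real^'n \<Rightarrow> real) \<Rightarrow> ereal \<Rightarrow>
     (real^'n \<Rightarrow> real \<Rightarrow> real) \<Rightarrow> bool" where
  "is_solution m a0 G F \<phi> T u \<longleftrightarrow>
     (\<forall>\<tau>>0. ereal \<tau> < T \<longrightarrow> (\<forall>\<alpha>. length \<alpha> \<le> m \<longrightarrow>
        (let I = {t. \<tau> < t \<and> ereal t < T};
             D = (\<lambda>(x, t). pderivs (dirs \<alpha>) (\<lambda>x. u x t) x) in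
          (\<forall>t\<in>I. pderivs_exist (dirs \<alpha>) (\<lambda>x. u x t) UNIV) \<and>
          bounded (D ` (UNIV \<times> I)) \<and> continuous_on (UNIV \<times> I) D))) \<and>
     (\<forall>x t. 0 < t \<and> ereal t < T \<longrightarrow> satisfies_integral_eq m a0 G F \<phi> u x t)"

end

theory Submission
  imports Defs "HOL-Complex_Analysis.Great_Picard"
begin

text \<open>
  Let \<open>g\<^sub>t(z) = t\<^bsup>-N/d\<^esup> (1 + t\<^bsup>-1/d\<^esup>|z|)\<^bsup>-N-L\<^esup>\<close> be the envelope of the kernel; up to a constant,
  \<open>g\<^sub>r * g\<^sub>s \<le> g\<^bsub>r+s\<^esub>\<close>. Choose \<open>1 < \<beta> \<le> q\<close> with \<open>\<beta> < |p|\<close>, let \<open>H(x,t) = (g\<^sub>t * |\<phi>|\<^bsup>\<beta>\<^esup>)(x)\<close> and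
  \<open>h = H\<^bsup>1/\<beta>\<^esup>\<close>. The Morrey bound gives \<open>h \<le> c \<gamma> t\<^bsup>-N/(d r\<^sub>0)\<^esup>\<close>, and Jensen's inequality bounds the
  \<open>j\<close>-th derivatives of the linear part by \<open>t\<^bsup>-j/d\<^esup> h\<close>. If \<open>|\<nabla>\<^sup>j u| \<le> R t\<^bsup>-j/d\<^esup> h\<close> for all \<open>j\<close>, then
  \<open>|F(y,s,\<dots>)| \<le> c \<gamma>\<^bsup>|p|-\<beta>\<^esup> s\<^bsup>\<delta>-1\<^esup> H(y,s)\<close> with \<open>\<delta> = (\<beta>-1)N/(d r\<^sub>0) > 0\<close>; this is where \<open>q > 1\<close>
  makes the time singularity integrable. The near-semigroup property turns the Duhamel term into at
  most \<open>c \<gamma>\<^bsup>|p|-1\<^esup> t\<^bsup>-j/d\<^esup> h\<close>, so for small \<open>\<gamma>\<close> these bounds are preserved.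

  As \<open>F\<close> is merely continuous, the solution is obtained by compactness: the equation with a time delay is
  solved by finitely many iterations, the Duhamel integrals of all sources below a fixed multiple of
  \<open>s\<^bsup>\<delta>-1\<^esup> H\<close> are equicontinuous at every point, and a pointwise convergent subsequence of delayed
  solutions yields a solution by dominated convergence. The approximations are families of functions
  indexed by words of derivatives; only in the limit are the components identified with derivatives of
  a single function.
\<close>

section \<open>Polynomially decaying kernels\<close>

text \<open>The obstacle is scale invariance. With e = N/(d r_0), the definition of r_0 says e (|p|
  - 1) = 1 + A - <p>_0/d. If each factor of F is bounded only by a multiple of s^(-j/d) s^(-e), the
  source bound is s^(A - <p>_0/d - e|p|) = s^(-1-e), which is not integrable at s = 0. So the bound
  has to retain the spatial profile of the datum: of the |p| powers of h only |p| - \<beta> are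
  traded for powers of s, while h^\<beta> = H is linear in |\<phi>|^\<beta>, and convolving it with
  the kernel costs a constant but no power of time. Integration in time leaves t^\<delta> H =
  t^\<delta> h^(\<beta>-1) h, and the bound for h^(\<beta>-1) cancels t^\<delta> exactly. No power
  of t remains, so one smallness condition serves for all times.

  Compactness gives a limit for each word separately. What links the limits is the kernel: every
  component satisfies its own integral equation, all with the same source, and the kernel of
  \<open>i # \<alpha>\<close> is the derivative of the kernel of \<open>\<alpha>\<close>.\<close>

definition decay_kernel :: "real \<Rightarrow> real \<Rightarrow> real \<Rightarrow> 'a::euclidean_space \<Rightarrow> real" where
  "decay_kernel d L t z =
     t powr (- real DIM('a) / d) * (1 + t powr (- 1 / d) * norm z) powr (- real DIM('a) - L)"

lemma decay_kernel_nonneg [simp]: "0 \<le> decay_kernel d L t z"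
  by (simp add: decay_kernel_def)

lemma measurable_decay_kernel [measurable (raw)]:
  assumes [measurable]: "f \<in> borel_measurable M" "g \<in> borel_measurable M"
  shows "(\<lambda>x. decay_kernel d L (f x) (g x :: 'a::euclidean_space)) \<in> borel_measurable M"
  unfolding decay_kernel_def by measurable

text \<open>Balls rather than annuli stand on the right, because the densities met later are
  controlled only on balls. A single term suffices: for the least k with
  \<open>norm z < 2 ^ k * \<tau>\<close>, the point lies outside the previous ball, where the kernel
  has decayed by the factor in the coefficient; for k = 0 the coefficient exceeds the maximum of the
  kernel.\<close>

lemma decay_kernel_le_shells:
  fixes z :: "'a::euclidean_space"
  assumes "0 < t" "0 < d" "0 < L"
  defines "N \<equiv> real DIM('a)" and "\<tau> \<equiv> t powr (1 / d)"
  shows "ennreal (decay_kernel d L t z) \<le>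
    (\<Sum>k. ennreal (\<tau> powr (- N) * 2 powr ((1 - real k) * (N + L))) * indicator {z. norm z < 2 ^ k * \<tau>} z)"
proof -
  define f where "f k = ennreal (\<tau> powr (- N) * 2 powr ((1 - real k) * (N + L))) * indicator {z. norm z < 2 ^ k * \<tau>} z" for k
  have \<tau>: "\<tau> > 0" using assms by (simp add: \<tau>_def)
  have t1: "t powr (- N / d) = \<tau> powr (- N)" "t powr (-1 / d) = 1 / \<tau>"
    using assms by (auto simp: \<tau>_def powr_powr powr_minus_divide)
  have ge: "decay_kernel d L t z = \<tau> powr (- N) * (1 + norm z / \<tau>) powr (- N - L)"
    unfolding decay_kernel_def N_def[symmetric] t1 by simp
  have ex: "\<exists>k::nat. norm z < 2 ^ k * \<tau>"
    using real_arch_pow[of 2 "norm z / \<tau>"] \<tau> by (auto simp: field_simps)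
  define k where "k = (LEAST k::nat. norm z < 2 ^ k * \<tau>)"
  have k: "norm z < 2 ^ k * \<tau>" unfolding k_def using ex by (rule LeastI_ex)
  have "decay_kernel d L t z \<le> \<tau> powr (- N) * 2 powr ((1 - real k) * (N + L))"
  proof (cases k)
    case 0
    have "(1 + norm z / \<tau>) powr (- N - L) \<le> 1 powr (- N - L)"
      using \<tau> assms by (intro powr_mono2') (auto simp: N_def)
    also have "\<dots> \<le> 2 powr (N + L)" using assms by (simp add: ge_one_powr_ge_zero N_def)
    finally show ?thesis unfolding ge 0 by (simp add: mult_left_mono)
  next
    case (Suc i)
    have "\<not> norm z < 2 ^ i * \<tau>" using Suc unfolding k_def by (metis not_less_Least lessI)
    then have "2 ^ i \<le> 1 + norm z / \<tau>" using \<tau> by (simp add: field_simps)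
    then have "(1 + norm z / \<tau>) powr (- N - L) \<le> (2 ^ i) powr (- N - L)"
      using assms by (intro powr_mono2') (auto simp: N_def)
    also have "\<dots> = 2 powr (real i * (- N - L))"
      by (simp add: powr_realpow[symmetric] powr_powr)
    also have "real i * (- N - L) = (1 - real k) * (N + L)"
      unfolding Suc by (simp add: algebra_simps)
    finally show ?thesis unfolding ge by (simp add: mult_left_mono)
  qed
  then have "ennreal (decay_kernel d L t z) \<le> f k"
    using k by (simp add: ennreal_leI f_def)
  also have "\<dots> \<le> suminf f"
    using sum_le_suminf[of f "{k}"] by simp
  finally show ?thesis unfolding f_def .
qed

text \<open>The coefficient of the k-th ball times its mass
  \<open>\<kappa> * (2 ^ k * \<tau>) powr (N - b)\<close> is a geometric sequence of ratio
  \<open>2 powr (- (L + b))\<close>, hence the denominator of the constant; the powers of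
  \<open>\<tau>\<close> combine to \<open>t powr (- b / d)\<close>.\<close>

lemma ball_growth_decay_kernel_bound:
  fixes \<psi> :: "'a::euclidean_space \<Rightarrow> real"
  assumes "0 < d" "0 < L" "0 \<le> b"
  defines "N \<equiv> real DIM('a)"
  assumes [measurable]: "\<psi> \<in> borel_measurable borel"
    and growth: "\<And>x \<sigma>. 0 < \<sigma> \<Longrightarrow> (\<integral>\<^sup>+z. ennreal (\<psi> z) * indicator (ball x \<sigma>) z \<partial>lborel) \<le> ennreal (\<kappa> * \<sigma> powr (N - b))"
    and "0 \<le> \<kappa>" "0 < t"
  shows "(\<integral>\<^sup>+z. ennreal (decay_kernel d L t (x - z)) * ennreal (\<psi> z) \<partial>lborel)
    \<le> ennreal (2 powr (N + L) / (1 - 2 powr (- (L + b))) * \<kappa> * t powr (- b / d))"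
proof -
  define \<tau> where "\<tau> = t powr (1 / d)"
  have \<tau>: "\<tau> > 0" using assms by (simp add: \<tau>_def)
  define c where "c k = \<tau> powr (- N) * 2 powr ((1 - real k) * (N + L))" for k
  have c0: "0 \<le> c k" for k by (simp add: c_def)
  define r where "r = 2 powr (- (L + b))"
  have r: "0 < r" "r < 1" using assms by (auto simp: r_def powr_less_one)
  have m: "(\<lambda>z. ennreal (\<psi> z) * indicator (ball x s) z) \<in> borel_measurable borel" for s
    by (intro borel_measurable_times_ennreal borel_measurable_indicator) measurable
  have "(\<integral>\<^sup>+z. ennreal (decay_kernel d L t (x - z)) * ennreal (\<psi> z) \<partial>lborel)
      \<le> (\<integral>\<^sup>+z. (\<Sum>k. ennreal (c k) * indicator {z. norm z < 2 ^ k * \<tau>} (x - z)) * ennreal (\<psi> z) \<partial>lborel)"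
    using decay_kernel_le_shells[OF \<open>0 < t\<close> \<open>0 < d\<close> \<open>0 < L\<close>]
    unfolding c_def \<tau>_def N_def by (intro nn_integral_mono mult_right_mono) auto
  also have "\<dots> = (\<integral>\<^sup>+z. (\<Sum>k. ennreal (c k) * (ennreal (\<psi> z) * indicator (ball x (2 ^ k * \<tau>)) z)) \<partial>lborel)"
    by (auto intro!: nn_integral_cong simp: ennreal_suminf_multc[symmetric] indicator_def dist_norm ac_simps)
  also have "\<dots> = (\<Sum>k. ennreal (c k) * (\<integral>\<^sup>+z. (ennreal (\<psi> z) * indicator (ball x (2 ^ k * \<tau>)) z) \<partial>lborel))"
  proof (subst nn_integral_suminf)
    show "(\<lambda>z. ennreal (c k) * (ennreal (\<psi> z) * indicator (ball x (2 ^ k * \<tau>)) z)) \<in> borel_measurable lborel" for k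
      using borel_measurable_times_ennreal[OF borel_measurable_const m] by simp
    show "(\<Sum>k. \<integral>\<^sup>+z. ennreal (c k) * (ennreal (\<psi> z) * indicator (ball x (2 ^ k * \<tau>)) z) \<partial>lborel)
      = (\<Sum>k. ennreal (c k) * (\<integral>\<^sup>+z. (ennreal (\<psi> z) * indicator (ball x (2 ^ k * \<tau>)) z) \<partial>lborel))"
      by (intro suminf_cong nn_integral_cmult) (simp add: m)
  qed
  also have "\<dots> \<le> (\<Sum>k. ennreal (c k) * ennreal (\<kappa> * (2 ^ k * \<tau>) powr (N - b)))"
    using \<tau> by (intro suminf_le mult_left_mono growth) auto
  also have "\<dots> = (\<Sum>k. ennreal (2 powr (N + L) * \<kappa> * t powr (- b / d) * r ^ k))"
  proof -
    have eq: "c k * (\<kappa> * (2 ^ k * \<tau>) powr (N - b)) = 2 powr (N + L) * \<kappa> * t powr (- b / d) * r ^ k" for k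
    proof -
      have 1: "r ^ k = 2 powr (- (L + b) * real k)"
        by (simp add: r_def powr_realpow[symmetric] powr_powr)
      have 2: "(2 ^ k * \<tau>) powr (N - b) = 2 powr (real k * (N - b)) * \<tau> powr (N - b)"
        using \<tau> by (simp add: powr_mult powr_realpow[symmetric] powr_powr)
      have 3: "t powr (- b / d) = \<tau> powr (- N) * \<tau> powr (N - b)"
        using assms by (simp add: \<tau>_def powr_powr powr_add[symmetric] field_simps)
      have 4: "2 powr ((1 - real k) * (N + L)) * 2 powr (real k * (N - b)) = 2 powr (N + L) * 2 powr (- (L + b) * real k)"
        unfolding powr_add[symmetric] by (rule arg_cong[where f = "\<lambda>e. 2 powr e"]) (simp add: algebra_simps)
      have "c k * (\<kappa> * (2 ^ k * \<tau>) powr (N - b))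
          = (2 powr ((1 - real k) * (N + L)) * 2 powr (real k * (N - b))) * \<kappa> * (\<tau> powr (- N) * \<tau> powr (N - b))"
        unfolding c_def 2 by (simp only: mult_ac)
      also have "\<dots> = 2 powr (N + L) * \<kappa> * t powr (- b / d) * r ^ k"
        unfolding 1 3 4 by (simp only: mult_ac)
      finally show ?thesis .
    qed
    show ?thesis
      unfolding eq[symmetric] by (intro suminf_cong ennreal_mult[symmetric] c0) (simp add: \<open>0 \<le> \<kappa>\<close>)
  qed
  also have "\<dots> = ennreal (2 powr (N + L) * \<kappa> * t powr (- b / d) * (1 / (1 - r)))"
    using r assms by (intro suminf_ennreal_eq sums_mult geometric_sums) auto
  finally show ?thesis by (simp add: r_def field_simps)
qed

lemma emeasure_lborel_ball:
  "0 \<le> r \<Longrightarrow> emeasure lborel (ball (x::'a::euclidean_space) r) = ennreal (unit_ball_vol DIM('a) * r powr DIM('a))"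
  by (cases "r = 0") (simp_all add: emeasure_ball powr_realpow)

text \<open>Lebesgue measure is the case b = 0 of the growth bound, for which the power of t
  disappears; L > 0 then still makes the series converge.\<close>

lemma decay_kernel_mass:
  assumes "0 < d" "0 < L"
  shows "\<exists>S>0. \<forall>t>0. \<forall>x::'a::euclidean_space. (\<integral>\<^sup>+z. ennreal (decay_kernel d L t (x - z)) \<partial>lborel) \<le> ennreal S"
proof -
  let ?S = "2 powr (real DIM('a) + L) / (1 - 2 powr (- L)) * unit_ball_vol DIM('a)"
  have "2 powr (- L) < 1" using assms by (simp add: powr_less_one)
  then have "0 < ?S" by simp
  moreover have "(\<integral>\<^sup>+z. ennreal (decay_kernel d L t (x - z)) \<partial>lborel) \<le> ennreal ?S" if "t > 0" for t and x :: 'a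
    using ball_growth_decay_kernel_bound[where 'a = 'a and b = 0 and \<psi> = "\<lambda>_. 1" and \<kappa> = "unit_ball_vol DIM('a)", OF assms] that
    by (simp add: emeasure_lborel_ball)
  ultimately show ?thesis by blast
qed

text \<open>A shift by at most \<open>t powr (1 / d)\<close> changes
  \<open>1 + t powr (- 1 / d) * norm z\<close> by a factor of at most 2, and a change of time by a
  factor 2 costs \<open>2 powr (1 / d)\<close>. This supplies dominated convergence with one
  majorant, centred at a fixed point, for all nearby evaluation points.\<close>

lemma decay_kernel_comparable:
  fixes z z' :: "'a::euclidean_space"
  assumes "0 < d" "0 < L" "0 < t" "t / 2 \<le> t'" "t' \<le> 2 * t" "norm (z - z') \<le> t powr (1 / d)"
  shows "decay_kernel d L t' z' \<le>
    2 powr (real DIM('a) / d) * (2 * 2 powr (1 / d)) powr (real DIM('a) + L) * decay_kernel d L t z"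
proof -
  define N where "N = real DIM('a)"
  have t': "t' > 0" using assms by simp
  have a: "t' powr (- N / d) \<le> 2 powr (N / d) * t powr (- N / d)"
  proof -
    have "t' powr (- N / d) \<le> (t / 2) powr (- N / d)"
      using assms t' by (intro powr_mono2') (auto simp: N_def)
    also have "\<dots> = 2 powr (N / d) * t powr (- N / d)"
      using assms by (simp add: powr_divide powr_minus_divide)
    finally show ?thesis .
  qed
  have b: "1 + t powr (- 1 / d) * norm z \<le> 2 * 2 powr (1 / d) * (1 + t' powr (- 1 / d) * norm z')"
  proof -
    have "t powr (-1 / d) * norm z \<le> t powr (- 1 / d) * (norm z' + t powr (1 / d))"
      using assms(6) norm_triangle_sub[of z z'] by (intro mult_left_mono) auto
    also have "\<dots> = t powr (- 1 / d) * norm z' + 1"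
      using assms by (simp add: distrib_left powr_add[symmetric])
    finally have 1: "1 + t powr (-1 / d) * norm z \<le> 2 * (1 + t powr (- 1 / d) * norm z')" 
      using zero_le_mult_iff[of "t powr (-1/d)" "norm z'"] by (smt (verit) norm_ge_zero powr_ge_zero)
    have "t powr (- 1 / d) \<le> (t' / 2) powr (- 1 / d)"
      using assms t' by (intro powr_mono2') auto
    also have "\<dots> = 2 powr (1 / d) * t' powr (- 1 / d)"
      using t' by (simp add: powr_divide powr_minus_divide)
    finally have "t powr (- 1 / d) * norm z' \<le> 2 powr (1 / d) * t' powr (- 1 / d) * norm z'"
      by (rule mult_right_mono) simp
    moreover have "1 \<le> 2 powr (1 / d)" using assms by (simp add: ge_one_powr_ge_zero)
    ultimately have "1 + t powr (- 1 / d) * norm z' \<le> 2 powr (1 / d) * (1 + t' powr (- 1 / d) * norm z')"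
      by (simp add: algebra_simps)
    then show ?thesis using 1 by simp
  qed
  have c: "(1 + t' powr (- 1 / d) * norm z') powr (- N - L) \<le>
     (2 * 2 powr (1 / d)) powr (N + L) * (1 + t powr (- 1 / d) * norm z) powr (- N - L)"
  proof -
    have p: "1 + t powr (- 1 / d) * norm z > 0" by (simp add: add_pos_nonneg)
    have "(1 + t' powr (- 1 / d) * norm z') powr (- N - L) \<le>
       ((1 + t powr (- 1 / d) * norm z) / (2 * 2 powr (1 / d))) powr (- N - L)"
      using b p assms by (intro powr_mono2') (auto simp: N_def field_simps)
    also have "\<dots> = (2 * 2 powr (1 / d)) powr (N + L) * (1 + t powr (- 1 / d) * norm z) powr (- N - L)"
    proof -
      have "(A / B) powr (- N - L) = B powr (N + L) * A powr (- N - L)" if "A > 0" "B > 0" for A B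
        using that powr_minus_divide[of B "N + L"] by (simp add: powr_divide)
      then show ?thesis using p by simp
    qed
    finally show ?thesis .
  qed
  show ?thesis unfolding decay_kernel_def N_def[symmetric]
    using mult_mono[OF a c] by (simp add: mult_ac)
qed

lemma decay_kernel_minus_commute: "decay_kernel d L t (x - y) = decay_kernel d L t (y - x)"
  by (simp add: decay_kernel_def norm_minus_commute)

text \<open>The alternatives are the tail and the core of \<open>decay_kernel d L T\<close>. In the
  tail the left side is at most a multiple of \<open>a powr (L / d) * norm w powr (- N - L)\<close>,
  which increases with a, so \<open>a \<le> T\<close> suffices however small a is. In the core
  \<open>decay_kernel d L T w\<close> is comparable to \<open>T powr (- N / d)\<close>, and
  \<open>T / 2 \<le> a\<close> bounds the maximum of the left side by the same power.\<close>

lemma decay_kernel_le_off_diagonal: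
  fixes u w :: "'a::euclidean_space"
  assumes "0 < d" "0 < L" "0 < a" "a \<le> T"
    and "norm w / 2 \<le> norm u \<and> T powr (1 / d) \<le> norm w \<or> norm w < T powr (1 / d) \<and> T / 2 \<le> a"
  shows "decay_kernel d L a u \<le>
    (4 powr (real DIM('a) + L) + 2 powr (real DIM('a) / d) * 2 powr (real DIM('a) + L)) * decay_kernel d L T w"
proof -
  define N where "N = real DIM('a)"
  have N: "N \<ge> 0" by (simp add: N_def)
  have T: "T > 0" using assms by simp
  have neg: "(A / c) powr (- N - L) = c powr (N + L) * A powr (- N - L)" if "A > 0" "c > 0" for A c
    using that powr_minus_divide[of c "N + L"] by (simp add: powr_divide)
  have key: "x powr (- N / d) * (x powr (- 1 / d) * W) powr (- N - L) = x powr (L / d) * W powr (- N - L)"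
    if "x > 0" "W > 0" for x W :: real
  proof -
    have e: "- N / d + (- 1 / d) * (- N - L) = L / d" using assms by (simp add: field_simps)
    have "x powr (- N / d) * (x powr (- 1 / d) * W) powr (- N - L)
        = x powr (- N / d + (- 1 / d) * (- N - L)) * W powr (- N - L)"
      unfolding powr_add using that by (simp add: powr_mult powr_powr)
    then show ?thesis unfolding e .
  qed
  let ?g = "decay_kernel d L"
  from assms(5) show ?thesis
  proof
    assume *: "norm w / 2 \<le> norm u \<and> T powr (1 / d) \<le> norm w"
    have w: "norm w > 0" using * T by (smt (verit) powr_gt_zero)
    have "?g a u \<le> a powr (- N / d) * (a powr (- 1 / d) * norm w / 2) powr (- N - L)"
      unfolding decay_kernel_def N_def[symmetric]
    proof (intro mult_left_mono powr_mono2')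
      have "a powr (- 1 / d) * (norm w / 2) \<le> a powr (- 1 / d) * norm u"
        using * by (intro mult_left_mono) auto
      then show "a powr (- 1 / d) * norm w / 2 \<le> 1 + a powr (- 1 / d) * norm u" by simp
    qed (use assms w N in auto)
    also have "\<dots> = 2 powr (N + L) * (a powr (L / d) * norm w powr (- N - L))"
      using w assms key[of a "norm w"] neg[of "a powr (- 1 / d) * norm w" 2] by simp
    also have "\<dots> \<le> 2 powr (N + L) * (T powr (L / d) * norm w powr (- N - L))"
      using assms by (intro mult_left_mono mult_right_mono powr_mono2) auto
    also have "T powr (L / d) * norm w powr (- N - L) = T powr (- N / d) * (T powr (-1 / d) * norm w) powr (- N - L)"
      using key[of T "norm w"] w T by simp
    also have "(T powr (-1 / d) * norm w) powr (- N - L) \<le> ((1 + T powr (-1 / d) * norm w) / 2) powr (- N - L)"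
    proof (intro powr_mono2')
      have "T powr (-1 / d) * T powr (1 / d) \<le> T powr (-1 / d) * norm w"
        using * by (intro mult_left_mono) auto
      moreover have "T powr (-1 / d) * T powr (1 / d) = 1" using T by (simp add: powr_add[symmetric])
      ultimately have "1 \<le> T powr (-1 / d) * norm w" by linarith
      moreover have "(1 + X) / 2 \<le> X" if "1 \<le> X" for X :: real using that by simp
      ultimately show "(1 + T powr (-1 / d) * norm w) / 2 \<le> T powr (-1 / d) * norm w" by blast
    qed (use assms w N in \<open>auto intro!: add_pos_nonneg\<close>)
    also have "\<dots> = 2 powr (N + L) * (1 + T powr (-1 / d) * norm w) powr (- N - L)"
      by (intro neg add_pos_nonneg) auto
    also have "2 powr (N + L) * (T powr (- N / d) * (2 powr (N + L) * (1 + T powr (-1 / d) * norm w) powr (- N - L)))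
       = 4 powr (N + L) * ?g T w"
      using powr_mult[of 2 2 "N + L"] by (simp add: decay_kernel_def N_def)
    finally have "?g a u \<le> 4 powr (N + L) * ?g T w" by (simp add: mult_left_mono)
    then show ?thesis unfolding N_def distrib_right by (rule order_trans) simp
  next
    assume *: "norm w < T powr (1 / d) \<and> T / 2 \<le> a"
    have "?g a u \<le> a powr (- N / d) * 1 powr (- N - L)"
      unfolding decay_kernel_def N_def[symmetric]
      using N assms by (intro mult_left_mono powr_mono2') auto
    also have "\<dots> = a powr (- N / d)" by simp
    also have "\<dots> \<le> (T / 2) powr (- N / d)"
      using * T N assms by (intro powr_mono2') auto
    also have "\<dots> = 2 powr (N / d) * T powr (- N / d)"
      using T by (simp add: powr_divide powr_minus_divide)
    also have "T powr (- N / d) \<le> 2 powr (N + L) * ?g T w"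
    proof -
      have "T powr (-1 / d) * norm w \<le> T powr (-1 / d) * T powr (1 / d)"
        using * by (intro mult_left_mono) auto
      then have 1: "(1 + T powr (-1 / d) * norm w) / 2 \<le> 1" using T by (simp add: powr_add[symmetric])
      have p: "0 < 1 + T powr (-1 / d) * norm w" by (intro add_pos_nonneg) auto
      have "1 powr (- N - L) \<le> ((1 + T powr (-1 / d) * norm w) / 2) powr (- N - L)"
        using 1 p N assms by (intro powr_mono2') auto
      also have "\<dots> = 2 powr (N + L) * (1 + T powr (-1 / d) * norm w) powr (- N - L)"
        using p by (intro neg) auto
      finally have "T powr (- N / d) * 1 \<le> T powr (- N / d) * (2 powr (N + L) * (1 + T powr (-1 / d) * norm w) powr (- N - L))"
        by (intro mult_left_mono) auto
      then show ?thesis by (simp add: decay_kernel_def N_def mult_ac)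
    qed
    finally have "?g a u \<le> 2 powr (N / d) * 2 powr (N + L) * ?g T w" by (simp add: mult_left_mono)
    then show ?thesis unfolding N_def distrib_right by (rule order_trans) simp
  qed
qed

text \<open>One of x - y and y - z is at least half as long as x - z, and one of a and b is at least
  half of their sum. So for every y one factor is at most a multiple of
  \<open>decay_kernel d L (a + b) (x - z)\<close>, and the other has integral at most S. Adding both
  kernels in \<open>pt\<close> avoids splitting the domain of integration.\<close>

lemma decay_kernel_convolution:
  assumes "0 < d" "0 < L"
  shows "\<exists>C>0. \<forall>a>0. \<forall>b>0. \<forall>x z :: 'a::euclidean_space.
    (\<integral>\<^sup>+y. ennreal (decay_kernel d L a (x - y)) * ennreal (decay_kernel d L b (y - z)) \<partial>lborel)
      \<le> ennreal (C * decay_kernel d L (a + b) (x - z))"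
proof -
  obtain S where "S > 0" and S: "\<And>t (x::'a). t > 0 \<Longrightarrow> (\<integral>\<^sup>+z. ennreal (decay_kernel d L t (x - z)) \<partial>lborel) \<le> ennreal S"
    using decay_kernel_mass[OF assms, where 'a = 'a] by metis
  define c where "c = 4 powr (real DIM('a) + L) + 2 powr (real DIM('a) / d) * 2 powr (real DIM('a) + L)"
  have c: "c > 0" by (simp add: c_def add_pos_pos)
  have "(\<integral>\<^sup>+y. ennreal (decay_kernel d L a (x - y)) * ennreal (decay_kernel d L b (y - z)) \<partial>lborel)
      \<le> ennreal (2 * c * S * decay_kernel d L (a + b) (x - z))" if ab: "a > 0" "b > 0" for a b and x z :: 'a
  proof -
    define T where "T = a + b"
    let ?g = "decay_kernel d L"
    have pt: "?g a (x - y) * ?g b (y - z) \<le> c * ?g T (x - z) * (?g a (x - y) + ?g b (y - z))" for y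
    proof -
      have tri: "norm (x - z) \<le> norm (x - y) + norm (y - z)"
        using norm_triangle_ineq[of "x - y" "y - z"] by simp
      consider "norm (x - z) / 2 \<le> norm (x - y) \<and> T powr (1 / d) \<le> norm (x - z) \<or> norm (x - z) < T powr (1 / d) \<and> T / 2 \<le> a"
        | "norm (x - z) / 2 \<le> norm (y - z) \<and> T powr (1 / d) \<le> norm (x - z) \<or> norm (x - z) < T powr (1 / d) \<and> T / 2 \<le> b"
        using tri ab unfolding T_def by argo
      then show ?thesis
      proof cases
        case 1
        have "?g a (x - y) \<le> c * ?g T (x - z)"
          unfolding c_def using ab by (intro decay_kernel_le_off_diagonal assms 1) (auto simp: T_def)
        then have "?g a (x - y) * ?g b (y - z) \<le> c * ?g T (x - z) * ?g b (y - z)"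
          by (intro mult_right_mono) auto
        moreover have "0 \<le> c * ?g T (x - z) * ?g a (x - y)" using c by simp
        ultimately show ?thesis by (simp add: distrib_left)
      next
        case 2
        have "?g b (y - z) \<le> c * ?g T (x - z)"
          unfolding c_def using ab by (intro decay_kernel_le_off_diagonal assms 2) (auto simp: T_def)
        then have "?g a (x - y) * ?g b (y - z) \<le> ?g a (x - y) * (c * ?g T (x - z))"
          by (intro mult_left_mono) auto
        moreover have "0 \<le> c * ?g T (x - z) * ?g b (y - z)" using c by simp
        ultimately show ?thesis by (simp add: distrib_left mult_ac)
      qed
    qed
    have "(\<integral>\<^sup>+y. ennreal (?g a (x - y)) * ennreal (?g b (y - z)) \<partial>lborel)
       \<le> (\<integral>\<^sup>+y. ennreal (c * ?g T (x - z)) * (ennreal (?g a (x - y)) + ennreal (?g b (y - z))) \<partial>lborel)"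
      using pt c by (intro nn_integral_mono) (simp add: ennreal_mult[symmetric] ennreal_plus[symmetric] ennreal_leI del: ennreal_plus)
    also have "\<dots> = ennreal (c * ?g T (x - z)) * ((\<integral>\<^sup>+y. ennreal (?g a (x - y)) \<partial>lborel) + (\<integral>\<^sup>+y. ennreal (?g b (z - y)) \<partial>lborel))"
      by (simp add: nn_integral_cmult nn_integral_add decay_kernel_minus_commute[of d L b z])
    also have "\<dots> \<le> ennreal (c * ?g T (x - z)) * (ennreal S + ennreal S)"
      using ab by (intro mult_left_mono add_mono S) auto
    also have "\<dots> = ennreal (2 * c * S * ?g T (x - z))"
      using \<open>S > 0\<close> c by (simp add: ennreal_plus[symmetric] ennreal_mult[symmetric] mult_ac del: ennreal_plus)
    finally show ?thesis unfolding T_def .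
  qed
  moreover have "2 * c * S > 0" using c \<open>S > 0\<close> by simp
  ultimately show ?thesis by blast
qed

section \<open>Time integrals with singularities at both ends\<close>

lemma Beta_real_nonneg: "0 < x \<Longrightarrow> 0 < y \<Longrightarrow> 0 \<le> Beta x (y :: real)"
  by (simp add: Beta_def)

lemma nn_integral_Beta_scaled:
  fixes a \<delta> t :: real
  assumes "a < 1" "0 < \<delta>" "0 < t"
  shows "(\<integral>\<^sup>+s. ennreal (indicator {0<..<t} s * ((t - s) powr (- a) * s powr (\<delta> - 1))) \<partial>lborel)
    = ennreal (Beta \<delta> (1 - a) * t powr (\<delta> - a))"
proof -
  let ?f = "\<lambda>r::real. r powr (\<delta> - 1) * (1 - r) powr (- a)"
  have hi: "(?f has_integral Beta \<delta> (1 - a)) {0<..<1}"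
    using has_integral_Beta_real[of \<delta> "1 - a"] assms by (simp add: has_integral_Icc_iff_Ioo)
  have B: "(\<integral>\<^sup>+r. ennreal (indicator {0<..<1} r * ?f r) \<partial>lborel) = ennreal (Beta \<delta> (1 - a))"
  proof (rule nn_integral_has_integral_lborel)
    have "(\<lambda>r. indicator {0<..<1} r * ?f r) = (\<lambda>r. if r \<in> {0<..<1} then ?f r else 0)"
      by (auto simp: indicator_def)
    then show "((\<lambda>r. indicator {0<..<1} r * ?f r) has_integral Beta \<delta> (1 - a)) UNIV"
      using hi by (simp only: has_integral_restrict_UNIV)
  qed auto
  have "(\<integral>\<^sup>+s. ennreal (indicator {0<..<t} s * ((t - s) powr (- a) * s powr (\<delta> - 1))) \<partial>lborel)
     = ennreal t * (\<integral>\<^sup>+r. ennreal (indicator {0<..<t} (0 + t * r) * ((t - (0 + t * r)) powr (- a) * (0 + t * r) powr (\<delta> - 1))) \<partial>lborel)"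
    using assms by (subst nn_integral_real_affine[where t = 0 and c = t]) auto
  also have "(\<integral>\<^sup>+r. ennreal (indicator {0<..<t} (0 + t * r) * ((t - (0 + t * r)) powr (- a) * (0 + t * r) powr (\<delta> - 1))) \<partial>lborel)
     = (\<integral>\<^sup>+r. ennreal (t powr (\<delta> - a - 1)) * ennreal (indicator {0<..<1} r * ?f r) \<partial>lborel)"
  proof (intro nn_integral_cong)
    fix r :: real
    show "ennreal (indicator {0<..<t} (0 + t * r) * ((t - (0 + t * r)) powr (- a) * (0 + t * r) powr (\<delta> - 1)))
      = ennreal (t powr (\<delta> - a - 1)) * ennreal (indicator {0<..<1} r * ?f r)"
    proof (cases "0 < r \<and> r < 1")
      case True
      have "(t - t * r) powr (- a) = t powr (- a) * (1 - r) powr (- a)"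
        using True assms powr_mult[of t "1 - r" "- a"] by (simp add: right_diff_distrib)
      moreover have "t powr (\<delta> - a - 1) = t powr (- a) * t powr (\<delta> - 1)"
        by (simp add: powr_add[symmetric] algebra_simps)
      ultimately show ?thesis
        using True assms by (simp add: ennreal_mult[symmetric] powr_mult)
    next
      case False
      then show ?thesis using assms by (auto simp: indicator_def zero_less_mult_iff)
    qed
  qed
  also have "\<dots> = ennreal (t powr (\<delta> - a - 1)) * ennreal (Beta \<delta> (1 - a))"
    by (subst nn_integral_cmult) (simp_all add: B)
  also have "ennreal t * \<dots> = ennreal (t * (t powr (\<delta> - a - 1) * Beta \<delta> (1 - a)))"
    using assms by (simp add: ennreal_mult[symmetric] Beta_real_nonneg)
  also have "t * (t powr (\<delta> - a - 1) * Beta \<delta> (1 - a)) = Beta \<delta> (1 - a) * t powr (\<delta> - a)"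
    using powr_mult_base[of t "\<delta> - a - 1"] assms by simp
  finally show ?thesis .
qed

section \<open>Potentials of densities with ball growth\<close>

definition potential :: "real \<Rightarrow> real \<Rightarrow> ('a::euclidean_space \<Rightarrow> real) \<Rightarrow> real \<Rightarrow> 'a \<Rightarrow> ennreal" where
  "potential d L \<psi> t x = (\<integral>\<^sup>+z. ennreal (decay_kernel d L t (x - z)) * ennreal (\<psi> z) \<partial>lborel)"

definition parabolic_weight :: "real \<Rightarrow> real \<Rightarrow> real \<Rightarrow> ('a::euclidean_space \<Rightarrow> real) \<Rightarrow> 'a \<times> real \<Rightarrow> ennreal" where
  "parabolic_weight d L \<delta> \<psi> = (\<lambda>(y, s). ennreal (indicator {0<..} s * s powr (\<delta> - 1)) * potential d L \<psi> s y)"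

lemma measurable_potential [measurable (raw)]:
  assumes [measurable]: "\<psi> \<in> borel_measurable borel" "f \<in> borel_measurable M" "g \<in> borel_measurable M"
  shows "(\<lambda>x. potential d L \<psi> (f x) (g x)) \<in> borel_measurable M"
  unfolding potential_def by measurable

lemma measurable_parabolic_weight [measurable]:
  assumes [measurable]: "\<psi> \<in> borel_measurable borel"
  shows "parabolic_weight d L \<delta> \<psi> \<in> borel_measurable borel"
  unfolding parabolic_weight_def borel_prod[symmetric] by measurable

text \<open>Models one spatial derivative of order j of the kernel, with a = j/d; a < 1 is
  integrability of the singularity at t = 0 after integration in space.\<close>

locale singular_kernel =
  fixes d L a C :: real and k :: "'a::euclidean_space \<Rightarrow> 'a \<Rightarrow> real \<Rightarrow> real"
  assumes d_pos: "0 < d" and L_pos: "0 < L" and a_nonneg: "0 \<le> a" and a_less: "a < 1" and C_nonneg: "0 \<le> C"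
    and k_measurable: "(\<lambda>(x, y, t). k x y t) \<in> borel_measurable borel"
    and k_cont: "continuous_on {(x, y, t). 0 < t} (\<lambda>(x, y, t). k x y t)"
    and k_bound: "0 < t \<Longrightarrow> \<bar>k x y t\<bar> \<le> C * t powr (- a) * decay_kernel d L t (x - y)"
    and k_zero: "t \<le> 0 \<Longrightarrow> k x y t = 0"
begin

lemma measurable_k [measurable (raw)]:
  assumes [measurable]: "f \<in> borel_measurable M" "g \<in> borel_measurable M" "h \<in> borel_measurable M"
  shows "(\<lambda>x. k (f x) (g x) (h x)) \<in> borel_measurable M"
proof -
  have "(\<lambda>x. (f x, g x, h x)) \<in> borel_measurable M" by measurable
  from measurable_compose[OF this k_measurable] show ?thesis by simp
qed

lemma tendsto_k:
  assumes "(f \<longlongrightarrow> x) F" "(g \<longlongrightarrow> y) F" "(h \<longlongrightarrow> t) F" "0 < t"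
  shows "((\<lambda>n. k (f n) (g n) (h n)) \<longlongrightarrow> k x y t) F"
proof -
  have op: "open {(x::'a, y::'a, t::real). 0 < t}"
    by (simp add: open_Collect_less case_prod_beta' continuous_on_snd continuous_on_id)
  have "isCont (\<lambda>(x, y, t). k x y t) (x, y, t)"
    using k_cont op assms(4) by (simp add: continuous_on_eq_continuous_at)
  from isCont_tendsto_compose[OF this tendsto_Pair[OF assms(1) tendsto_Pair[OF assms(2,3)]]]
  show ?thesis by simp
qed

lemma k_comparable:
  assumes "0 < t" "t / 2 \<le> t'" "t' \<le> 2 * t" "norm (x - x') \<le> t powr (1 / d)"
  shows "\<bar>k x' y t'\<bar> \<le> C * (2 powr a * t powr (- a)) *
    (2 powr (real DIM('a) / d) * (2 * 2 powr (1 / d)) powr (real DIM('a) + L) * decay_kernel d L t (x - y))"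
proof -
  have t': "t' > 0" using assms by simp
  have "t' powr (- a) \<le> (t / 2) powr (- a)"
    using assms a_nonneg by (intro powr_mono2') auto
  also have "\<dots> = 2 powr a * t powr (- a)"
    using assms by (simp add: powr_divide powr_minus_divide)
  finally have p: "t' powr (- a) \<le> 2 powr a * t powr (- a)" .
  have "\<bar>k x' y t'\<bar> \<le> C * t' powr (- a) * decay_kernel d L t' (x' - y)"
    using t' by (rule k_bound)
  also have "\<dots> \<le> C * (2 powr a * t powr (- a)) *
    (2 powr (real DIM('a) / d) * (2 * 2 powr (1 / d)) powr (real DIM('a) + L) * decay_kernel d L t (x - y))"
    using C_nonneg assms by (intro mult_mono p mult_left_mono decay_kernel_comparable d_pos L_pos) auto
  finally show ?thesis .
qed

end

text \<open>In the application \<psi> is |\<phi>|^\<beta> and b = N\<beta>/r_0. The convolution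
  constant is a parameter, independent of \<psi>, because it enters the size of \<gamma>, which has
  to be fixed before the datum is known.\<close>

locale ball_growth_density =
  fixes d L Cv b \<kappa> \<delta> :: real and \<psi> :: "'a::euclidean_space \<Rightarrow> real"
  assumes dp: "0 < d" and Lp: "0 < L" and Cv_pos: "0 < Cv"
    and convolution: "0 < r \<Longrightarrow> 0 < s \<Longrightarrow>
      (\<integral>\<^sup>+y. ennreal (decay_kernel d L r (x - y)) * ennreal (decay_kernel d L s (y - z :: 'a)) \<partial>lborel)
        \<le> ennreal (Cv * decay_kernel d L (r + s) (x - z))"
    and b_nonneg: "0 \<le> b" and \<kappa>_nonneg: "0 \<le> \<kappa>" and \<delta>_pos: "0 < \<delta>"
    and \<psi>_measurable [measurable]: "\<psi> \<in> borel_measurable borel"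
    and growth: "0 < \<sigma> \<Longrightarrow> (\<integral>\<^sup>+z. ennreal (\<psi> z) * indicator (ball x \<sigma>) z \<partial>lborel) \<le> ennreal (\<kappa> * \<sigma> powr (real DIM('a) - b))"
begin

abbreviation "H \<equiv> potential d L \<psi>"
abbreviation "B \<equiv> parabolic_weight d L \<delta> \<psi>"

lemma potential_le:
  assumes "0 < t"
  shows "H t x \<le> ennreal (2 powr (real DIM('a) + L) / (1 - 2 powr (- (L + b))) * \<kappa> * t powr (- b / d))"
  unfolding potential_def
  by (rule ball_growth_decay_kernel_bound) (use assms dp Lp b_nonneg \<kappa>_nonneg growth in auto)

text \<open>The potential reproduces itself: by Tonelli, convolving with the kernel at time t - s
  the potential at time s gives \<psi> convolved with two kernels, whose times add up to t. No power
  of t is lost, and only the integral of the time weight \<theta> is left.\<close>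

lemma potential_convolution_bound:
  assumes [measurable]: "\<theta> \<in> borel_measurable borel"
  shows "(\<integral>\<^sup>+(y, s). ennreal (decay_kernel d L (t - s) (x - y)) * (indicator {0<..<t} s * \<theta> s) * potential d L \<psi> s (y :: 'a) \<partial>lborel)
    \<le> ennreal Cv * potential d L \<psi> t x * (\<integral>\<^sup>+s. indicator {0<..<t} s * \<theta> s \<partial>lborel)"
proof -
  let ?g = "\<lambda>t z. ennreal (decay_kernel d L t (z :: 'a))"
  have slice: "(\<integral>\<^sup>+y. ?g (t - s) (x - y) * potential d L \<psi> s y \<partial>lborel) \<le> ennreal Cv * potential d L \<psi> t x"
    if s: "0 < s" "s < t" for s
  proof -
    have "(\<integral>\<^sup>+y. ?g (t - s) (x - y) * potential d L \<psi> s y \<partial>lborel)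
      = (\<integral>\<^sup>+y. (\<integral>\<^sup>+z. ?g (t - s) (x - y) * ?g s (y - z) * ennreal (\<psi> z) \<partial>lborel) \<partial>lborel)"
      unfolding potential_def by (auto intro!: nn_integral_cong simp: nn_integral_cmult[symmetric] mult.assoc)
    also have "\<dots> = (\<integral>\<^sup>+z. (\<integral>\<^sup>+y. ?g (t - s) (x - y) * ?g s (y - z) * ennreal (\<psi> z) \<partial>lborel) \<partial>lborel)"
      by (rule lborel_pair.Fubini') measurable
    also have "\<dots> = (\<integral>\<^sup>+z. (\<integral>\<^sup>+y. ?g (t - s) (x - y) * ?g s (y - z) \<partial>lborel) * ennreal (\<psi> z) \<partial>lborel)"
      by (intro nn_integral_cong nn_integral_multc) measurable
    also have "\<dots> \<le> (\<integral>\<^sup>+z. ennreal (Cv * decay_kernel d L (t - s + s) (x - z)) * ennreal (\<psi> z) \<partial>lborel)"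
      using s by (intro nn_integral_mono mult_right_mono convolution) auto
    also have "\<dots> = (\<integral>\<^sup>+z. ennreal Cv * (?g t (x - z) * ennreal (\<psi> z)) \<partial>lborel)"
      using Cv_pos by (auto intro!: nn_integral_cong simp: ennreal_mult mult.assoc)
    also have "\<dots> = ennreal Cv * potential d L \<psi> t x"
      unfolding potential_def by (rule nn_integral_cmult) measurable
    finally show ?thesis .
  qed
  have m: "(\<lambda>(y, s). ?g (t - s) (x - y) * (indicator {0<..<t} s * \<theta> s) * potential d L \<psi> s (y :: 'a))
      \<in> borel_measurable (lborel \<Otimes>\<^sub>M lborel)"
    by measurable
  have "(\<integral>\<^sup>+(y, s). ?g (t - s) (x - y) * (indicator {0<..<t} s * \<theta> s) * potential d L \<psi> s (y :: 'a) \<partial>lborel)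
    = (\<integral>\<^sup>+s. (\<integral>\<^sup>+y. ?g (t - s) (x - y) * (indicator {0<..<t} s * \<theta> s) * potential d L \<psi> s y \<partial>lborel) \<partial>lborel)"
    unfolding lborel_prod[symmetric] using lborel_pair.nn_integral_snd[OF m] by simp
  also have "\<dots> = (\<integral>\<^sup>+s. (indicator {0<..<t} s * \<theta> s) * (\<integral>\<^sup>+y. ?g (t - s) (x - y) * potential d L \<psi> s y \<partial>lborel) \<partial>lborel)"
    by (subst nn_integral_cmult[symmetric]) (measurable, simp only: mult_ac)
  also have "\<dots> \<le> (\<integral>\<^sup>+s. (indicator {0<..<t} s * \<theta> s) * (ennreal Cv * potential d L \<psi> t x) \<partial>lborel)"
    using slice by (intro nn_integral_mono) (auto simp: indicator_def intro!: mult_left_mono)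
  also have "\<dots> = (\<integral>\<^sup>+s. indicator {0<..<t} s * \<theta> s \<partial>lborel) * (ennreal Cv * potential d L \<psi> t x)"
    by (rule nn_integral_multc) measurable
  finally show ?thesis by (simp only: mult_ac)
qed

lemma potential_finite: "0 < t \<Longrightarrow> H t x < top"
  using potential_le[of t x] by (simp add: le_less_trans)

end

context ball_growth_density
begin

text \<open>The function f is arbitrary so that the bound covers kernels, their truncations near the
  singular time and majorants alike; for the truncations a' is larger than the exponent of the
  kernel.\<close>

lemma kernel_weight_integral_le:
  assumes "0 < t" "a' < 1" "0 \<le> c"
    and f: "\<And>y s. 0 < s \<Longrightarrow> s < t \<Longrightarrow> f (y, s) \<le> ennreal (c * (t - s) powr (- a') * decay_kernel d L (t - s) (x - y))"
    and f0: "\<And>y s. t \<le> s \<Longrightarrow> f (y, s) = 0"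
  shows "(\<integral>\<^sup>+p. f p * B p \<partial>lborel) \<le> ennreal (Cv * Beta \<delta> (1 - a') * c * t powr (\<delta> - a')) * H t x"
proof -
  let ?\<theta> = "\<lambda>s. ennreal (indicator {0<..<t} s * ((t - s) powr (- a') * s powr (\<delta> - 1)))"
  have pt: "f (y, s) * B (y, s) \<le> ennreal c * (ennreal (decay_kernel d L (t - s) (x - y)) * (indicator {0<..<t} s * ?\<theta> s) * H s y)"
    for y s
  proof (cases "0 < s \<and> s < t")
    case True
    then have "f (y, s) * B (y, s) \<le> ennreal (c * (t - s) powr (- a') * decay_kernel d L (t - s) (x - y)) * B (y, s)"
      using f by (intro mult_right_mono) auto
    also have "\<dots> = ennreal c * (ennreal (decay_kernel d L (t - s) (x - y)) * (indicator {0<..<t} s * ?\<theta> s) * H s y)"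
      using True assms(3) by (simp add: parabolic_weight_def ennreal_mult mult_ac)
    finally show ?thesis .
  next
    case False
    then have z: "f (y, s) * B (y, s) = 0" using f0 by (cases "0 < s") (auto simp: parabolic_weight_def)
    show ?thesis unfolding z by simp
  qed
  have "(\<integral>\<^sup>+p. f p * B p \<partial>lborel)
      \<le> (\<integral>\<^sup>+p. ennreal c * (case p of (y, s) \<Rightarrow> ennreal (decay_kernel d L (t - s) (x - y)) * (indicator {0<..<t} s * ?\<theta> s) * H s y) \<partial>lborel)"
    using pt by (intro nn_integral_mono) auto
  also have "\<dots> = ennreal c * (\<integral>\<^sup>+p. (case p of (y, s) \<Rightarrow> ennreal (decay_kernel d L (t - s) (x - y)) * (indicator {0<..<t} s * ?\<theta> s) * H s y) \<partial>lborel)"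
    unfolding lborel_prod[symmetric] by (rule nn_integral_cmult) measurable
  also have "\<dots> \<le> ennreal c * (ennreal Cv * H t x * (\<integral>\<^sup>+s. indicator {0<..<t} s * ?\<theta> s \<partial>lborel))"
    by (intro mult_left_mono potential_convolution_bound) auto
  also have "(\<integral>\<^sup>+s. indicator {0<..<t} s * ?\<theta> s \<partial>lborel) = (\<integral>\<^sup>+s. ?\<theta> s \<partial>lborel)"
    by (intro nn_integral_cong) (auto simp: indicator_def)
  also have "\<dots> = ennreal (Beta \<delta> (1 - a') * t powr (\<delta> - a'))"
    using assms \<delta>_pos by (intro nn_integral_Beta_scaled) auto
  also have "ennreal c * (ennreal Cv * H t x * \<dots>) = ennreal (Cv * Beta \<delta> (1 - a') * c * t powr (\<delta> - a')) * H t x"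
  proof -
    have "0 \<le> Beta \<delta> (1 - a')" using assms \<delta>_pos by (intro Beta_real_nonneg) auto
    then have "ennreal (Cv * Beta \<delta> (1 - a') * c * t powr (\<delta> - a')) = ennreal c * ennreal Cv * ennreal (Beta \<delta> (1 - a') * t powr (\<delta> - a'))"
      using assms(3) Cv_pos by (simp add: ennreal_mult[symmetric] mult_ac)
    then show ?thesis by (simp add: mult_ac)
  qed
  finally show ?thesis .
qed

end

locale singular_kernel_with_density = singular_kernel d L a C k + ball_growth_density d L Cv b \<kappa> \<delta> \<psi>
  for d L a C and k :: "'a::euclidean_space \<Rightarrow> 'a \<Rightarrow> real \<Rightarrow> real" and Cv b \<kappa> \<delta> and \<psi> :: "'a \<Rightarrow> real"

context ball_growth_density
begin

lemma parabolic_weight_finite: "B p < top"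
  by (cases p) (auto simp: parabolic_weight_def ennreal_mult_less_top potential_finite indicator_def)

end

section \<open>Continuity of the kernel in L1 of the weight\<close>

context singular_kernel_with_density
begin

text \<open>Near the singular time, \<open>(t - s)\<^bsup>-a\<^esup> \<le> \<rho>\<^bsup>(1-a)/2\<^esup> (t - s)\<^bsup>-(1+a)/2\<^esup>\<close>, and the larger exponent is still below 1.\<close>

lemma near_part_le:
  shows "\<exists>Q\<ge>0. \<forall>t x \<rho>. 0 < t \<longrightarrow> 0 < \<rho> \<longrightarrow>
    (\<integral>\<^sup>+p. (case p of (y, s) \<Rightarrow> ennreal (indicator {t - \<rho><..} s * \<bar>k x y (t - s)\<bar>)) * B p \<partial>lborel)
      \<le> ennreal (Q * \<rho> powr ((1 - a) / 2) * t powr (\<delta> - (1 + a) / 2 - b / d))"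
proof -
  define S where "S = 2 powr (real DIM('a) + L) / (1 - 2 powr (- (L + b))) * \<kappa>"
  have S: "0 \<le> S" using Lp b_nonneg \<kappa>_nonneg powr_less_one[of 2 "-(L+b)"] by (simp add: S_def)
  define Q where "Q = Cv * Beta \<delta> (1 - (1 + a) / 2) * C * S"
  have Be: "0 \<le> Beta \<delta> (1 - (1 + a) / 2)"
    using \<delta>_pos a_less by (intro Beta_real_nonneg) auto
  have Q: "0 \<le> Q" using Cv_pos Be C_nonneg S by (simp add: Q_def)
  have "(\<integral>\<^sup>+p. (case p of (y, s) \<Rightarrow> ennreal (indicator {t - \<rho><..} s * \<bar>k x y (t - s)\<bar>)) * B p \<partial>lborel)
      \<le> ennreal (Q * \<rho> powr ((1 - a) / 2) * t powr (\<delta> - (1 + a) / 2 - b / d))" if t: "0 < t" "0 < \<rho>" for t x \<rho>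
  proof -
    have "(\<integral>\<^sup>+p. (case p of (y, s) \<Rightarrow> ennreal (indicator {t - \<rho><..} s * \<bar>k x y (t - s)\<bar>)) * B p \<partial>lborel)
      \<le> ennreal (Cv * Beta \<delta> (1 - (1 + a) / 2) * (C * \<rho> powr ((1 - a) / 2)) * t powr (\<delta> - (1 + a) / 2)) * H t x"
    proof (rule kernel_weight_integral_le)
      fix y s assume s: "0 < s" "s < t"
      have "indicator {t - \<rho><..} s * \<bar>k x y (t - s)\<bar> \<le> C * \<rho> powr ((1 - a) / 2) * (t - s) powr (- ((1 + a) / 2)) * decay_kernel d L (t - s) (x - y)"
      proof (cases "t - \<rho> < s")
        case True
        have "(t - s) powr (- a) = (t - s) powr ((1 - a) / 2) * (t - s) powr (- ((1 + a) / 2))"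
          by (simp add: powr_add[symmetric] field_simps)
        also have "\<dots> \<le> \<rho> powr ((1 - a) / 2) * (t - s) powr (- ((1 + a) / 2))"
          using True s a_less by (intro mult_right_mono powr_mono2) auto
        finally have "C * (t - s) powr (- a) * decay_kernel d L (t - s) (x - y)
          \<le> C * (\<rho> powr ((1 - a) / 2) * (t - s) powr (- ((1 + a) / 2))) * decay_kernel d L (t - s) (x - y)"
          using C_nonneg by (intro mult_right_mono mult_left_mono) auto
        then show ?thesis using True k_bound[of "t - s" x y] s by (simp add: mult.assoc)
      next
        case False
        then show ?thesis using C_nonneg by simp
      qed
      then show "(case (y, s) of (y, s) \<Rightarrow> ennreal (indicator {t - \<rho><..} s * \<bar>k x y (t - s)\<bar>))
         \<le> ennreal (C * \<rho> powr ((1 - a) / 2) * (t - s) powr (- ((1 + a) / 2)) * decay_kernel d L (t - s) (x - y))"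
        by (simp add: ennreal_leI)
    qed (use t a_less C_nonneg k_zero in auto)
    also have "\<dots> \<le> ennreal (Cv * Beta \<delta> (1 - (1 + a) / 2) * (C * \<rho> powr ((1 - a) / 2)) * t powr (\<delta> - (1 + a) / 2)) * ennreal (S * t powr (- b / d))"
      unfolding S_def using potential_le[OF t(1)] by (intro mult_left_mono) auto
    also have "\<dots> = ennreal (Q * \<rho> powr ((1 - a) / 2) * t powr (\<delta> - (1 + a) / 2 - b / d))"
    proof -
      have e: "t powr (\<delta> - (1 + a) / 2 - b / d) = t powr (\<delta> - (1 + a) / 2) * t powr (- b / d)"
        by (simp add: powr_add[symmetric])
      show ?thesis unfolding e Q_def
        by (subst ennreal_mult[symmetric]) (use Cv_pos Be C_nonneg S in \<open>auto simp: mult_ac\<close>)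
    qed
    finally show ?thesis .
  qed
  then show ?thesis using Q by blast
qed

text \<open>Sources older than 2\<eta> stay away from the singularity even when the evaluation time
  moves by \<eta>: \<open>t - s\<close> and \<open>T n - s\<close> then differ by a factor of at
  most 2, as the common majorant W requires.\<close>

lemma far_part_tendsto:
  assumes X: "X \<longlonglongrightarrow> x" and T: "T \<longlonglongrightarrow> t" and t: "0 < t" and \<eta>: "0 < \<eta>"
  shows "(\<lambda>n. \<integral>\<^sup>+p. (case p of (y, s) \<Rightarrow> ennreal (indicator {..t - 2 * \<eta>} s * \<bar>k (X n) y (T n - s) - k x y (t - s)\<bar>)) * B p \<partial>lborel) \<longlonglongrightarrow> 0"
proof -
  define Cc where "Cc = 2 powr (real DIM('a) / d) * (2 * 2 powr (1 / d)) powr (real DIM('a) + L)"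
  have Cc: "0 \<le> Cc" by (simp add: Cc_def)
  define c where "c = C * 2 powr a * Cc + C"
  have c: "0 \<le> c" using Cc C_nonneg by (simp add: c_def)
  have "eventually (\<lambda>n. dist (T n) t < \<eta> \<and> dist (X n) x < \<eta> powr (1 / d)) sequentially"
    using \<eta> by (intro eventually_conj tendstoD[OF X] tendstoD[OF T]) auto
  then obtain N where N: "\<And>n. dist (T (n + N)) t < \<eta>" "\<And>n. dist (X (n + N)) x < \<eta> powr (1 / d)"
    unfolding eventually_sequentially by (metis le_add2)
  define D where "D n = (\<lambda>(y, s). ennreal (indicator {..t - 2 * \<eta>} s * \<bar>k (X n) y (T n - s) - k x y (t - s)\<bar>))" for n
  define W where "W = (\<lambda>(y, s). ennreal (indicator {..<t} s * (c * (t - s) powr (- a) * decay_kernel d L (t - s) (x - y))))"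
  have [measurable]: "D n \<in> borel_measurable borel" for n
    unfolding D_def borel_prod[symmetric] by measurable
  have [measurable]: "W \<in> borel_measurable borel"
    unfolding W_def borel_prod[symmetric] by measurable
  have "(\<lambda>n. \<integral>\<^sup>+p. D (n + N) p * B p \<partial>lborel) \<longlonglongrightarrow> (\<integral>\<^sup>+p. 0 \<partial>(lborel :: ('a \<times> real) measure))"
  proof (rule nn_integral_dominated_convergence[where w = "\<lambda>p. W p * B p"])
    have "(\<integral>\<^sup>+p. W p * B p \<partial>lborel) \<le> ennreal (Cv * Beta \<delta> (1 - a) * c * t powr (\<delta> - a)) * H t x"
      by (rule kernel_weight_integral_le) (use t a_less c in \<open>auto simp: W_def\<close>)
    also have "\<dots> < \<infinity>" using potential_finite[OF t, of x] by (simp add: ennreal_mult_less_top)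
    finally show "(\<integral>\<^sup>+p. W p * B p \<partial>lborel) < \<infinity>" .
    have "D (n + N) (y, s) \<le> W (y, s)" for n y s
    proof (cases "s \<le> t - 2 * \<eta>")
      case True
      let ?\<tau> = "t - s" and ?\<tau>' = "T (n + N) - s"
      have \<tau>: "2 * \<eta> \<le> ?\<tau>" using True by simp
      have \<tau>': "?\<tau> / 2 \<le> ?\<tau>'" "?\<tau>' \<le> 2 * ?\<tau>"
        using N(1)[of n] \<tau> \<eta> by (auto simp: dist_real_def)
      have "\<eta> powr (1 / d) \<le> ?\<tau> powr (1 / d)" using \<tau> \<eta> dp by (intro powr_mono2) auto
      then have nx: "norm (x - X (n + N)) \<le> ?\<tau> powr (1 / d)"
        using N(2)[of n] by (simp add: dist_norm norm_minus_commute)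
      have "\<bar>k (X (n + N)) y ?\<tau>'\<bar> \<le> C * (2 powr a * ?\<tau> powr (- a)) * (Cc * decay_kernel d L ?\<tau> (x - y))"
        unfolding Cc_def using \<tau> \<eta> nx \<tau>' by (intro k_comparable) auto
      moreover have c_eq: "c * ?\<tau> powr (- a) * decay_kernel d L ?\<tau> (x - y)
        = C * (2 powr a * ?\<tau> powr (- a)) * (Cc * decay_kernel d L ?\<tau> (x - y)) + C * ?\<tau> powr (- a) * decay_kernel d L ?\<tau> (x - y)"
        unfolding c_def by (simp add: algebra_simps)
      moreover have "\<bar>k x y ?\<tau>\<bar> \<le> C * ?\<tau> powr (- a) * decay_kernel d L ?\<tau> (x - y)"
        using \<tau> \<eta> by (intro k_bound) auto
      ultimately have "\<bar>k (X (n + N)) y ?\<tau>' - k x y ?\<tau>\<bar> \<le> c * ?\<tau> powr (- a) * decay_kernel d L ?\<tau> (x - y)"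
        unfolding c_eq by linarith
      then show ?thesis using True \<eta> by (simp add: D_def W_def ennreal_leI)
    qed (simp add: D_def)
    then show "AE p in lborel. D (n + N) p * B p \<le> W p * B p" for n
      by (auto intro!: mult_right_mono)
    have "(\<lambda>n. D (n + N) (y, s) * B (y, s)) \<longlonglongrightarrow> 0" for y s
    proof (cases "s \<le> t - 2 * \<eta>")
      case True
      have "(\<lambda>n. k (X (n + N)) y (T (n + N) - s)) \<longlonglongrightarrow> k x y (t - s)"
        using True \<eta> by (intro tendsto_k tendsto_intros LIMSEQ_ignore_initial_segment X T) auto
      then have "(\<lambda>n. \<bar>k (X (n + N)) y (T (n + N) - s) - k x y (t - s)\<bar>) \<longlonglongrightarrow> \<bar>k x y (t - s) - k x y (t - s)\<bar>"
        by (intro tendsto_intros)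
      then have "(\<lambda>n. B (y, s) * ennreal \<bar>k (X (n + N)) y (T (n + N) - s) - k x y (t - s)\<bar>) \<longlonglongrightarrow> B (y, s) * ennreal 0"
        using parabolic_weight_finite[of "(y, s)"] by (intro ennreal_tendsto_cmult tendsto_ennrealI) auto
      then show ?thesis using True by (simp add: D_def mult.commute)
    qed (simp add: D_def)
    then show "AE p in lborel. (\<lambda>n. D (n + N) p * B p) \<longlonglongrightarrow> 0" by auto
  qed auto
  then have "(\<lambda>n. \<integral>\<^sup>+p. D n p * B p \<partial>lborel) \<longlonglongrightarrow> 0"
    using LIMSEQ_offset[of "\<lambda>n. \<integral>\<^sup>+p. D n p * B p \<partial>lborel" N 0] by simp
  then show ?thesis by (simp add: D_def)
qed

text \<open>Convergence is measured against the weight and not for a given source. Thus the rate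
  depends on a source only through its constant M, which is what makes whole families of Duhamel
  integrals equicontinuous.\<close>

lemma kernel_weight_L1_tendsto:
  assumes X: "X \<longlonglongrightarrow> x" and T: "T \<longlonglongrightarrow> t" and t: "0 < t"
  shows "(\<lambda>n. \<integral>\<^sup>+p. (case p of (y, s) \<Rightarrow> ennreal \<bar>k (X n) y (T n - s) - k x y (t - s)\<bar>) * B p \<partial>lborel) \<longlonglongrightarrow> 0"
proof (rule tendsto_zero_ennreal)
  fix \<epsilon> :: real assume \<epsilon>: "0 < \<epsilon>"
  obtain Q where Q: "0 \<le> Q" and near: "\<And>t x \<rho>. 0 < t \<Longrightarrow> 0 < \<rho> \<Longrightarrow>
    (\<integral>\<^sup>+p. (case p of (y, s) \<Rightarrow> ennreal (indicator {t - \<rho><..} s * \<bar>k x y (t - s)\<bar>)) * B p \<partial>lborel)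
      \<le> ennreal (Q * \<rho> powr ((1 - a) / 2) * t powr (\<delta> - (1 + a) / 2 - b / d))"
    using near_part_le by blast
  \<comment> \<open>The sign of e is not known. Continuity gives
    \<open>T n powr e < t powr e + 1\<close> eventually, and fixing this slack of 1 in advance
    allows \<eta> to be chosen independently of n.\<close>
  define e where "e = \<delta> - (1 + a) / 2 - b / d"
  have "((\<lambda>\<eta>. Q * (3 * \<eta>) powr ((1 - a) / 2) * (t powr e + 1)) \<longlongrightarrow> Q * (3 * 0) powr ((1 - a) / 2) * (t powr e + 1)) (at_right 0)"
    using a_less by (intro tendsto_intros tendsto_powr2) (auto simp: eventually_at_right_less eventually_at_filter)
  then have "eventually (\<lambda>\<eta>. Q * (3 * \<eta>) powr ((1 - a) / 2) * (t powr e + 1) < \<epsilon> / 4) (at_right 0)"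
    using \<epsilon> by (intro order_tendstoD) auto
  moreover have "eventually (\<lambda>\<eta>::real. \<eta> \<in> {0<..<t / 4}) (at_right 0)"
    using t by (intro eventually_at_right_real) auto
  ultimately have "eventually (\<lambda>\<eta>. Q * (3 * \<eta>) powr ((1 - a) / 2) * (t powr e + 1) < \<epsilon> / 4 \<and> \<eta> \<in> {0<..<t / 4}) (at_right 0)"
    by eventually_elim auto
  then obtain \<eta> where \<eta>: "Q * (3 * \<eta>) powr ((1 - a) / 2) * (t powr e + 1) < \<epsilon> / 4" "0 < \<eta>" "\<eta> < t / 4"
    using eventually_happens'[of "at_right (0::real)"] by (auto simp: trivial_limit_at_right_real)
  \<comment> \<open>The far part stops at \<open>t - 2 * \<eta>\<close>. Since \<open>T n\<close>
    may exceed t by almost \<eta>, the near part seen from \<open>T n\<close> has to reach back by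
    \<open>3 * \<eta>\<close> in order to cover the rest.\<close>
  have near': "(\<integral>\<^sup>+p. (case p of (y, s) \<Rightarrow> ennreal (indicator {t' - 3 * \<eta><..} s * \<bar>k x y (t' - s)\<bar>)) * B p \<partial>lborel) \<le> ennreal (\<epsilon> / 4)"
    if "0 < t'" "t' powr e < t powr e + 1" for t' x
  proof -
    have "Q * (3 * \<eta>) powr ((1 - a) / 2) * t' powr e \<le> Q * (3 * \<eta>) powr ((1 - a) / 2) * (t powr e + 1)"
      using Q that by (intro mult_left_mono) auto
    then have "Q * (3 * \<eta>) powr ((1 - a) / 2) * t' powr e \<le> \<epsilon> / 4" using \<eta> by simp
    then show ?thesis
      using near[of t' "3 * \<eta>" x] that \<eta> unfolding e_def by (meson ennreal_leI order_trans mult_pos_pos zero_less_numeral)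
  qed
  have "((\<lambda>n. T n powr e) \<longlongrightarrow> t powr e) sequentially"
    using T t by (intro tendsto_intros) auto
  then have ev: "eventually (\<lambda>n. T n powr e < t powr e + 1) sequentially"
    by (rule order_tendstoD) simp
  have ev2: "eventually (\<lambda>n. dist (T n) t < \<eta>) sequentially"
    using \<eta> by (intro tendstoD[OF T])
  have ev3: "eventually (\<lambda>n. (\<integral>\<^sup>+p. (case p of (y, s) \<Rightarrow> ennreal (indicator {..t - 2 * \<eta>} s * \<bar>k (X n) y (T n - s) - k x y (t - s)\<bar>)) * B p \<partial>lborel) < ennreal (\<epsilon> / 4)) sequentially"
    using \<epsilon> \<eta> by (intro order_tendstoD(2)[OF far_part_tendsto[OF X T t]]) auto
  from ev ev2 ev3 show "eventually (\<lambda>n. (\<integral>\<^sup>+p. (case p of (y, s) \<Rightarrow> ennreal \<bar>k (X n) y (T n - s) - k x y (t - s)\<bar>) * B p \<partial>lborel) < ennreal \<epsilon>) sequentially"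
  proof eventually_elim
    case (elim n)
    let ?f1 = "\<lambda>p. case p of (y, s) \<Rightarrow> ennreal (indicator {..t - 2 * \<eta>} s * \<bar>k (X n) y (T n - s) - k x y (t - s)\<bar>)"
    let ?f2 = "\<lambda>p. case p of (y, s) \<Rightarrow> ennreal (indicator {T n - 3 * \<eta><..} s * \<bar>k (X n) y (T n - s)\<bar>)"
    let ?f3 = "\<lambda>p. case p of (y, s) \<Rightarrow> ennreal (indicator {t - 3 * \<eta><..} s * \<bar>k x y (t - s)\<bar>)"
    have [measurable]: "?f1 \<in> borel_measurable borel" "?f2 \<in> borel_measurable borel" "?f3 \<in> borel_measurable borel"
      unfolding borel_prod[symmetric] by measurable
    have m: "(\<lambda>p. ?f1 p * B p) \<in> borel_measurable lborel" "(\<lambda>p. ?f2 p * B p) \<in> borel_measurable lborel" "(\<lambda>p. ?f3 p * B p) \<in> borel_measurable lborel"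
      by measurable
    have Tn: "T n > 0" "t - 2 * \<eta> \<ge> T n - 3 * \<eta>" using elim(2) \<eta> by (auto simp: dist_real_def)
    have pt: "(case p of (y, s) \<Rightarrow> ennreal \<bar>k (X n) y (T n - s) - k x y (t - s)\<bar>) * B p \<le> ?f1 p * B p + (?f2 p * B p + ?f3 p * B p)" for p
    proof (cases p)
      case (Pair y s)
      have "\<bar>k (X n) y (T n - s) - k x y (t - s)\<bar> \<le>
        indicator {..t - 2 * \<eta>} s * \<bar>k (X n) y (T n - s) - k x y (t - s)\<bar> +
        (indicator {T n - 3 * \<eta><..} s * \<bar>k (X n) y (T n - s)\<bar> + indicator {t - 3 * \<eta><..} s * \<bar>k x y (t - s)\<bar>)"
        using Tn \<eta> by (auto simp: indicator_def)
      then have "ennreal \<bar>k (X n) y (T n - s) - k x y (t - s)\<bar> \<le> ?f1 p + (?f2 p + ?f3 p)"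
        unfolding Pair by (simp add: ennreal_plus[symmetric] ennreal_leI del: ennreal_plus)
      then show ?thesis unfolding Pair distrib_right[symmetric] by (intro mult_right_mono) auto
    qed
    have "(\<integral>\<^sup>+p. (case p of (y, s) \<Rightarrow> ennreal \<bar>k (X n) y (T n - s) - k x y (t - s)\<bar>) * B p \<partial>lborel)
       \<le> (\<integral>\<^sup>+p. ?f1 p * B p + (?f2 p * B p + ?f3 p * B p) \<partial>lborel)"
      using pt by (intro nn_integral_mono) auto
    also have "\<dots> = (\<integral>\<^sup>+p. ?f1 p * B p \<partial>lborel) + ((\<integral>\<^sup>+p. ?f2 p * B p \<partial>lborel) + (\<integral>\<^sup>+p. ?f3 p * B p \<partial>lborel))"
      using m by (simp add: nn_integral_add)
    also have "\<dots> \<le> ennreal (\<epsilon> / 4) + (ennreal (\<epsilon> / 4) + ennreal (\<epsilon> / 4))"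
      using elim Tn t by (intro add_mono near') auto
    also have "\<dots> = ennreal (3 * \<epsilon> / 4)" using \<epsilon> by (simp add: ennreal_plus[symmetric] del: ennreal_plus)
    also have "\<dots> < ennreal \<epsilon>" using \<epsilon> by (simp add: ennreal_lessI)
    finally show ?case .
  qed
qed

end

section \<open>Differentiation under the integral sign and Duhamel integrals\<close>

text \<open>The derivatives of the Duhamel kernel have no integrable majorant that is uniform in \<open>h\<close>; bounded
  integrals and continuity of the integrated derivative suffice, by Fubini and the fundamental theorem of calculus.\<close>

lemma (in sigma_finite_measure) has_real_derivative_integral:
  fixes k k' :: "real \<Rightarrow> 'a \<Rightarrow> real"
  assumes meas [measurable]: "(\<lambda>(h, \<omega>). k' h \<omega>) \<in> borel_measurable (borel \<Otimes>\<^sub>M M)"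
    and deriv: "\<And>h \<omega>. \<omega> \<in> space M \<Longrightarrow> ((\<lambda>h. k h \<omega>) has_real_derivative k' h \<omega>) (at h)"
    and cont: "\<And>\<omega>. \<omega> \<in> space M \<Longrightarrow> continuous_on UNIV (\<lambda>h. k' h \<omega>)"
    and int: "\<And>h. integrable M (k h)"
    and bound: "\<And>h. (\<integral>\<^sup>+\<omega>. ennreal \<bar>k' h \<omega>\<bar> \<partial>M) \<le> ennreal c"
    and contW: "continuous_on UNIV (\<lambda>h. \<integral>\<omega>. k' h \<omega> \<partial>M)"
  shows "((\<lambda>h. \<integral>\<omega>. k h \<omega> \<partial>M) has_real_derivative (\<integral>\<omega>. k' 0 \<omega> \<partial>M)) (at 0)"
proof -
  interpret P: pair_sigma_finite lborel M
    by (simp add: pair_sigma_finite_def sigma_finite_measure_axioms lborel.sigma_finite_measure_axioms)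
  define W where "W h = (\<integral>\<omega>. k h \<omega> \<partial>M)" for h
  define W' where "W' h = (\<integral>\<omega>. k' h \<omega> \<partial>M)" for h
  have cW: "continuous_on A W'" for A
    using continuous_on_subset[OF contW] by (auto simp: W'_def[abs_def])
  \<comment> \<open>The base point - 1 only has to lie to the left of 0, so that 0 is interior and
    the fundamental theorem yields a two-sided derivative.\<close>
  have eq: "W h = W (- 1) + integral {- 1..h} W'" if h: "- 1 \<le> h" for h
  proof -
    have m: "(\<lambda>(\<eta>, \<omega>). k' \<eta> \<omega> * indicator {- 1..h} \<eta>) \<in> borel_measurable (lborel \<Otimes>\<^sub>M M)"
      by measurable
    have "(\<integral>\<^sup>+p. ennreal (norm (case p of (\<eta>, \<omega>) \<Rightarrow> k' \<eta> \<omega> * indicator {- 1..h} \<eta>)) \<partial>(lborel \<Otimes>\<^sub>M M))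
        = (\<integral>\<^sup>+\<eta>. (\<integral>\<^sup>+\<omega>. ennreal \<bar>k' \<eta> \<omega>\<bar> * indicator {- 1..h} \<eta> \<partial>M) \<partial>lborel)"
      using m by (subst nn_integral_fst[symmetric]) (auto intro!: nn_integral_cong simp: indicator_def)
    also have "\<dots> \<le> (\<integral>\<^sup>+\<eta>. ennreal c * indicator {- 1..h} \<eta> \<partial>lborel)"
      using bound by (intro nn_integral_mono) (auto simp: indicator_def)
    also have "\<dots> < \<infinity>"
      using h by (subst nn_integral_cmult_indicator) (auto simp: ennreal_mult_less_top)
    finally have ip: "integrable (lborel \<Otimes>\<^sub>M M) (\<lambda>(\<eta>, \<omega>). k' \<eta> \<omega> * indicator {- 1..h} \<eta>)"
      using m by (intro integrableI_bounded) auto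
    have "W h - W (- 1) = (\<integral>\<omega>. k h \<omega> - k (- 1) \<omega> \<partial>M)"
      unfolding W_def using int by (subst Bochner_Integration.integral_diff) auto
    also have "\<dots> = (\<integral>\<omega>. (\<integral>\<eta>. k' \<eta> \<omega> * indicator {- 1..h} \<eta> \<partial>lborel) \<partial>M)"
    proof (intro Bochner_Integration.integral_cong refl)
      fix \<omega> assume \<omega>: "\<omega> \<in> space M"
      show "k h \<omega> - k (- 1) \<omega> = (\<integral>\<eta>. k' \<eta> \<omega> * indicator {- 1..h} \<eta> \<partial>lborel)"
        using h cont[OF \<omega>] deriv[OF \<omega>]
        by (intro integral_FTC_Icc_real[symmetric]) (auto simp: continuous_on_eq_continuous_at)
    qed
    also have "\<dots> = (\<integral>\<eta>. (\<integral>\<omega>. k' \<eta> \<omega> * indicator {- 1..h} \<eta> \<partial>M) \<partial>lborel)"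
      by (rule P.Fubini_integral) (use ip in simp)
    also have "\<dots> = (LINT \<eta>:{- 1..h}|lborel. W' \<eta>)"
      by (simp add: set_lebesgue_integral_def W'_def mult.commute)
    also have "\<dots> = integral {- 1..h} W'"
      by (rule set_borel_integral_eq_integral(2)) (use borel_integrable_compact[OF _ cW, of "{- 1..h}"] in \<open>simp add: set_integrable_def\<close>)
    finally show ?thesis by simp
  qed
  have "((\<lambda>h. integral {- 1..h} W') has_real_derivative W' 0) (at 0 within {- 1..1})"
    by (rule integral_has_real_derivative[OF cW]) simp
  then have "((\<lambda>h. integral {- 1..h} W') has_real_derivative W' 0) (at 0 within {- 1<..<1})"
    by (rule DERIV_subset) auto
  then have "((\<lambda>h. integral {- 1..h} W') has_real_derivative W' 0) (at 0)"
    by (subst (asm) at_within_open) auto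
  then have "((\<lambda>h. W (- 1) + integral {- 1..h} W') has_real_derivative W' 0) (at 0)"
    using DERIV_add[OF DERIV_const[of "W (- 1)"]] by fastforce
  moreover have "eventually (\<lambda>h. W (- 1) + integral {- 1..h} W' = W h) (nhds 0)"
    by (rule eventually_mono[OF eventually_nhds_in_open[of "{- 1<..<1::real}"]]) (auto intro!: eq[symmetric])
  ultimately have "(W has_real_derivative W' 0) (at 0)"
    by (rule iffD1[OF DERIV_cong_ev[OF refl _ refl], rotated 1])
  then show ?thesis by (simp add: W_def[abs_def] W'_def)
qed

section \<open>Duhamel integrals of weighted sources\<close>

lemma measurable_fst_borel: "fst \<in> borel_measurable (borel :: ('a::topological_space \<times> 'b::topological_space) measure)"
  by (intro borel_measurable_continuous_onI continuous_intros)

lemma measurable_snd_borel: "snd \<in> borel_measurable (borel :: ('a::topological_space \<times> 'b::topological_space) measure)"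
  by (intro borel_measurable_continuous_onI continuous_intros)

text \<open>The integral runs over all times: kernels vanish at nonpositive times and weighted
  sources for s \<le> 0, so only 0 < s < t contributes. A single space-time integral lets dominated
  convergence act once; Fubini recovers the iterated form at the very end.\<close>

definition duhamel :: "('a::euclidean_space \<Rightarrow> 'a \<Rightarrow> real \<Rightarrow> real) \<Rightarrow> ('a \<times> real \<Rightarrow> real) \<Rightarrow> 'a \<Rightarrow> real \<Rightarrow> real" where
  "duhamel k f x t = (\<integral>(y, s). k x y (t - s) * f (y, s) \<partial>lborel)"

context ball_growth_density
begin

definition weighted :: "real \<Rightarrow> ('a \<times> real \<Rightarrow> real) \<Rightarrow> bool" where
  "weighted M f \<longleftrightarrow> 0 \<le> M \<and> f \<in> borel_measurable borel \<and> (\<forall>p. ennreal \<bar>f p\<bar> \<le> ennreal M * B p)"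

lemma weighted_nonpos: "weighted M f \<Longrightarrow> s \<le> 0 \<Longrightarrow> f (y, s) = 0"
  unfolding weighted_def by (drule conjunct2, drule conjunct2, drule spec[of _ "(y, s)"])
    (simp add: parabolic_weight_def ennreal_eq_0_iff)

end

context singular_kernel_with_density
begin

lemma duhamel_integrand_measurable:
  assumes "f \<in> borel_measurable borel"
  shows "(\<lambda>(y, s). k x y (t - s) * f (y, s)) \<in> borel_measurable lborel"
proof -
  note [measurable] = assms measurable_fst_borel measurable_snd_borel
  have "(\<lambda>p. k x (fst p) (t - snd p) * f p) \<in> borel_measurable borel" by measurable
  then show ?thesis by (simp add: case_prod_beta')
qed

lemma duhamel_nn_bound:
  assumes f: "weighted M f" and t: "0 < t"
  shows "(\<integral>\<^sup>+(y, s). ennreal \<bar>k x y (t - s) * f (y, s)\<bar> \<partial>lborel)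
    \<le> ennreal (M * (Cv * Beta \<delta> (1 - a) * C) * t powr (\<delta> - a)) * H t x"
proof -
  have [measurable]: "(\<lambda>(y, s). ennreal \<bar>k x y (t - s)\<bar>) \<in> borel_measurable borel"
    unfolding borel_prod[symmetric] by measurable
  have M: "0 \<le> M" using f by (simp add: weighted_def)
  have "(\<integral>\<^sup>+(y, s). ennreal \<bar>k x y (t - s) * f (y, s)\<bar> \<partial>lborel)
      \<le> (\<integral>\<^sup>+p. ennreal M * ((case p of (y, s) \<Rightarrow> ennreal \<bar>k x y (t - s)\<bar>) * B p) \<partial>lborel)"
  proof (intro nn_integral_mono, clarify)
    fix y :: 'a and s :: real
    have "ennreal \<bar>k x y (t - s) * f (y, s)\<bar> = ennreal \<bar>k x y (t - s)\<bar> * ennreal \<bar>f (y, s)\<bar>"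
      by (simp add: abs_mult ennreal_mult)
    also have "\<dots> \<le> ennreal \<bar>k x y (t - s)\<bar> * (ennreal M * B (y, s))"
      using f by (intro mult_left_mono) (auto simp: weighted_def)
    finally show "ennreal \<bar>k x y (t - s) * f (y, s)\<bar> \<le> ennreal M * (ennreal \<bar>k x y (t - s)\<bar> * B (y, s))"
      by (simp add: mult_ac)
  qed
  also have "\<dots> = ennreal M * (\<integral>\<^sup>+p. (case p of (y, s) \<Rightarrow> ennreal \<bar>k x y (t - s)\<bar>) * B p \<partial>lborel)"
    by (rule nn_integral_cmult) measurable
  also have "\<dots> \<le> ennreal M * (ennreal (Cv * Beta \<delta> (1 - a) * C * t powr (\<delta> - a)) * H t x)"
    using k_bound k_zero by (intro mult_left_mono kernel_weight_integral_le t a_less C_nonneg) (auto intro!: ennreal_leI)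
  also have "\<dots> = ennreal (M * (Cv * Beta \<delta> (1 - a) * C) * t powr (\<delta> - a)) * H t x"
  proof -
    have "0 \<le> Cv * Beta \<delta> (1 - a) * C * t powr (\<delta> - a)"
      using Cv_pos C_nonneg a_less \<delta>_pos by (simp add: Beta_real_nonneg)
    then show ?thesis using M by (simp add: ennreal_mult'[symmetric] mult.assoc[symmetric])
  qed
  finally show ?thesis .
qed

lemma duhamel_integrable:
  assumes f: "weighted M f"
  shows "integrable lborel (\<lambda>(y, s). k x y (t - s) * f (y, s))"
proof (cases "0 < t")
  case True
  have [measurable]: "f \<in> borel_measurable borel" using f by (simp add: weighted_def)
  have "(\<integral>\<^sup>+p. ennreal (norm (case p of (y, s) \<Rightarrow> k x y (t - s) * f (y, s))) \<partial>lborel) < \<infinity>"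
    using duhamel_nn_bound[OF f True, of x] potential_finite[OF True, of x]
    by (simp add: case_prod_beta' ennreal_mult_less_top le_less_trans)
  then show ?thesis
    using duhamel_integrand_measurable[of f] by (intro integrableI_bounded) auto
next
  case False
  have "(\<lambda>(y, s). k x y (t - s) * f (y, s)) = (\<lambda>_. 0)"
    using False weighted_nonpos[OF f] k_zero by (auto simp: fun_eq_iff) (meson diff_le_0_iff_le le_cases order_trans not_le)
  then show ?thesis by simp
qed

lemma duhamel_bound:
  assumes f: "weighted M f" and t: "0 < t"
  shows "ennreal \<bar>duhamel k f x t\<bar> \<le> ennreal (M * (Cv * Beta \<delta> (1 - a) * C) * t powr (\<delta> - a)) * H t x"
proof -
  have "ennreal \<bar>duhamel k f x t\<bar> \<le> (\<integral>\<^sup>+(y, s). ennreal \<bar>k x y (t - s) * f (y, s)\<bar> \<partial>lborel)"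
    using integral_norm_bound_ennreal[OF duhamel_integrable[OF f, of x t]]
    by (simp add: duhamel_def case_prod_beta')
  then show ?thesis using duhamel_nn_bound[OF f t, of x] by (rule order_trans)
qed

text \<open>\<rho> is chosen before f: the difference is at most M times the weighted L1 distance
  \<open>E\<close> of the two kernels, in which the source no longer occurs.\<close>

lemma duhamel_equicontinuous:
  assumes t: "0 < t" and M: "0 \<le> M" and \<epsilon>: "0 < \<epsilon>"
  shows "\<exists>\<rho>>0. \<forall>x' t' f. weighted M f \<longrightarrow> dist (x', t') (x, t) < \<rho> \<longrightarrow> \<bar>duhamel k f x' t' - duhamel k f x t\<bar> < \<epsilon>"
proof -
  define E where "E q = (\<integral>\<^sup>+p. (case p of (y, s) \<Rightarrow> ennreal \<bar>k (fst q) y (snd q - s) - k x y (t - s)\<bar>) * B p \<partial>lborel)" for q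
  have "(E \<longlongrightarrow> 0) (at (x, t))"
    unfolding tendsto_at_iff_sequentially
  proof (intro allI impI)
    fix q assume "q \<longlonglongrightarrow> (x, t)"
    then have "(\<lambda>n. fst (q n)) \<longlonglongrightarrow> x" "(\<lambda>n. snd (q n)) \<longlonglongrightarrow> t"
      using tendsto_fst[of q "(x, t)"] tendsto_snd[of q "(x, t)"] by auto
    from kernel_weight_L1_tendsto[OF this t]
    show "(E \<circ> q) \<longlonglongrightarrow> 0" by (simp add: E_def comp_def)
  qed
  moreover have "E (x, t) = 0" by (simp add: E_def case_prod_beta')
  ultimately have "(E \<longlongrightarrow> 0) (nhds (x, t))"
    using tendsto_at_iff_tendsto_nhds[of E "(x, t)"] by simp
  then have "eventually (\<lambda>q. E q < ennreal (\<epsilon> / (M + 1))) (nhds (x, t))"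
    using M \<epsilon> by (intro order_tendstoD) auto
  then obtain \<rho> where \<rho>: "\<rho> > 0" "\<And>q. dist q (x, t) < \<rho> \<Longrightarrow> E q < ennreal (\<epsilon> / (M + 1))"
    unfolding eventually_nhds_metric by blast
  have "\<bar>duhamel k f x' t' - duhamel k f x t\<bar> < \<epsilon>" if f: "weighted M f" and d: "dist (x', t') (x, t) < \<rho>" for x' t' f
  proof -
    have [measurable]: "(\<lambda>(y, s). ennreal \<bar>k x' y (t' - s) - k x y (t - s)\<bar>) \<in> borel_measurable borel"
      unfolding borel_prod[symmetric] by measurable
    have int: "integrable lborel (\<lambda>p. (case p of (y, s) \<Rightarrow> k x' y (t' - s) * f (y, s)) - (case p of (y, s) \<Rightarrow> k x y (t - s) * f (y, s)))"
      by (intro Bochner_Integration.integrable_diff duhamel_integrable[OF f])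
    have "duhamel k f x' t' - duhamel k f x t =
      (\<integral>p. (case p of (y, s) \<Rightarrow> k x' y (t' - s) * f (y, s)) - (case p of (y, s) \<Rightarrow> k x y (t - s) * f (y, s)) \<partial>lborel)"
      unfolding duhamel_def by (subst Bochner_Integration.integral_diff) (auto intro: duhamel_integrable[OF f])
    then have "ennreal \<bar>duhamel k f x' t' - duhamel k f x t\<bar> \<le>
      (\<integral>\<^sup>+p. ennreal \<bar>(case p of (y, s) \<Rightarrow> k x' y (t' - s) * f (y, s)) - (case p of (y, s) \<Rightarrow> k x y (t - s) * f (y, s))\<bar> \<partial>lborel)"
      using integral_norm_bound_ennreal[OF int] by simp
    also have "\<dots> \<le> (\<integral>\<^sup>+p. ennreal M * ((case p of (y, s) \<Rightarrow> ennreal \<bar>k x' y (t' - s) - k x y (t - s)\<bar>) * B p) \<partial>lborel)"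
    proof (intro nn_integral_mono, clarify)
      fix y :: 'a and s :: real
      have "ennreal \<bar>k x' y (t' - s) * f (y, s) - k x y (t - s) * f (y, s)\<bar> = ennreal \<bar>k x' y (t' - s) - k x y (t - s)\<bar> * ennreal \<bar>f (y, s)\<bar>"
        by (simp add: left_diff_distrib[symmetric] abs_mult ennreal_mult)
      also have "\<dots> \<le> ennreal \<bar>k x' y (t' - s) - k x y (t - s)\<bar> * (ennreal M * B (y, s))"
        using f by (intro mult_left_mono) (auto simp: weighted_def)
      finally show "ennreal \<bar>k x' y (t' - s) * f (y, s) - k x y (t - s) * f (y, s)\<bar> \<le> ennreal M * (ennreal \<bar>k x' y (t' - s) - k x y (t - s)\<bar> * B (y, s))"
        by (simp add: mult_ac)
    qed
    also have "\<dots> = ennreal M * E (x', t')"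
      unfolding E_def by (subst nn_integral_cmult) auto
    also have "\<dots> \<le> ennreal M * ennreal (\<epsilon> / (M + 1))"
      using \<rho>(2)[OF d] by (intro mult_left_mono) auto
    also have "\<dots> = ennreal (M * (\<epsilon> / (M + 1)))" using M \<epsilon> by (simp add: ennreal_mult[symmetric])
    also have "\<dots> < ennreal \<epsilon>"
      using M \<epsilon> by (intro ennreal_lessI) (auto simp: field_simps)
    finally show ?thesis using \<epsilon> by (simp add: ennreal_less_iff)
  qed
  then show ?thesis using \<rho>(1) by blast
qed

lemma duhamel_continuous:
  assumes f: "weighted M f"
  shows "continuous_on (UNIV \<times> {0<..}) (\<lambda>(x, t). duhamel k f x t)"
  unfolding continuous_on_iff
proof (intro ballI allI impI)
  fix q :: "'a \<times> real" and \<epsilon> :: real assume q: "q \<in> UNIV \<times> {0<..}" and "0 < \<epsilon>"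
  moreover have "0 \<le> M" using f by (simp add: weighted_def)
  ultimately obtain \<rho> where "\<rho> > 0" "\<And>x' t'. dist (x', t') (fst q, snd q) < \<rho> \<Longrightarrow> \<bar>duhamel k f x' t' - duhamel k f (fst q) (snd q)\<bar> < \<epsilon>"
    using duhamel_equicontinuous[of "snd q" M \<epsilon> "fst q"] f by (auto simp: mem_Times_iff)
  then show "\<exists>d>0. \<forall>q'\<in>UNIV \<times> {0<..}. dist q' q < d \<longrightarrow> dist (case q' of (x, t) \<Rightarrow> duhamel k f x t) (case q of (x, t) \<Rightarrow> duhamel k f x t) < \<epsilon>"
    by (intro exI[of _ \<rho>]) (auto simp: dist_real_def case_prod_beta')
qed

end

section \<open>The linear part, and differentiation of both integrals in space\<close>

definition evolution :: "('a::euclidean_space \<Rightarrow> 'a \<Rightarrow> real \<Rightarrow> real) \<Rightarrow> ('a \<Rightarrow> real) \<Rightarrow> 'a \<Rightarrow> real \<Rightarrow> real" where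
  "evolution k \<phi> x t = (\<integral>y. k x y t * \<phi> y \<partial>lborel)"

locale locally_bounded_potential =
  fixes d L :: real and \<phi> :: "'a::euclidean_space \<Rightarrow> real" and P :: "real \<Rightarrow> real"
  assumes \<phi>_measurable [measurable]: "\<phi> \<in> borel_measurable borel"
    and \<phi>_potential: "0 < t \<Longrightarrow> potential d L (\<lambda>z. \<bar>\<phi> z\<bar>) t x \<le> ennreal (P t)"

locale singular_kernel_with_datum = singular_kernel d L a C k + locally_bounded_potential d L \<phi> P
  for d L a C and k :: "'a::euclidean_space \<Rightarrow> 'a \<Rightarrow> real \<Rightarrow> real" and \<phi> :: "'a \<Rightarrow> real" and P
begin

lemma evolution_nn_bound:
  assumes t: "0 < t"
  shows "(\<integral>\<^sup>+y. ennreal \<bar>k x y t * \<phi> y\<bar> \<partial>lborel) \<le> ennreal (C * t powr (- a)) * potential d L (\<lambda>z. \<bar>\<phi> z\<bar>) t x"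
proof -
  have "(\<integral>\<^sup>+y. ennreal \<bar>k x y t * \<phi> y\<bar> \<partial>lborel)
      \<le> (\<integral>\<^sup>+y. ennreal (C * t powr (- a)) * (ennreal (decay_kernel d L t (x - y)) * ennreal \<bar>\<phi> y\<bar>) \<partial>lborel)"
  proof (intro nn_integral_mono)
    fix y
    have "\<bar>k x y t * \<phi> y\<bar> \<le> C * t powr (- a) * decay_kernel d L t (x - y) * \<bar>\<phi> y\<bar>"
      unfolding abs_mult using k_bound[OF t] by (intro mult_right_mono) auto
    then show "ennreal \<bar>k x y t * \<phi> y\<bar> \<le> ennreal (C * t powr (- a)) * (ennreal (decay_kernel d L t (x - y)) * ennreal \<bar>\<phi> y\<bar>)"
      using C_nonneg by (simp add: ennreal_mult[symmetric] ennreal_leI mult.assoc)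
  qed
  also have "\<dots> = ennreal (C * t powr (- a)) * potential d L (\<lambda>z. \<bar>\<phi> z\<bar>) t x"
    unfolding potential_def by (rule nn_integral_cmult) measurable
  finally show ?thesis .
qed

lemma evolution_integrable:
  assumes t: "0 < t"
  shows "integrable lborel (\<lambda>y. k x y t * \<phi> y)"
proof (rule integrableI_bounded)
  have "(\<integral>\<^sup>+y. ennreal (norm (k x y t * \<phi> y)) \<partial>lborel) \<le> ennreal (C * t powr (- a)) * ennreal (P t)"
    using order_trans[OF evolution_nn_bound[OF t, of x] mult_left_mono[OF \<phi>_potential[OF t, of x]]] by simp
  then show "(\<integral>\<^sup>+y. ennreal (norm (k x y t * \<phi> y)) \<partial>lborel) < \<infinity>"
    by (rule le_less_trans) (simp add: ennreal_mult_less_top)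
qed measurable

lemma evolution_bound:
  assumes t: "0 < t"
  shows "ennreal \<bar>evolution k \<phi> x t\<bar> \<le> ennreal (C * t powr (- a)) * potential d L (\<lambda>z. \<bar>\<phi> z\<bar>) t x"
  using integral_norm_bound_ennreal[OF evolution_integrable[OF t, of x]] evolution_nn_bound[OF t, of x]
  by (simp add: evolution_def)

lemma evolution_continuous: "continuous_on (UNIV \<times> {0<..}) (\<lambda>(x, t). evolution k \<phi> x t)"
  unfolding continuous_on_sequentially
proof (intro allI ballI impI)
  fix q :: "nat \<Rightarrow> 'a \<times> real" and r assume r: "r \<in> UNIV \<times> {0<..}" and q: "(\<forall>n. q n \<in> UNIV \<times> {0<..}) \<and> q \<longlonglongrightarrow> r"
  define x t where "x = fst r" and "t = snd r"
  define X T where "X n = fst (q n)" and "T n = snd (q n)" for n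
  have t: "t > 0" using r by (auto simp: t_def)
  have X: "X \<longlonglongrightarrow> x" and T: "T \<longlonglongrightarrow> t"
    using q by (auto simp: X_def[abs_def] T_def[abs_def] x_def t_def intro!: tendsto_intros)
  have "eventually (\<lambda>n. dist (T n) t < t / 2 \<and> dist (X n) x < t powr (1 / d)) sequentially"
    using t by (intro eventually_conj tendstoD[OF X] tendstoD[OF T]) auto
  then obtain N where N: "\<And>n. dist (T (n + N)) t < t / 2" "\<And>n. dist (X (n + N)) x < t powr (1 / d)"
    unfolding eventually_sequentially by (metis le_add2)
  define c where "c = C * (2 powr a * t powr (- a)) * (2 powr (real DIM('a) / d) * (2 * 2 powr (1 / d)) powr (real DIM('a) + L))"
  have c: "0 \<le> c" using C_nonneg by (simp add: c_def)
  have "(\<lambda>n. \<integral>y. k (X (n + N)) y (T (n + N)) * \<phi> y \<partial>lborel) \<longlonglongrightarrow> (\<integral>y. k x y t * \<phi> y \<partial>lborel)"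
  proof (rule integral_dominated_convergence[where w = "\<lambda>y. c * decay_kernel d L t (x - y) * \<bar>\<phi> y\<bar>"])
    have "(\<integral>\<^sup>+y. ennreal (norm (c * decay_kernel d L t (x - y) * \<bar>\<phi> y\<bar>)) \<partial>lborel) = ennreal c * potential d L (\<lambda>z. \<bar>\<phi> z\<bar>) t x"
      unfolding potential_def using c by (subst nn_integral_cmult[symmetric]) (auto intro!: nn_integral_cong simp: abs_mult ennreal_mult mult.assoc)
    also have "\<dots> \<le> ennreal c * ennreal (P t)" by (intro mult_left_mono \<phi>_potential t) auto
    also have "\<dots> < \<infinity>" by (simp add: ennreal_mult_less_top)
    finally show "integrable lborel (\<lambda>y. c * decay_kernel d L t (x - y) * \<bar>\<phi> y\<bar>)"
      by (intro integrableI_bounded) auto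
    have "\<bar>k (X (n + N)) y (T (n + N))\<bar> \<le> c * decay_kernel d L t (x - y)" for n y
    proof -
      have "t / 2 \<le> T (n + N)" "T (n + N) \<le> 2 * t" "norm (x - X (n + N)) \<le> t powr (1 / d)"
        using N[of n] t abs_diff_less_iff[of "T (n + N)" t "t / 2"]
        by (auto simp: dist_real_def dist_norm norm_minus_commute)
      from k_comparable[OF t this, of y] show ?thesis by (simp add: c_def mult.assoc)
    qed
    then show "AE y in lborel. norm (k (X (n + N)) y (T (n + N)) * \<phi> y) \<le> c * decay_kernel d L t (x - y) * \<bar>\<phi> y\<bar>" for n
      by (auto simp: abs_mult intro!: mult_right_mono)
    show "AE y in lborel. (\<lambda>n. k (X (n + N)) y (T (n + N)) * \<phi> y) \<longlonglongrightarrow> k x y t * \<phi> y"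
      by (auto intro!: tendsto_intros tendsto_k t LIMSEQ_ignore_initial_segment X T)
  qed measurable
  then have "(\<lambda>n. evolution k \<phi> (X n) (T n)) \<longlonglongrightarrow> evolution k \<phi> x t"
    unfolding evolution_def by (rule LIMSEQ_offset)
  then show "((\<lambda>(x, t). evolution k \<phi> x t) \<circ> q) \<longlonglongrightarrow> (case r of (x, t) \<Rightarrow> evolution k \<phi> x t)"
    by (simp add: comp_def case_prod_beta' X_def T_def x_def t_def)
qed

lemma evolution_measurable: "(\<lambda>(x, t). evolution k \<phi> x t) \<in> borel_measurable borel"
proof -
  note [measurable] = measurable_fst_borel measurable_snd_borel
  have "(\<lambda>z. k (fst (fst z)) (snd z) (snd (fst z)) * \<phi> (snd z)) \<in> borel_measurable ((borel :: ('a \<times> real) measure) \<Otimes>\<^sub>M borel)"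
    by measurable
  then have "(\<lambda>(q, y). k (fst q) y (snd q) * \<phi> y) \<in> borel_measurable ((borel :: ('a \<times> real) measure) \<Otimes>\<^sub>M lborel)"
    by (simp add: case_prod_beta' measurable_cong_sets[OF sets_pair_measure_cong[OF refl sets_lborel] refl])
  from lborel.borel_measurable_lebesgue_integral[OF this]
  show ?thesis by (simp add: evolution_def case_prod_beta')
qed

end

text \<open>All estimates apply to one word at a time; \<open>K_deriv\<close> alone relates
  different words. Because m < d, each exponent \<open>real (length \<alpha>) / d\<close> is below
  1, so every member of the family is a singular kernel in the above sense.\<close>

locale kernel_jets =
  fixes m :: nat and d L C :: real and K :: "'n::finite list \<Rightarrow> real^'n \<Rightarrow> real^'n \<Rightarrow> real \<Rightarrow> real"
  assumes m_less: "real m < d" and Lpos: "0 < L" and Cnonneg: "0 \<le> C"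
    and K_measurable: "length \<alpha> \<le> m \<Longrightarrow> (\<lambda>(x, y, t). K \<alpha> x y t) \<in> borel_measurable borel"
    and K_cont: "length \<alpha> \<le> m \<Longrightarrow> continuous_on {(x, y, t). 0 < t} (\<lambda>(x, y, t). K \<alpha> x y t)"
    and K_bound: "length \<alpha> \<le> m \<Longrightarrow> 0 < t \<Longrightarrow> \<bar>K \<alpha> x y t\<bar> \<le> C * t powr (- (real (length \<alpha>) / d)) * decay_kernel d L t (x - y)"
    and K_zero: "t \<le> 0 \<Longrightarrow> K \<alpha> x y t = 0"
    and K_deriv: "length (i # \<alpha>) \<le> m \<Longrightarrow> 0 < t \<Longrightarrow>
      ((\<lambda>h. K \<alpha> (x + h *\<^sub>R axis i 1) y t) has_real_derivative K (i # \<alpha>) x y t) (at 0)"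
begin

lemma singular: "length \<alpha> \<le> m \<Longrightarrow> singular_kernel d L (real (length \<alpha>) / d) C (K \<alpha>)"
  using m_less Lpos Cnonneg K_measurable[of \<alpha>] K_cont[of \<alpha>] K_bound[of \<alpha>] K_zero
  by unfold_locales (auto simp: field_simps)

text \<open>True for every t, since the extension by zero is trivially differentiable in space. This
  matters for Duhamel integrands, where t - s takes both signs.\<close>

lemma K_deriv_line:
  assumes "length (i # \<alpha>) \<le> m"
  shows "((\<lambda>h. K \<alpha> (x + h *\<^sub>R axis i 1) y t) has_real_derivative K (i # \<alpha>) (x + h *\<^sub>R axis i 1) y t) (at h)"
proof (cases "0 < t")
  case True
  have "((\<lambda>h'. K \<alpha> (x + (h + h') *\<^sub>R axis i 1) y t) has_real_derivative K (i # \<alpha>) (x + h *\<^sub>R axis i 1) y t) (at 0)"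
    using K_deriv[OF assms True, of "x + h *\<^sub>R axis i 1" y] by (simp add: algebra_simps)
  then show ?thesis
    using DERIV_at_within_shift[of "\<lambda>h. K \<alpha> (x + h *\<^sub>R axis i 1) y t" _ h 0 UNIV] by simp
next
  case False
  then show ?thesis by (simp add: K_zero)
qed

lemma K_cont_line:
  assumes "length \<alpha> \<le> m"
  shows "continuous_on UNIV (\<lambda>h. K \<alpha> (x + h *\<^sub>R axis i 1) y t)"
proof (cases "0 < t")
  case True
  interpret singular_kernel d L "real (length \<alpha>) / d" C "K \<alpha>" by (rule singular[OF assms])
  show ?thesis unfolding continuous_on_def
    by (auto intro!: tendsto_k tendsto_intros True)
next
  case False
  then show ?thesis by (simp add: K_zero)
qed

lemma evolution_has_derivative:
  assumes i\<alpha>: "length (i # \<alpha>) \<le> m" and \<phi>: "locally_bounded_potential d L \<phi> P" and t: "0 < t"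
  shows "((\<lambda>h. evolution (K \<alpha>) \<phi> (x + h *\<^sub>R axis i 1) t) has_real_derivative evolution (K (i # \<alpha>)) \<phi> x t) (at 0)"
proof -
  interpret locally_bounded_potential d L \<phi> P by fact
  interpret S1: singular_kernel_with_datum d L "real (length \<alpha>) / d" C "K \<alpha>" \<phi> P
    by (intro singular_kernel_with_datum.intro singular \<phi>) (use i\<alpha> in auto)
  interpret S2: singular_kernel_with_datum d L "real (length (i # \<alpha>)) / d" C "K (i # \<alpha>)" \<phi> P
    by (intro singular_kernel_with_datum.intro singular \<phi>) (use i\<alpha> in auto)
  define c where "c = C * t powr (- (real (length (i # \<alpha>)) / d)) * P t"
  have "((\<lambda>h. \<integral>y. K \<alpha> (x + h *\<^sub>R axis i 1) y t * \<phi> y \<partial>lborel) has_real_derivative (\<integral>y. K (i # \<alpha>) (x + 0 *\<^sub>R axis i 1) y t * \<phi> y \<partial>lborel)) (at 0)"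
  proof (rule lborel.has_real_derivative_integral[where c = c])
    have "(\<lambda>(h, y). K (i # \<alpha>) (x + h *\<^sub>R axis i 1) y t * \<phi> y) \<in> borel_measurable (borel \<Otimes>\<^sub>M borel)"
      by measurable
    then show "(\<lambda>(h, y). K (i # \<alpha>) (x + h *\<^sub>R axis i 1) y t * \<phi> y) \<in> borel_measurable (borel \<Otimes>\<^sub>M lborel)"
      by (simp add: measurable_cong_sets[OF sets_pair_measure_cong[OF refl sets_lborel] refl])
    show "((\<lambda>h. K \<alpha> (x + h *\<^sub>R axis i 1) y t * \<phi> y) has_real_derivative K (i # \<alpha>) (x + h *\<^sub>R axis i 1) y t * \<phi> y) (at h)" for h y
      by (rule DERIV_cmult_right[OF K_deriv_line[OF i\<alpha>]])
    show "continuous_on UNIV (\<lambda>h. K (i # \<alpha>) (x + h *\<^sub>R axis i 1) y t * \<phi> y)" for y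
      by (intro continuous_intros K_cont_line i\<alpha>)
    show "integrable lborel (\<lambda>y. K \<alpha> (x + h *\<^sub>R axis i 1) y t * \<phi> y)" for h
      by (rule S1.evolution_integrable[OF t])
    show "(\<integral>\<^sup>+y. ennreal \<bar>K (i # \<alpha>) (x + h *\<^sub>R axis i 1) y t * \<phi> y\<bar> \<partial>lborel) \<le> ennreal c" for h
    proof -
      have "(\<integral>\<^sup>+y. ennreal \<bar>K (i # \<alpha>) (x + h *\<^sub>R axis i 1) y t * \<phi> y\<bar> \<partial>lborel)
         \<le> ennreal (C * t powr (- (real (length (i # \<alpha>)) / d))) * ennreal (P t)"
        by (rule order_trans[OF S2.evolution_nn_bound[OF t] mult_left_mono[OF \<phi>_potential[OF t]]]) simp
      then show ?thesis unfolding c_def using Cnonneg by (simp add: ennreal_mult'[symmetric])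
    qed
    have "continuous_on UNIV (\<lambda>h. (x + h *\<^sub>R axis i 1, t))" by (intro continuous_intros)
    from continuous_on_compose2[OF S2.evolution_continuous this]
    show "continuous_on UNIV (\<lambda>h. \<integral>y. K (i # \<alpha>) (x + h *\<^sub>R axis i 1) y t * \<phi> y \<partial>lborel)"
      using t by (auto simp: evolution_def)
  qed
  then show ?thesis by (simp add: evolution_def)
qed

end

locale kernel_jets_with_density = kernel_jets m d L C K + ball_growth_density d L Cv b \<kappa> \<delta> \<psi>
  for m d L C and K :: "'n::finite list \<Rightarrow> real^'n \<Rightarrow> real^'n \<Rightarrow> real \<Rightarrow> real" and Cv b \<kappa> \<delta> and \<psi> :: "real^'n \<Rightarrow> real"
begin

lemma singular_density: "length \<alpha> \<le> m \<Longrightarrow> singular_kernel_with_density d L (real (length \<alpha>) / d) C (K \<alpha>) Cv b \<kappa> \<delta> \<psi>"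
  by (intro singular_kernel_with_density.intro singular ball_growth_density_axioms)

text \<open>Since \<open>length (i # \<alpha>) \<le> m\<close> and m < d, the differentiated kernel
  still has an integrable singularity in time, and the bound \<open>c' * S\<close> is uniform in
  space because the potential is.\<close>

lemma duhamel_has_derivative:
  assumes i\<alpha>: "length (i # \<alpha>) \<le> m" and f: "weighted M f" and t: "0 < t"
  shows "((\<lambda>h. duhamel (K \<alpha>) f (x + h *\<^sub>R axis i 1) t) has_real_derivative duhamel (K (i # \<alpha>)) f x t) (at 0)"
proof -
  interpret S1: singular_kernel_with_density d L "real (length \<alpha>) / d" C "K \<alpha>" Cv b \<kappa> \<delta> \<psi>
    by (rule singular_density) (use i\<alpha> in auto)
  interpret S2: singular_kernel_with_density d L "real (length (i # \<alpha>)) / d" C "K (i # \<alpha>)" Cv b \<kappa> \<delta> \<psi>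
    by (rule singular_density) (use i\<alpha> in auto)
  have [measurable]: "f \<in> borel_measurable borel" using f by (simp add: weighted_def)
  define S where "S = 2 powr (real DIM(real^'n) + L) / (1 - 2 powr (- (L + b))) * \<kappa> * t powr (- b / d)"
  define c' where "c' = M * (Cv * Beta \<delta> (1 - real (length (i # \<alpha>)) / d) * C) * t powr (\<delta> - real (length (i # \<alpha>)) / d)"
  have "((\<lambda>h. \<integral>p. K \<alpha> (x + h *\<^sub>R axis i 1) (fst p) (t - snd p) * f p \<partial>lborel)
    has_real_derivative (\<integral>p. K (i # \<alpha>) (x + 0 *\<^sub>R axis i 1) (fst p) (t - snd p) * f p \<partial>lborel)) (at 0)"
  proof (rule lborel.has_real_derivative_integral[where c = "c' * S"])
    note [measurable] = measurable_fst_borel measurable_snd_borel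
    have "(\<lambda>(h, p). K (i # \<alpha>) (x + h *\<^sub>R axis i 1) (fst p) (t - snd p) * f p) \<in> borel_measurable (borel \<Otimes>\<^sub>M borel)"
      by measurable
    then show "(\<lambda>(h, p). K (i # \<alpha>) (x + h *\<^sub>R axis i 1) (fst p) (t - snd p) * f p) \<in> borel_measurable (borel \<Otimes>\<^sub>M lborel)"
      by (simp add: measurable_cong_sets[OF sets_pair_measure_cong[OF refl sets_lborel] refl])
    show "((\<lambda>h. K \<alpha> (x + h *\<^sub>R axis i 1) (fst p) (t - snd p) * f p) has_real_derivative
       K (i # \<alpha>) (x + h *\<^sub>R axis i 1) (fst p) (t - snd p) * f p) (at h)" for h p
      by (rule DERIV_cmult_right[OF K_deriv_line[OF i\<alpha>]])
    show "continuous_on UNIV (\<lambda>h. K (i # \<alpha>) (x + h *\<^sub>R axis i 1) (fst p) (t - snd p) * f p)" for p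
      by (intro continuous_intros K_cont_line i\<alpha>)
    show "integrable lborel (\<lambda>p. K \<alpha> (x + h *\<^sub>R axis i 1) (fst p) (t - snd p) * f p)" for h
      using S1.duhamel_integrable[OF f] by (simp add: case_prod_beta')
    show "(\<integral>\<^sup>+p. ennreal \<bar>K (i # \<alpha>) (x + h *\<^sub>R axis i 1) (fst p) (t - snd p) * f p\<bar> \<partial>lborel) \<le> ennreal (c' * S)" for h
    proof -
      have c': "0 \<le> c'"
      proof -
        have "0 \<le> Beta \<delta> (1 - real (length (i # \<alpha>)) / d)"
          using S2.a_less \<delta>_pos by (intro Beta_real_nonneg) auto
        then show ?thesis using f Cnonneg Cv_pos by (simp add: c'_def weighted_def)
      qed
      have "(\<integral>\<^sup>+p. ennreal \<bar>K (i # \<alpha>) (x + h *\<^sub>R axis i 1) (fst p) (t - snd p) * f p\<bar> \<partial>lborel) \<le> ennreal c' * H t (x + h *\<^sub>R axis i 1)"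
        using S2.duhamel_nn_bound[OF f t, of "x + h *\<^sub>R axis i 1"] by (simp add: case_prod_beta' c'_def)
      also have "\<dots> \<le> ennreal c' * ennreal S"
        unfolding S_def by (intro mult_left_mono potential_le t) auto
      finally show ?thesis using c' by (simp add: ennreal_mult'[symmetric])
    qed
    have "continuous_on UNIV (\<lambda>h. (x + h *\<^sub>R axis i 1, t))" by (intro continuous_intros)
    from continuous_on_compose2[OF S2.duhamel_continuous[OF f] this]
    show "continuous_on UNIV (\<lambda>h. \<integral>p. K (i # \<alpha>) (x + h *\<^sub>R axis i 1) (fst p) (t - snd p) * f p \<partial>lborel)"
      using t by (auto simp: duhamel_def case_prod_beta')
  qed
  then show ?thesis by (simp add: duhamel_def case_prod_beta')
qed

end

section \<open>Solutions by delayed iteration and compactness\<close>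

lemma tendsto_fun_iff:
  fixes f :: "'a \<Rightarrow> 'b \<Rightarrow> 'c::topological_space"
  shows "(f \<longlongrightarrow> l) F \<longleftrightarrow> (\<forall>i. ((\<lambda>x. f x i) \<longlongrightarrow> l i) F)"
  using limitin_componentwise[of "\<lambda>_. euclidean" UNIV f l F] by (simp add: euclidean_product_topology)

lemma closed_jet_space: "closed (jet_space m)"
proof -
  have "closed {z :: 'n list \<Rightarrow> real. m < length \<alpha> \<longrightarrow> z \<alpha> = 0}" for \<alpha>
    by (cases "m < length \<alpha>") (auto intro!: closed_Collect_eq continuous_on_product_coordinates)
  then show ?thesis unfolding jet_space_def by (rule closed_Collect_all)
qed

lemma finite_words: "finite {\<alpha> :: 'n::finite list. length \<alpha> \<le> m}"
  using finite_lists_length_le[of "UNIV :: 'n set" m] by simp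

text \<open>\<Theta> describes an invariant region: inside it \<open>F_bound\<close> puts the source
  into the class \<open>weighted M\<close>, and for such sources the linear part and the Duhamel
  part each use up half of \<Theta>. These bounds never compare two values of F, so continuity is
  all the regularity that is asked of it.\<close>

locale tonelli_scheme = kernel_jets_with_density m d L C K Cv b \<kappa> \<delta> \<psi> + locally_bounded_potential d L \<phi> P
  for m d L C and K :: "'n::finite list \<Rightarrow> real^'n \<Rightarrow> real^'n \<Rightarrow> real \<Rightarrow> real" and Cv b \<kappa> \<delta> and \<psi> \<phi> :: "real^'n \<Rightarrow> real" and P +
  fixes a0 M :: real and F :: "real^'n \<Rightarrow> real \<Rightarrow> ('n list \<Rightarrow> real) \<Rightarrow> real" and \<Theta> :: "'n list \<Rightarrow> real^'n \<Rightarrow> real \<Rightarrow> real"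
  assumes M_nonneg: "0 \<le> M"
    and F_cont: "continuous_on (UNIV \<times> {0..} \<times> jet_space m) (\<lambda>(x, t, z). F x t z)"
    and F_bound: "0 < s \<Longrightarrow> z \<in> jet_space m \<Longrightarrow> (\<And>\<alpha>. length \<alpha> \<le> m \<Longrightarrow> \<bar>z \<alpha>\<bar> \<le> \<Theta> \<alpha> y s) \<Longrightarrow> ennreal \<bar>F y s z\<bar> \<le> ennreal M * B (y, s)"
    and evolution_le: "length \<alpha> \<le> m \<Longrightarrow> 0 < t \<Longrightarrow> \<bar>evolution (K \<alpha>) \<phi> x t\<bar> \<le> \<Theta> \<alpha> x t / 2"
    and duhamel_le: "length \<alpha> \<le> m \<Longrightarrow> 0 < t \<Longrightarrow> weighted M f \<Longrightarrow> \<bar>a0 * duhamel (K \<alpha>) f x t\<bar> \<le> \<Theta> \<alpha> x t / 2"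
begin

lemma datum: "length \<alpha> \<le> m \<Longrightarrow> singular_kernel_with_datum d L (real (length \<alpha>) / d) C (K \<alpha>) \<phi> P"
  by (intro singular_kernel_with_datum.intro singular locally_bounded_potential_axioms)

definition source :: "('n list \<Rightarrow> (real^'n) \<times> real \<Rightarrow> real) \<Rightarrow> (real^'n) \<times> real \<Rightarrow> real" where
  "source w = (\<lambda>(y, s). if 0 < s then F y s (\<lambda>\<alpha>. if length \<alpha> \<le> m then w \<alpha> (y, s) else 0) else 0)"

definition dominated :: "('n list \<Rightarrow> (real^'n) \<times> real \<Rightarrow> real) \<Rightarrow> bool" where
  "dominated w \<longleftrightarrow> (\<forall>\<alpha>. length \<alpha> \<le> m \<longrightarrow> w \<alpha> \<in> borel_measurable borel \<and> (\<forall>x t. 0 < t \<longrightarrow> \<bar>w \<alpha> (x, t)\<bar> \<le> \<Theta> \<alpha> x t))"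

text \<open>The delay is realised by discarding the most recent sources instead of shifting the
  argument of the solution. Truncation keeps a source in \<open>weighted M\<close> with the same M,
  so the invariant bounds hold unchanged for every delay.\<close>

definition delayed :: "real \<Rightarrow> ((real^'n) \<times> real \<Rightarrow> real) \<Rightarrow> (real^'n) \<times> real \<Rightarrow> real" where
  "delayed r f = (\<lambda>p. if snd p < r then f p else 0)"

definition step :: "real \<Rightarrow> ('n list \<Rightarrow> (real^'n) \<times> real \<Rightarrow> real) \<Rightarrow> 'n list \<Rightarrow> (real^'n) \<times> real \<Rightarrow> real" where
  "step \<epsilon> w \<alpha> = (\<lambda>(x, t). evolution (K \<alpha>) \<phi> x t + a0 * duhamel (K \<alpha>) (delayed (t - \<epsilon>) (source w)) x t)"

definition iterate :: "real \<Rightarrow> nat \<Rightarrow> 'n list \<Rightarrow> (real^'n) \<times> real \<Rightarrow> real" where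
  "iterate \<epsilon> n = (step \<epsilon> ^^ n) (\<lambda>\<alpha> (x, t). evolution (K \<alpha>) \<phi> x t)"

lemma jet_in_jet_space: "(\<lambda>\<alpha> :: 'n list. if length \<alpha> \<le> m then w \<alpha> else 0) \<in> jet_space m"
  by (simp add: jet_space_def)

text \<open>Outside nonnegative times and the jet space F is arbitrary. It is therefore cut off by
  the indicator of a Borel set S on which it is continuous; padding words longer than m by 0 ensures
  that for s > 0 only points of S are evaluated.\<close>

lemma source_measurable:
  assumes [measurable]: "\<And>\<alpha>. length \<alpha> \<le> m \<Longrightarrow> w \<alpha> \<in> borel_measurable borel"
  shows "source w \<in> borel_measurable borel"
proof -
  define S where "S = {q :: (real^'n) \<times> real \<times> ('n list \<Rightarrow> real). 0 < fst (snd q)} \<inter> (\<lambda>q. snd (snd q)) -` jet_space m"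
  have S: "S \<in> sets borel"
    unfolding S_def
    by (intro sets.Int borel_open borel_closed open_Collect_less closed_vimage closed_jet_space continuous_intros)
  have "continuous_on S (\<lambda>(x, t, z). F x t z)"
    by (rule continuous_on_subset[OF F_cont]) (auto simp: S_def)
  from borel_measurable_continuous_on_indicator[OF S this]
  have \<Phi>: "(\<lambda>q. indicator S q *\<^sub>R (case q of (x, t, z) \<Rightarrow> F x t z)) \<in> borel_measurable borel" .
  have z: "(\<lambda>p \<alpha>. if length \<alpha> \<le> m then w \<alpha> p else 0) \<in> borel_measurable borel"
  proof (rule measurable_coordinatewise_then_product)
    show "(\<lambda>p. if length \<alpha> \<le> m then w \<alpha> p else 0) \<in> borel_measurable borel" for \<alpha>
      using assms[of \<alpha>] by (cases "length \<alpha> \<le> m") auto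
  qed
  note [measurable] = z measurable_fst_borel measurable_snd_borel
  have "(\<lambda>p. (fst p, snd p, \<lambda>\<alpha>. if length \<alpha> \<le> m then w \<alpha> p else 0)) \<in> borel_measurable borel"
    by (intro borel_measurable_Pair z measurable_fst_borel measurable_snd_borel)
  from measurable_compose[OF this \<Phi>]
  have "(\<lambda>p. indicator S (fst p, snd p, \<lambda>\<alpha>. if length \<alpha> \<le> m then w \<alpha> p else 0) *
      F (fst p) (snd p) (\<lambda>\<alpha>. if length \<alpha> \<le> m then w \<alpha> p else 0)) \<in> borel_measurable borel" by simp
  moreover have "(\<lambda>p. indicator S (fst p, snd p, \<lambda>\<alpha>. if length \<alpha> \<le> m then w \<alpha> p else 0) *
      F (fst p) (snd p) (\<lambda>\<alpha>. if length \<alpha> \<le> m then w \<alpha> p else 0)) = source w"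
    using jet_in_jet_space by (auto simp: fun_eq_iff source_def S_def indicator_def)
  ultimately show ?thesis by simp
qed

lemma source_weighted:
  assumes w: "dominated w"
  shows "weighted M (source w)"
  unfolding weighted_def
proof (intro conjI allI M_nonneg)
  show "source w \<in> borel_measurable borel"
    by (rule source_measurable) (use w in \<open>simp add: dominated_def\<close>)
  fix p :: "(real^'n) \<times> real"
  obtain y s where p: "p = (y, s)" by (cases p)
  show "ennreal \<bar>source w p\<bar> \<le> ennreal M * B p"
  proof (cases "0 < s")
    case True
    have "ennreal \<bar>F y s (\<lambda>\<alpha>. if length \<alpha> \<le> m then w \<alpha> (y, s) else 0)\<bar> \<le> ennreal M * B (y, s)"
      using w True by (intro F_bound jet_in_jet_space) (auto simp: dominated_def)
    then show ?thesis using True by (simp add: source_def p)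
  qed (simp add: source_def p)
qed

lemma delayed_weighted: "weighted M f \<Longrightarrow> weighted M (delayed r f)"
proof -
  assume f: "weighted M f"
  note [measurable] = measurable_snd_borel
  have [measurable]: "f \<in> borel_measurable borel" using f by (simp add: weighted_def)
  have "delayed r f \<in> borel_measurable borel" unfolding delayed_def by measurable
  then show ?thesis using f by (auto simp: weighted_def delayed_def)
qed

lemma step_dominated:
  assumes w: "dominated w"
  shows "dominated (step \<epsilon> w)"
  unfolding dominated_def
proof (intro allI impI conjI)
  fix \<alpha> :: "'n list" assume \<alpha>: "length \<alpha> \<le> m"
  interpret S: singular_kernel_with_datum d L "real (length \<alpha>) / d" C "K \<alpha>" \<phi> P by (rule datum[OF \<alpha>])
  note [measurable] = measurable_snd_borel measurable_fst_borel
  have sw: "weighted M (source w)" by (rule source_weighted[OF w])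
  then have [measurable]: "source w \<in> borel_measurable borel" by (simp add: weighted_def)
  have "(\<lambda>z. K \<alpha> (fst (fst z)) (fst (snd z)) (snd (fst z) - snd (snd z)) * (if snd (snd z) < snd (fst z) - \<epsilon> then source w (snd z) else 0))
      \<in> borel_measurable ((borel :: ((real^'n) \<times> real) measure) \<Otimes>\<^sub>M borel)"
    by measurable
  then have "(\<lambda>(q, p). K \<alpha> (fst q) (fst p) (snd q - snd p) * delayed (snd q - \<epsilon>) (source w) p)
      \<in> borel_measurable ((borel :: ((real^'n) \<times> real) measure) \<Otimes>\<^sub>M lborel)"
    by (simp add: delayed_def case_prod_beta' measurable_cong_sets[OF sets_pair_measure_cong[OF refl sets_lborel] refl])
  from lborel.borel_measurable_lebesgue_integral[OF this]
  have [measurable]: "(\<lambda>q. duhamel (K \<alpha>) (delayed (snd q - \<epsilon>) (source w)) (fst q) (snd q)) \<in> borel_measurable borel"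
    by (simp add: duhamel_def case_prod_beta')
  have [measurable]: "(\<lambda>q. evolution (K \<alpha>) \<phi> (fst q) (snd q)) \<in> borel_measurable borel"
    using S.evolution_measurable by (simp add: case_prod_beta')
  show "step \<epsilon> w \<alpha> \<in> borel_measurable borel"
    unfolding step_def case_prod_beta' by measurable
  fix x :: "real^'n" and t :: real assume t: "0 < t"
  show "\<bar>step \<epsilon> w \<alpha> (x, t)\<bar> \<le> \<Theta> \<alpha> x t"
    using evolution_le[OF \<alpha> t, of x] duhamel_le[OF \<alpha> t delayed_weighted[OF sw], of "t - \<epsilon>" x]
    by (simp add: step_def)
qed

lemma iterate_dominated: "dominated (iterate \<epsilon> n)"
proof (induction n)
  case 0
  show ?case unfolding dominated_def
  proof (intro allI impI conjI)
    fix \<alpha> :: "'n list" assume \<alpha>: "length \<alpha> \<le> m"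
    interpret S: singular_kernel_with_datum d L "real (length \<alpha>) / d" C "K \<alpha>" \<phi> P by (rule datum[OF \<alpha>])
    show "iterate \<epsilon> 0 \<alpha> \<in> borel_measurable borel" using S.evolution_measurable by (simp add: iterate_def)
    fix x :: "real^'n" and t :: real assume t: "0 < t"
    show "\<bar>iterate \<epsilon> 0 \<alpha> (x, t)\<bar> \<le> \<Theta> \<alpha> x t"
      using evolution_le[OF \<alpha> t, of x] by (simp add: iterate_def)
  qed
next
  case (Suc n)
  then show ?case using step_dominated by (simp add: iterate_def)
qed

text \<open>With a delay \<open>\<epsilon>\<close> every iteration determines the solution on a further time interval of length \<open>\<epsilon>\<close>.\<close>

lemma iterate_stable:
  assumes "0 < \<epsilon>" "t \<le> (real n + 1) * \<epsilon>"
  shows "iterate \<epsilon> (Suc n) \<alpha> (x, t) = iterate \<epsilon> n \<alpha> (x, t)"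
  using assms(2)
proof (induction n arbitrary: \<alpha> x t)
  case 0
  \<comment> \<open>For t \<le> \<epsilon> only times s < t - \<epsilon> \<le> 0 survive the
    truncation, and there sources vanish. Hence the iteration without any step is already exact up
    to time \<epsilon>, which explains n + 1 in the claim.\<close>
  have "delayed (t - \<epsilon>) (source (iterate \<epsilon> 0)) = (\<lambda>_. 0)"
    using 0 by (auto simp: delayed_def source_def fun_eq_iff)
  then show ?case by (simp add: iterate_def step_def duhamel_def case_prod_beta')
next
  case (Suc n)
  have "delayed (t - \<epsilon>) (source (iterate \<epsilon> (Suc n))) = delayed (t - \<epsilon>) (source (iterate \<epsilon> n))"
  proof
    fix p :: "(real^'n) \<times> real"
    obtain y s where p: "p = (y, s)" by (cases p)
    show "delayed (t - \<epsilon>) (source (iterate \<epsilon> (Suc n))) p = delayed (t - \<epsilon>) (source (iterate \<epsilon> n)) p"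
    proof (cases "s < t - \<epsilon>")
      case True
      then have "s \<le> (real n + 1) * \<epsilon>" using Suc.prems by (simp add: algebra_simps)
      then have "(\<lambda>\<alpha>. if length \<alpha> \<le> m then iterate \<epsilon> (Suc n) \<alpha> (y, s) else 0)
          = (\<lambda>\<alpha>. if length \<alpha> \<le> m then iterate \<epsilon> n \<alpha> (y, s) else 0)"
        by (intro ext if_cong refl Suc.IH)
      then show ?thesis by (simp add: p delayed_def source_def)
    qed (simp add: p delayed_def)
  qed
  then show ?case
    by (simp add: iterate_def step_def)
qed

text \<open>(n + 1)^2 steps of length 1/(n + 1) reach time n + 1: the delay tends to 0 while the
  interval on which the delayed equation holds exactly exhausts the half-line.\<close>

definition approximant :: "nat \<Rightarrow> 'n list \<Rightarrow> (real^'n) \<times> real \<Rightarrow> real" where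
  "approximant n = iterate (1 / (real n + 1)) ((n + 1) ^ 2)"

lemma approximant_eq:
  assumes "t \<le> real n + 1"
  shows "approximant n \<alpha> (x, t) = step (1 / (real n + 1)) (approximant n) \<alpha> (x, t)"
proof -
  have "real n + 1 \<le> (real ((n + 1) ^ 2) + 1) * (1 / (real n + 1))"
    by (simp add: field_simps power2_eq_square)
  then have "t \<le> (real ((n + 1) ^ 2) + 1) * (1 / (real n + 1))" using assms by linarith
  from iterate_stable[OF _ this, of \<alpha> x] show ?thesis
    by (simp add: approximant_def iterate_def)
qed

section \<open>Compactness and passage to the limit\<close>

lemma approximant_dominated: "dominated (approximant n)"
  unfolding approximant_def by (rule iterate_dominated)

text \<open>The discarded sources lie within 1/(n + 1) of the singular time, where the near-part
  estimate is uniform over \<open>weighted M\<close>; therefore the source may vary with n.\<close>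

lemma delayed_duhamel_tendsto:
  assumes \<alpha>: "length \<alpha> \<le> m" and t: "0 < t" and f: "\<And>n. weighted M (f n)"
  shows "(\<lambda>n. duhamel (K \<alpha>) (delayed (t - 1 / (real n + 1)) (f n)) x t - duhamel (K \<alpha>) (f n) x t) \<longlonglongrightarrow> 0"
proof -
  interpret S: singular_kernel_with_density d L "real (length \<alpha>) / d" C "K \<alpha>" Cv b \<kappa> \<delta> \<psi>
    by (rule singular_density[OF \<alpha>])
  define e where "e = (1 - real (length \<alpha>) / d) / 2"
  have e: "0 < e" using S.a_less by (simp add: e_def)
  obtain Q where Q: "0 \<le> Q" and near: "\<And>\<rho>. 0 < \<rho> \<Longrightarrow>
      (\<integral>\<^sup>+p. (case p of (y, s) \<Rightarrow> ennreal (indicator {t - \<rho><..} s * \<bar>K \<alpha> x y (t - s)\<bar>)) * B p \<partial>lborel) \<le> ennreal (Q * \<rho> powr e)"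
  proof -
    obtain Q where "0 \<le> Q" and "\<And>t x \<rho>. 0 < t \<Longrightarrow> 0 < \<rho> \<Longrightarrow>
      (\<integral>\<^sup>+p. (case p of (y, s) \<Rightarrow> ennreal (indicator {t - \<rho><..} s * \<bar>K \<alpha> x y (t - s)\<bar>)) * B p \<partial>lborel)
      \<le> ennreal (Q * \<rho> powr e * t powr (\<delta> - (1 + real (length \<alpha>) / d) / 2 - b / d))"
      using S.near_part_le unfolding e_def by blast
    then show ?thesis using t
      by (intro that[of "Q * t powr (\<delta> - (1 + real (length \<alpha>) / d) / 2 - b / d)"]) (auto simp: mult_ac)
  qed
  have bd: "\<bar>duhamel (K \<alpha>) (delayed (t - 1 / (real n + 1)) (f n)) x t - duhamel (K \<alpha>) (f n) x t\<bar> \<le> M * (Q * (2 * (1 / (real n + 1))) powr e)" for n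
  proof -
    define \<rho> where "\<rho> = 1 / (real n + 1)"
    have \<rho>: "0 < \<rho>" by (simp add: \<rho>_def)
    let ?g = "delayed (t - \<rho>) (f n)"
    note wg = delayed_weighted[OF f[of n], of "t - \<rho>"]
    have [measurable]: "(\<lambda>(y, s). ennreal (indicator {t - 2 * \<rho><..} s * \<bar>K \<alpha> x y (t - s)\<bar>)) \<in> borel_measurable borel"
      unfolding borel_prod[symmetric] by measurable
    have int: "integrable lborel (\<lambda>p. (case p of (y, s) \<Rightarrow> K \<alpha> x y (t - s) * ?g (y, s)) - (case p of (y, s) \<Rightarrow> K \<alpha> x y (t - s) * f n (y, s)))"
      by (intro Bochner_Integration.integrable_diff S.duhamel_integrable[OF wg] S.duhamel_integrable[OF f])
    have "duhamel (K \<alpha>) ?g x t - duhamel (K \<alpha>) (f n) x t =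
      (\<integral>p. (case p of (y, s) \<Rightarrow> K \<alpha> x y (t - s) * ?g (y, s)) - (case p of (y, s) \<Rightarrow> K \<alpha> x y (t - s) * f n (y, s)) \<partial>lborel)"
      unfolding duhamel_def by (subst Bochner_Integration.integral_diff) (auto intro: S.duhamel_integrable[OF wg] S.duhamel_integrable[OF f])
    then have "ennreal \<bar>duhamel (K \<alpha>) ?g x t - duhamel (K \<alpha>) (f n) x t\<bar> \<le>
      (\<integral>\<^sup>+p. ennreal \<bar>(case p of (y, s) \<Rightarrow> K \<alpha> x y (t - s) * ?g (y, s)) - (case p of (y, s) \<Rightarrow> K \<alpha> x y (t - s) * f n (y, s))\<bar> \<partial>lborel)"
      using integral_norm_bound_ennreal[OF int] by simp
    \<comment> \<open>The factor 2 accounts for the endpoint: truncation also discards s = t -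
      \<rho>, whereas the near-part estimate concerns a half-line open on the left.\<close>
    also have "\<dots> \<le> (\<integral>\<^sup>+p. ennreal M * ((case p of (y, s) \<Rightarrow> ennreal (indicator {t - 2 * \<rho><..} s * \<bar>K \<alpha> x y (t - s)\<bar>)) * B p) \<partial>lborel)"
    proof (intro nn_integral_mono, clarify)
      fix y :: "real^'n" and s :: real
      show "ennreal \<bar>K \<alpha> x y (t - s) * ?g (y, s) - K \<alpha> x y (t - s) * f n (y, s)\<bar>
        \<le> ennreal M * (ennreal (indicator {t - 2 * \<rho><..} s * \<bar>K \<alpha> x y (t - s)\<bar>) * B (y, s))"
      proof (cases "s < t - \<rho>")
        case True
        then show ?thesis by (simp add: delayed_def)
      next
        case False
        then have "ennreal \<bar>K \<alpha> x y (t - s) * ?g (y, s) - K \<alpha> x y (t - s) * f n (y, s)\<bar> = ennreal \<bar>K \<alpha> x y (t - s)\<bar> * ennreal \<bar>f n (y, s)\<bar>"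
          by (simp add: delayed_def abs_mult ennreal_mult)
        also have "\<dots> \<le> ennreal \<bar>K \<alpha> x y (t - s)\<bar> * (ennreal M * B (y, s))"
          using f by (intro mult_left_mono) (auto simp: weighted_def)
        finally show ?thesis using False \<rho> by (simp add: mult_ac)
      qed
    qed
    also have "\<dots> = ennreal M * (\<integral>\<^sup>+p. (case p of (y, s) \<Rightarrow> ennreal (indicator {t - 2 * \<rho><..} s * \<bar>K \<alpha> x y (t - s)\<bar>)) * B p \<partial>lborel)"
      by (rule nn_integral_cmult) measurable
    also have "\<dots> \<le> ennreal M * ennreal (Q * (2 * \<rho>) powr e)"
      using \<rho> by (intro mult_left_mono near) auto
    also have "\<dots> = ennreal (M * (Q * (2 * \<rho>) powr e))"
      using M_nonneg Q by (simp add: ennreal_mult[symmetric])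
    finally show ?thesis using M_nonneg Q by (simp add: ennreal_le_iff \<rho>_def)
  qed
  have "(\<lambda>n. 2 * (1 / (real n + 1))) \<longlonglongrightarrow> 2 * 0"
    using LIMSEQ_inverse_real_of_nat by (intro tendsto_intros) (simp add: inverse_eq_divide add.commute)
  then have "(\<lambda>n. (2 * (1 / (real n + 1))) powr e) \<longlonglongrightarrow> (2 * 0) powr e"
    by (rule tendsto_powr2[OF _ tendsto_const]) (use e in auto)
  then have "(\<lambda>n. M * (Q * (2 * (1 / (real n + 1))) powr e)) \<longlonglongrightarrow> M * (Q * (2 * 0) powr e)"
    by (intro tendsto_mult tendsto_const)
  then have "(\<lambda>n. M * (Q * (2 * (1 / (real n + 1))) powr e)) \<longlonglongrightarrow> 0" by simp
  then show ?thesis by (rule Lim_null_comparison[OF always_eventually, rotated]) (use bd in auto)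
qed

text \<open>The Arzela-Ascoli argument in pointwise form. A diagonal selection makes all words
  converge on a countable dense set, and equicontinuity, which is uniform in the source, extends the
  Cauchy property to every point of positive time.\<close>

lemma duhamel_convergent_subsequence:
  assumes f: "\<And>n. weighted M (f n)"
  obtains r :: "nat \<Rightarrow> nat" where "strict_mono r"
    "\<And>\<alpha> x t. length \<alpha> \<le> m \<Longrightarrow> 0 < t \<Longrightarrow> convergent (\<lambda>n. a0 * duhamel (K \<alpha>) (f (r n)) x t)"
proof -
  obtain D :: "((real^'n) \<times> real) set" where D: "countable D" and dense: "\<And>X. open X \<Longrightarrow> X \<noteq> {} \<Longrightarrow> \<exists>d\<in>D. d \<in> X"
    using countable_dense_setE by blast
  define I where "I = {\<alpha> :: 'n list. length \<alpha> \<le> m} \<times> {p \<in> D. 0 < snd p}"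
  have I: "countable I" unfolding I_def
    by (intro countable_SIGMA countable_finite[OF finite_words] countable_subset[OF _ D]) auto
  define U where "U n \<alpha> x t = a0 * duhamel (K \<alpha>) (f n) x t" for n \<alpha> x t
  \<comment> \<open>The selection principle wants one bound for all indices, so values are divided
    by their a priori bound; adding 1 avoids a division by zero where \<Theta> vanishes.\<close>
  define g where "g n = (\<lambda>(\<alpha>, x, t). U n \<alpha> x t / (\<Theta> \<alpha> x t / 2 + 1))" for n
  have g1: "norm (g n i) \<le> 1" if "i \<in> I" for n i
  proof -
    obtain \<alpha> x t where i: "i = (\<alpha>, x, t)" by (cases i)
    have h: "length \<alpha> \<le> m" "0 < t" using that by (auto simp: I_def i)
    have "\<bar>U n \<alpha> x t\<bar> \<le> \<Theta> \<alpha> x t / 2" unfolding U_def by (rule duhamel_le[OF h f])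
    then show ?thesis by (simp add: g_def i)
  qed
  obtain r where r: "strict_mono (r :: nat \<Rightarrow> nat)" and conv: "\<And>i. i \<in> I \<Longrightarrow> \<exists>l. (\<lambda>n. g (r n) i) \<longlonglongrightarrow> l"
    using function_convergent_subsequence[OF I, of g 1] g1 by blast
  have U_conv: "convergent (\<lambda>n. U (r n) \<alpha> x t)" if i: "(\<alpha>, x, t) \<in> I" for \<alpha> x t
  proof -
    obtain l where l: "(\<lambda>n. g (r n) (\<alpha>, x, t)) \<longlonglongrightarrow> l" using conv[OF i] by blast
    have h: "length \<alpha> \<le> m" "0 < t" using i by (auto simp: I_def)
    have "0 \<le> \<Theta> \<alpha> x t / 2" using duhamel_le[OF h f[of 0], of x] by linarith
    then have "U (r n) \<alpha> x t = g (r n) (\<alpha>, x, t) * (\<Theta> \<alpha> x t / 2 + 1)" for n by (simp add: g_def)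
    moreover have "(\<lambda>n. g (r n) (\<alpha>, x, t) * (\<Theta> \<alpha> x t / 2 + 1)) \<longlonglongrightarrow> l * (\<Theta> \<alpha> x t / 2 + 1)"
      by (intro tendsto_intros l)
    ultimately show ?thesis unfolding convergent_def by auto
  qed
  have "convergent (\<lambda>n. a0 * duhamel (K \<alpha>) (f (r n)) x t)" if \<alpha>: "length \<alpha> \<le> m" and t: "0 < t" for \<alpha> x t
  proof -
    interpret S: singular_kernel_with_density d L "real (length \<alpha>) / d" C "K \<alpha>" Cv b \<kappa> \<delta> \<psi>
      by (rule singular_density[OF \<alpha>])
    have "Cauchy (\<lambda>n. U (r n) \<alpha> x t)"
    proof (rule metric_CauchyI)
      fix \<epsilon> :: real assume \<epsilon>: "0 < \<epsilon>"
      then have "0 < \<epsilon> / (3 * (\<bar>a0\<bar> + 1))" by simp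
      from S.duhamel_equicontinuous[OF t M_nonneg this, of x]
      obtain \<rho> where \<rho>: "\<rho> > 0" and eq: "\<And>x' t' f. weighted M f \<Longrightarrow> dist (x', t') (x, t) < \<rho> \<Longrightarrow> \<bar>duhamel (K \<alpha>) f x' t' - duhamel (K \<alpha>) f x t\<bar> < \<epsilon> / (3 * (\<bar>a0\<bar> + 1))"
        by blast
      obtain x' t' where p: "(x', t') \<in> D" "dist (x', t') (x, t) < min \<rho> t"
      proof -
        have "\<exists>q\<in>D. q \<in> ball (x, t) (min \<rho> t)" using \<rho> t by (intro dense) auto
        then obtain q where "q \<in> D" "dist q (x, t) < min \<rho> t" unfolding mem_ball by (metis dist_commute)
        then show ?thesis using that[of "fst q" "snd q"] by simp
      qed
      have "dist t' t \<le> dist (x', t') (x, t)" using dist_snd_le[of "(x', t')" "(x, t)"] by simp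
      then have "t' > 0" using p by (auto simp: dist_real_def)
      then have pI: "(\<alpha>, x', t') \<in> I" using p \<alpha> by (simp add: I_def)
      have close: "\<bar>U n \<alpha> x' t' - U n \<alpha> x t\<bar> \<le> \<epsilon> / 3" for n
      proof -
        have "\<bar>U n \<alpha> x' t' - U n \<alpha> x t\<bar> = \<bar>a0\<bar> * \<bar>duhamel (K \<alpha>) (f n) x' t' - duhamel (K \<alpha>) (f n) x t\<bar>"
          by (simp add: U_def right_diff_distrib[symmetric] abs_mult)
        also have "\<dots> \<le> \<bar>a0\<bar> * (\<epsilon> / (3 * (\<bar>a0\<bar> + 1)))"
          using eq[OF f[of n], of x' t'] p by (intro mult_left_mono) auto
        also have "\<dots> \<le> \<epsilon> / 3" using \<epsilon> by (simp add: field_simps)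
        finally show ?thesis .
      qed
      from U_conv[OF pI] have "Cauchy (\<lambda>n. U (r n) \<alpha> x' t')" by (rule convergent_Cauchy)
      then obtain N where N: "\<And>i j. N \<le> i \<Longrightarrow> N \<le> j \<Longrightarrow> dist (U (r i) \<alpha> x' t') (U (r j) \<alpha> x' t') < \<epsilon> / 3"
        using \<epsilon> unfolding Cauchy_def by (meson divide_pos_pos zero_less_numeral)
      show "\<exists>N. \<forall>i\<ge>N. \<forall>j\<ge>N. dist (U (r i) \<alpha> x t) (U (r j) \<alpha> x t) < \<epsilon>"
      proof (intro exI allI impI)
        fix i j assume "N \<le> i" "N \<le> j"
        moreover have "\<epsilon> = \<epsilon> / 3 + \<epsilon> / 3 + \<epsilon> / 3" by simp
        ultimately show "dist (U (r i) \<alpha> x t) (U (r j) \<alpha> x t) < \<epsilon>"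
          using N[of i j] close[of "r i"] close[of "r j"] unfolding dist_real_def by (smt (verit) field_sum_of_halves)
      qed
    qed
    then show ?thesis by (simp add: Cauchy_convergent_iff U_def)
  qed
  with r show ?thesis by (rule that)
qed

lemma duhamel_tendsto:
  assumes \<alpha>: "length \<alpha> \<le> m" and t: "0 < t" and f: "\<And>n. weighted M (f n)" and g: "weighted M g"
    and lim: "\<And>p. (\<lambda>n. f n p) \<longlonglongrightarrow> g p"
  shows "(\<lambda>n. duhamel (K \<alpha>) (f n) x t) \<longlonglongrightarrow> duhamel (K \<alpha>) g x t"
proof -
  interpret S: singular_kernel_with_density d L "real (length \<alpha>) / d" C "K \<alpha>" Cv b \<kappa> \<delta> \<psi>
    by (rule singular_density[OF \<alpha>])
  \<comment> \<open>The extremal source: the weight is finite, and its real version lies in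
    \<open>weighted M\<close> itself, so its integrability against the kernel is already known and
    provides the majorant.\<close>
  define e where "e p = M * enn2real (B p)" for p
  have eB: "ennreal (e p) = ennreal M * B p" for p
    using parabolic_weight_finite[of p] M_nonneg by (simp add: e_def ennreal_mult)
  have e0: "0 \<le> e p" for p using M_nonneg by (simp add: e_def)
  have [measurable]: "e \<in> borel_measurable borel" unfolding e_def[abs_def] by measurable
  have we: "weighted M e"
    unfolding weighted_def using M_nonneg eB e0 by (auto simp: e_def)
  have fe: "\<bar>f n p\<bar> \<le> e p" for n p
  proof -
    have "ennreal \<bar>f n p\<bar> \<le> ennreal (e p)" unfolding eB using f[of n] by (cases p) (simp add: weighted_def)
    then show ?thesis using e0 by (simp add: ennreal_le_iff)
  qed
  have "(\<lambda>n. \<integral>(y, s). K \<alpha> x y (t - s) * f n (y, s) \<partial>lborel) \<longlonglongrightarrow> (\<integral>(y, s). K \<alpha> x y (t - s) * g (y, s) \<partial>lborel)"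
  proof (rule integral_dominated_convergence[where w = "\<lambda>p. \<bar>case p of (y, s) \<Rightarrow> K \<alpha> x y (t - s) * e (y, s)\<bar>"])
    show "integrable lborel (\<lambda>p. \<bar>case p of (y, s) \<Rightarrow> K \<alpha> x y (t - s) * e (y, s)\<bar>)"
      by (rule integrable_abs[OF S.duhamel_integrable[OF we]])
    show "(\<lambda>(y, s). K \<alpha> x y (t - s) * f n (y, s)) \<in> borel_measurable lborel" for n
      by (rule borel_measurable_integrable[OF S.duhamel_integrable[OF f]])
    show "(\<lambda>(y, s). K \<alpha> x y (t - s) * g (y, s)) \<in> borel_measurable lborel"
      by (rule borel_measurable_integrable[OF S.duhamel_integrable[OF g]])
    show "AE p in lborel. norm (case p of (y, s) \<Rightarrow> K \<alpha> x y (t - s) * f n (y, s)) \<le> \<bar>case p of (y, s) \<Rightarrow> K \<alpha> x y (t - s) * e (y, s)\<bar>" for n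
      using fe e0 by (intro AE_I2) (auto simp: abs_mult intro!: mult_left_mono)
    show "AE p in lborel. (\<lambda>n. case p of (y, s) \<Rightarrow> K \<alpha> x y (t - s) * f n (y, s)) \<longlonglongrightarrow> (case p of (y, s) \<Rightarrow> K \<alpha> x y (t - s) * g (y, s))"
      using lim by (auto intro!: tendsto_intros)
  qed
  then show ?thesis by (simp add: duhamel_def)
qed

text \<open>The sources have no common modulus of continuity; only their Duhamel integrals are
  compact. Convergence of these gives, since the delay disappears, convergence of the approximants;
  continuity of F passes it on to the sources, and \<open>duhamel_tendsto\<close> then identifies
  the limit.\<close>

lemma jet_solution_exists:
  obtains w where "dominated w"
    "\<And>\<alpha> x t. length \<alpha> \<le> m \<Longrightarrow> 0 < t \<Longrightarrow> w \<alpha> (x, t) = evolution (K \<alpha>) \<phi> x t + a0 * duhamel (K \<alpha>) (source w) x t"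
proof -
  define f where "f n = source (approximant n)" for n
  have f: "weighted M (f n)" for n
    unfolding f_def by (rule source_weighted[OF approximant_dominated])
  obtain r :: "nat \<Rightarrow> nat" where r: "strict_mono r" and
    conv: "\<And>\<alpha> x t. length \<alpha> \<le> m \<Longrightarrow> 0 < t \<Longrightarrow> convergent (\<lambda>n. a0 * duhamel (K \<alpha>) (f (r n)) x t)"
    using duhamel_convergent_subsequence[where f = f] f by metis
  define w where "w \<alpha> = (\<lambda>(x, t). if 0 < t then evolution (K \<alpha>) \<phi> x t + lim (\<lambda>n. a0 * duhamel (K \<alpha>) (f (r n)) x t) else 0)" for \<alpha>
  have A: "(\<lambda>n. approximant (r n) \<alpha> (x, t)) \<longlonglongrightarrow> w \<alpha> (x, t)" if \<alpha>: "length \<alpha> \<le> m" and t: "0 < t" for \<alpha> x t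
  proof -
    have 1: "(\<lambda>n. evolution (K \<alpha>) \<phi> x t + (a0 * duhamel (K \<alpha>) (f (r n)) x t +
        a0 * (duhamel (K \<alpha>) (delayed (t - 1 / (real (r n) + 1)) (f (r n))) x t - duhamel (K \<alpha>) (f (r n)) x t)))
      \<longlonglongrightarrow> evolution (K \<alpha>) \<phi> x t + (lim (\<lambda>n. a0 * duhamel (K \<alpha>) (f (r n)) x t) + a0 * 0)"
      using LIMSEQ_subseq_LIMSEQ[OF delayed_duhamel_tendsto[OF \<alpha> t f] r] conv[OF \<alpha> t, of x]
      by (intro tendsto_intros) (auto simp: convergent_LIMSEQ_iff comp_def)
    obtain N :: nat where N: "t \<le> real N" using real_arch_simple by blast
    have "eventually (\<lambda>n. evolution (K \<alpha>) \<phi> x t + (a0 * duhamel (K \<alpha>) (f (r n)) x t +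
        a0 * (duhamel (K \<alpha>) (delayed (t - 1 / (real (r n) + 1)) (f (r n))) x t - duhamel (K \<alpha>) (f (r n)) x t)) = approximant (r n) \<alpha> (x, t)) sequentially"
      using eventually_ge_at_top[of N]
    proof eventually_elim
      case (elim n)
      have "n \<le> r n" by (rule seq_suble[OF r])
      then have "real N \<le> real (r n)" using elim by linarith
      then have "t \<le> real (r n) + 1" using N by linarith
      from approximant_eq[OF this, of \<alpha> x] show ?case
        by (simp add: step_def f_def right_diff_distrib)
    qed
    from Lim_transform_eventually[OF 1 this] show ?thesis using t by (simp add: w_def)
  qed
  have dom: "dominated w"
    unfolding dominated_def
  proof (intro allI impI conjI)
    fix \<alpha> :: "'n list" assume \<alpha>: "length \<alpha> \<le> m"
    show "w \<alpha> \<in> borel_measurable borel"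
    proof (rule borel_measurable_LIMSEQ_real)
      note [measurable] = measurable_snd_borel
      have [measurable]: "approximant (r n) \<alpha> \<in> borel_measurable borel" for n
        using approximant_dominated \<alpha> by (simp add: dominated_def)
      show "(\<lambda>p. if 0 < snd p then approximant (r n) \<alpha> p else 0) \<in> borel_measurable borel" for n
        by measurable
      show "(\<lambda>n. if 0 < snd p then approximant (r n) \<alpha> p else 0) \<longlonglongrightarrow> w \<alpha> p" for p
        using A[OF \<alpha>, of "snd p" "fst p"] by (cases p) (auto simp: w_def)
    qed
    fix x :: "real^'n" and t :: real assume t: "0 < t"
    have "\<bar>approximant (r n) \<alpha> (x, t)\<bar> \<le> \<Theta> \<alpha> x t" for n
      using approximant_dominated \<alpha> t by (simp add: dominated_def)
    then show "\<bar>w \<alpha> (x, t)\<bar> \<le> \<Theta> \<alpha> x t"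
      by (intro LIMSEQ_le_const2[OF tendsto_rabs[OF A[OF \<alpha> t]]]) auto
  qed
  have lim_source: "(\<lambda>n. f (r n) p) \<longlonglongrightarrow> source w p" for p
  proof (cases p)
    case (Pair y s)
    show ?thesis
    proof (cases "0 < s")
      case True
      let ?z = "\<lambda>v \<alpha>. if length \<alpha> \<le> m then v \<alpha> (y, s) else 0"
      have z: "(\<lambda>n. ?z (approximant (r n))) \<longlonglongrightarrow> ?z w"
        unfolding tendsto_fun_iff using A True by auto
      have "(\<lambda>n. (\<lambda>(x, t, z). F x t z) (y, s, ?z (approximant (r n)))) \<longlonglongrightarrow> (\<lambda>(x, t, z). F x t z) (y, s, ?z w)"
        by (rule continuous_on_tendsto_compose[OF F_cont])
          (use True jet_in_jet_space in \<open>auto intro!: tendsto_Pair tendsto_const z\<close>)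
      then show ?thesis using True by (simp add: f_def source_def Pair)
    qed (simp add: f_def source_def Pair)
  qed
  have "w \<alpha> (x, t) = evolution (K \<alpha>) \<phi> x t + a0 * duhamel (K \<alpha>) (source w) x t" if \<alpha>: "length \<alpha> \<le> m" and t: "0 < t" for \<alpha> x t
  proof -
    have "(\<lambda>n. a0 * duhamel (K \<alpha>) (f (r n)) x t) \<longlonglongrightarrow> a0 * duhamel (K \<alpha>) (source w) x t"
      by (intro tendsto_intros duhamel_tendsto[OF \<alpha> t f source_weighted[OF dom] lim_source])
    then show ?thesis using t by (simp add: w_def limI)
  qed
  with dom show ?thesis by (rule that)
qed

end

section \<open>Admissible kernels and Morrey norms\<close>

text \<open>Connects the smoothness of the kernel, assumed jointly in (x, y, t), with its estimates,
  which concern x-derivatives at fixed (y, t).\<close>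

lemma pderivs_slice:
  fixes f :: "(real^'n::finite) \<times> 'b::real_normed_vector \<Rightarrow> real"
  shows "pderivs (map (\<lambda>i. (axis i 1, 0)) \<alpha>) f (x, y) = pderivs (dirs \<alpha>) (\<lambda>x. f (x, y)) x"
  by (induction \<alpha> arbitrary: x) auto

lemma grad_norm_ge:
  fixes f :: "real^'n::finite \<Rightarrow> real"
  shows "\<bar>pderivs (dirs \<alpha>) f x\<bar> \<le> grad_norm (length \<alpha>) f x"
proof -
  have "finite {\<beta> :: 'n list. length \<beta> = length \<alpha>}"
    using finite_lists_length_eq[of "UNIV :: 'n set" "length \<alpha>"] by simp
  from member_le_L2_set[OF this, of \<alpha> "\<lambda>\<alpha>. \<bar>pderivs (dirs \<alpha>) f x\<bar>"]
  show ?thesis by (simp add: grad_norm_def block_norm_def L2_set_def)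
qed

definition kernel_jet :: "(real^'n::finite \<Rightarrow> real^'n \<Rightarrow> real \<Rightarrow> real) \<Rightarrow> 'n list \<Rightarrow> real^'n \<Rightarrow> real^'n \<Rightarrow> real \<Rightarrow> real" where
  "kernel_jet G \<alpha> x y t = (if 0 < t then pderivs (dirs \<alpha>) (\<lambda>x. G x y t) x else 0)"

lemma admissible_kernel_jets:
  fixes G :: "real^'n::finite \<Rightarrow> real^'n \<Rightarrow> real \<Rightarrow> real"
  assumes "admissible_kernel m d L \<infinity> G"
  shows "\<exists>C>0. kernel_jets m d L C (kernel_jet G)"
proof -
  let ?S = "{(x :: real^'n, y :: real^'n, t :: real). 0 < t}"
  let ?f = "\<lambda>(x, y, t). G x y t"
  have m: "real m < d" "0 < L" and Ck: "Ck_on m ?f ?S"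
    using assms by (auto simp: admissible_kernel_def)
  obtain C where C: "C > 0" and bd: "\<And>x y t j. j \<le> m \<Longrightarrow> 0 < t \<Longrightarrow> grad_norm j (\<lambda>x. G x y t) x \<le>
          C * t powr (- (real CARD('n) + real j) / d) *
          (1 + t powr (- 1 / d) * norm (x - y)) powr (- real CARD('n) - L - real j)"
    using assms by (auto simp: admissible_kernel_def)
  have d: "0 < d" using m by simp
  let ?v = "\<lambda>\<alpha>. map (\<lambda>i::'n. (axis i 1 :: real^'n, 0 :: (real^'n) \<times> real)) \<alpha>"
  have ex: "pderivs_exist (?v \<alpha>) ?f ?S" and co: "continuous_on ?S (pderivs (?v \<alpha>) ?f)" if "length \<alpha> \<le> m" for \<alpha>
  proof -
    have "set (?v \<alpha>) \<subseteq> Basis" by (auto simp: Basis_prod_def axis_in_Basis_iff)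
    then show "pderivs_exist (?v \<alpha>) ?f ?S" "continuous_on ?S (pderivs (?v \<alpha>) ?f)"
      using Ck that unfolding Ck_on_def by (metis length_map)+
  qed
  have sl: "pderivs (?v \<alpha>) ?f (x, y, t) = pderivs (dirs \<alpha>) (\<lambda>x. G x y t) x" for \<alpha> x y t
    using pderivs_slice[of \<alpha> ?f x "(y, t)"] by simp
  have op: "open ?S"
    by (simp add: open_Collect_less case_prod_beta' continuous_on_snd continuous_on_id)
  have cK: "continuous_on ?S (\<lambda>(x, y, t). kernel_jet G \<alpha> x y t)" if "length \<alpha> \<le> m" for \<alpha>
    using co[OF that] by (rule continuous_on_eq) (auto simp: sl kernel_jet_def)
  have "kernel_jets m d L C (kernel_jet G)"
  proof unfold_locales
    fix \<alpha> :: "'n list" assume \<alpha>: "length \<alpha> \<le> m"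
    show "continuous_on ?S (\<lambda>(x, y, t). kernel_jet G \<alpha> x y t)" by (rule cK[OF \<alpha>])
    from borel_measurable_continuous_on_indicator[OF borel_open[OF op] this]
    have "(\<lambda>q. indicator ?S q *\<^sub>R (case q of (x, y, t) \<Rightarrow> kernel_jet G \<alpha> x y t)) \<in> borel_measurable borel" .
    also have "(\<lambda>q. indicator ?S q *\<^sub>R (case q of (x, y, t) \<Rightarrow> kernel_jet G \<alpha> x y t)) = (\<lambda>(x, y, t). kernel_jet G \<alpha> x y t)"
      by (auto simp: fun_eq_iff kernel_jet_def indicator_def)
    finally show "(\<lambda>(x, y, t). kernel_jet G \<alpha> x y t) \<in> borel_measurable borel" .
    fix t :: real and x y :: "real^'n" assume t: "0 < t"
    let ?j = "real (length \<alpha>)"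
    have "\<bar>kernel_jet G \<alpha> x y t\<bar> \<le> C * t powr (- (real CARD('n) + ?j) / d) *
          (1 + t powr (- 1 / d) * norm (x - y)) powr (- real CARD('n) - L - ?j)"
      using grad_norm_ge[of \<alpha> "\<lambda>x. G x y t" x] bd[OF \<alpha> t, of y x] t by (simp add: kernel_jet_def)
    \<comment> \<open>All orders are brought under one envelope, so that the order is visible only
      in the power of t.\<close>
    also have "\<dots> \<le> C * t powr (- (real CARD('n) + ?j) / d) *
          (1 + t powr (- 1 / d) * norm (x - y)) powr (- real CARD('n) - L)"
      using C by (intro mult_left_mono powr_mono) auto
    also have "t powr (- (real CARD('n) + ?j) / d) = t powr (- (?j / d)) * t powr (- real CARD('n) / d)"
      unfolding powr_add[symmetric] by (rule arg_cong[where f = "\<lambda>e. t powr e"]) (use d in \<open>simp add: field_simps\<close>)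
    finally show "\<bar>kernel_jet G \<alpha> x y t\<bar> \<le> C * t powr (- (?j / d)) * decay_kernel d L t (x - y)"
      by (simp add: decay_kernel_def mult.assoc)
  next
    fix i :: 'n and \<alpha> :: "'n list" and t :: real and x y :: "real^'n"
    assume i: "length (i # \<alpha>) \<le> m" and t: "0 < t"
    have "(\<lambda>h. pderivs (?v \<alpha>) ?f ((x, y, t) + h *\<^sub>R (axis i 1, 0))) field_differentiable (at 0)"
      using ex[OF i] t by auto
    then have "(\<lambda>h. kernel_jet G \<alpha> (x + h *\<^sub>R axis i 1) y t) field_differentiable (at 0)"
      using t by (simp add: sl kernel_jet_def)
    then have "((\<lambda>h. kernel_jet G \<alpha> (x + h *\<^sub>R axis i 1) y t) has_real_derivative
        deriv (\<lambda>h. kernel_jet G \<alpha> (x + h *\<^sub>R axis i 1) y t) 0) (at 0)"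
      by (simp add: DERIV_deriv_iff_field_differentiable)
    then show "((\<lambda>h. kernel_jet G \<alpha> (x + h *\<^sub>R axis i 1) y t) has_real_derivative kernel_jet G (i # \<alpha>) x y t) (at 0)"
      using t by (simp add: kernel_jet_def)
  qed (use m C in \<open>auto simp: kernel_jet_def\<close>)
  then show ?thesis using C by blast
qed

text \<open>Takes the place of Holder's and Jensen's inequalities: being linear in the powers of a,
  it can be integrated against any measure with values in \<open>ennreal\<close>, and a later choice
  of the level l restores the correct scaling.\<close>

lemma le_powr_split:
  fixes a l :: real
  assumes "0 \<le> a" "0 < l" "0 \<le> s" "s \<le> r"
  shows "a powr s \<le> l powr s + l powr (s - r) * a powr r"
proof (cases "a \<le> l")
  case True
  then have "a powr s \<le> l powr s" using assms by (intro powr_mono2) auto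
  then show ?thesis by (simp add: add_increasing2)
next
  case False
  have "a powr s = a powr (s - r) * a powr r" using False assms by (simp add: powr_add[symmetric])
  also have "\<dots> \<le> l powr (s - r) * a powr r"
    using False assms by (intro mult_right_mono powr_mono2') auto
  finally show ?thesis by (simp add: add_increasing)
qed

text \<open>Jensen's inequality up to a constant, for a kernel of mass at most S. Splitting at the
  level l, the choice l = H^(1/\<beta>) makes l^(1-\<beta>) H equal to l, hence the constant S + 1.
  If H = 0 this level degenerates, and arbitrarily small l are used instead.\<close>

lemma potential_power_mean:
  fixes \<phi> :: "'a::euclidean_space \<Rightarrow> real"
  assumes [measurable]: "\<phi> \<in> borel_measurable borel" and \<beta>: "1 \<le> \<beta>" and S: "0 < S"
    and mass: "(\<integral>\<^sup>+z. ennreal (decay_kernel d L t (x - z)) \<partial>lborel) \<le> ennreal S"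
    and fin: "potential d L (\<lambda>z. \<bar>\<phi> z\<bar> powr \<beta>) t x < top"
  shows "potential d L (\<lambda>z. \<bar>\<phi> z\<bar>) t x \<le> ennreal ((S + 1) * enn2real (potential d L (\<lambda>z. \<bar>\<phi> z\<bar> powr \<beta>) t x) powr (1 / \<beta>))"
proof -
  define Hr where "Hr = enn2real (potential d L (\<lambda>z. \<bar>\<phi> z\<bar> powr \<beta>) t x)"
  have Hr: "potential d L (\<lambda>z. \<bar>\<phi> z\<bar> powr \<beta>) t x = ennreal Hr" using fin by (simp add: Hr_def)
  have Hr0: "0 \<le> Hr" by (simp add: Hr_def)
  have main: "potential d L (\<lambda>z. \<bar>\<phi> z\<bar>) t x \<le> ennreal (l * S + l powr (1 - \<beta>) * Hr)" if l: "0 < l" for l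
  proof -
    have "potential d L (\<lambda>z. \<bar>\<phi> z\<bar>) t x \<le> (\<integral>\<^sup>+z. ennreal l * ennreal (decay_kernel d L t (x - z))
        + ennreal (l powr (1 - \<beta>)) * (ennreal (decay_kernel d L t (x - z)) * ennreal (\<bar>\<phi> z\<bar> powr \<beta>)) \<partial>lborel)"
      unfolding potential_def
    proof (intro nn_integral_mono)
      fix z
      have "\<bar>\<phi> z\<bar> \<le> l + l powr (1 - \<beta>) * \<bar>\<phi> z\<bar> powr \<beta>"
        using le_powr_split[of "\<bar>\<phi> z\<bar>" l 1 \<beta>] l \<beta> by simp
      then have "decay_kernel d L t (x - z) * \<bar>\<phi> z\<bar> \<le> decay_kernel d L t (x - z) * (l + l powr (1 - \<beta>) * \<bar>\<phi> z\<bar> powr \<beta>)"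
        by (intro mult_left_mono) auto
      then have "decay_kernel d L t (x - z) * \<bar>\<phi> z\<bar> \<le> l * decay_kernel d L t (x - z) + l powr (1 - \<beta>) * (decay_kernel d L t (x - z) * \<bar>\<phi> z\<bar> powr \<beta>)"
        by (simp add: algebra_simps)
      then show "ennreal (decay_kernel d L t (x - z)) * ennreal \<bar>\<phi> z\<bar> \<le> ennreal l * ennreal (decay_kernel d L t (x - z))
        + ennreal (l powr (1 - \<beta>)) * (ennreal (decay_kernel d L t (x - z)) * ennreal (\<bar>\<phi> z\<bar> powr \<beta>))"
        using l by (simp add: ennreal_mult[symmetric] ennreal_plus[symmetric] ennreal_leI del: ennreal_plus)
    qed
    also have "\<dots> = ennreal l * (\<integral>\<^sup>+z. ennreal (decay_kernel d L t (x - z)) \<partial>lborel) + ennreal (l powr (1 - \<beta>)) * potential d L (\<lambda>z. \<bar>\<phi> z\<bar> powr \<beta>) t x"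
      unfolding potential_def by (simp add: nn_integral_add nn_integral_cmult)
    also have "\<dots> \<le> ennreal l * ennreal S + ennreal (l powr (1 - \<beta>)) * ennreal Hr"
      unfolding Hr by (intro add_mono mult_left_mono mass) auto
    also have "\<dots> = ennreal (l * S + l powr (1 - \<beta>) * Hr)"
      using l S Hr0 by (simp add: ennreal_mult[symmetric] ennreal_plus[symmetric] del: ennreal_plus)
    finally show ?thesis .
  qed
  show ?thesis
  proof (cases "Hr = 0")
    case True
    have "potential d L (\<lambda>z. \<bar>\<phi> z\<bar>) t x \<le> 0"
    proof (rule ennreal_le_epsilon)
      fix e :: real assume "0 < e"
      then show "potential d L (\<lambda>z. \<bar>\<phi> z\<bar>) t x \<le> 0 + ennreal e" using main[of "e / S"] S True by simp
    qed
    then show ?thesis by simp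
  next
    case False
    define l where "l = Hr powr (1 / \<beta>)"
    have l: "0 < l" using False by (simp add: l_def)
    have "Hr = l powr \<beta>" using \<beta> Hr0 by (simp add: l_def powr_powr)
    then have "l powr (1 - \<beta>) * Hr = l" using l by (simp add: powr_add[symmetric])
    then show ?thesis using main[OF l] by (simp add: l_def[symmetric] Hr_def[symmetric] algebra_simps)
  qed
qed

lemma locally_integrable_measurable:
  assumes "locally_integrable (f :: 'v::euclidean_space \<Rightarrow> real)"
  shows "f \<in> borel_measurable lebesgue"
proof (rule borel_measurable_LIMSEQ_real)
  have "set_integrable lebesgue (cball 0 (real n)) f" for n
    using assms by (simp add: locally_integrable_def)
  then show "(\<lambda>x. indicator (cball 0 (real n)) x *\<^sub>R f x) \<in> borel_measurable lebesgue" for n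
    unfolding set_integrable_def by (rule borel_measurable_integrable)
  show "(\<lambda>n. indicator (cball 0 (real n)) x *\<^sub>R f x) \<longlonglongrightarrow> f x" for x
  proof -
    obtain N :: nat where N: "norm x \<le> real N" using real_arch_simple by blast
    have "eventually (\<lambda>n. indicator (cball 0 (real n)) x *\<^sub>R f x = f x) sequentially"
      using eventually_ge_at_top[of N] by eventually_elim (use N in \<open>auto simp: indicator_def\<close>)
    then show ?thesis by (rule tendsto_eventually)
  qed
qed

lemma morrey_norm_ball:
  fixes \<phi> :: "real^'n::finite \<Rightarrow> real"
  assumes norm: "morrey_norm r q \<phi> \<le> ennreal \<gamma>" and \<gamma>: "0 < \<gamma>" and q: "0 < q" and \<sigma>: "0 < \<sigma>"
  defines "N \<equiv> real CARD('n)"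
  shows "(\<integral>\<^sup>+y\<in>ball x \<sigma>. ennreal (\<bar>\<phi> y\<bar> powr q) \<partial>lebesgue)
    \<le> ennreal (unit_ball_vol N * \<sigma> powr N * (\<gamma> * \<sigma> powr (- N / r)) powr q)"
proof -
  define I where "I = (\<integral>\<^sup>+y\<in>ball x \<sigma>. ennreal (\<bar>\<phi> y\<bar> powr q) \<partial>lebesgue)"
  define V where "V = unit_ball_vol N * \<sigma> powr N"
  have V: "0 < V" using \<sigma> by (simp add: V_def N_def)
  have eV: "emeasure lebesgue (ball x \<sigma>) = ennreal V"
    using \<sigma> by (simp add: V_def N_def emeasure_lborel_ball)
  have le: "ennreal (\<sigma> powr (N / r)) * ennreal_powr (I / ennreal V) (1 / q) \<le> ennreal \<gamma>"
  proof -
    have "ennreal (\<sigma> powr (N / r)) * ennreal_powr (I / ennreal V) (1 / q) \<le> morrey_norm r q \<phi>"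
      unfolding morrey_norm_def I_def eV[symmetric] N_def
      by (rule order_trans[OF _ SUP_upper[of x]], rule order_trans[OF _ SUP_upper[of \<sigma>]]) (use \<sigma> in auto)
    then show ?thesis using norm by simp
  qed
  have "I \<noteq> top"
  proof
    assume "I = top"
    then have "I / ennreal V = top" by (simp add: ennreal_top_divide)
    then have "ennreal (\<sigma> powr (N / r)) * ennreal_powr (I / ennreal V) (1 / q) = top"
      using \<sigma> by (simp add: ennreal_powr_def ennreal_mult_eq_top_iff)
    then show False using le by (simp add: top_unique)
  qed
  then obtain i where i: "I = ennreal i" "0 \<le> i" by (cases I) auto
  have "I / ennreal V = ennreal (i / V)" using i V by (simp add: divide_ennreal)
  then have "ennreal (\<sigma> powr (N / r) * (i / V) powr (1 / q)) \<le> ennreal \<gamma>"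
    using le i V by (simp add: ennreal_powr_def ennreal_mult)
  then have "\<sigma> powr (N / r) * (i / V) powr (1 / q) \<le> \<gamma>" using \<gamma> by (simp add: ennreal_le_iff)
  then have "(i / V) powr (1 / q) \<le> \<gamma> * \<sigma> powr (- N / r)"
    using \<sigma> by (simp add: powr_minus_divide field_simps)
  then have "((i / V) powr (1 / q)) powr q \<le> (\<gamma> * \<sigma> powr (- N / r)) powr q"
    using q by (intro powr_mono2) auto
  then have "i / V \<le> (\<gamma> * \<sigma> powr (- N / r)) powr q"
    using q i V by (simp add: powr_powr)
  then have "i \<le> V * (\<gamma> * \<sigma> powr (- N / r)) powr q" using V by (simp add: field_simps)
  then show ?thesis unfolding I_def[symmetric] i V_def by (rule ennreal_leI)
qed

text \<open>Lowers the exponent from q to \<beta> by splitting at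
  \<open>l = \<gamma> * \<sigma> powr (- N / r)\<close>, the size that the Morrey norm predicts on a
  ball of radius \<sigma>. Both parts are then bounded by the volume times
  \<open>l powr \<beta>\<close>, which explains the factor 2.\<close>

lemma morrey_ball_growth:
  fixes \<phi> \<phi>' :: "real^'n::finite \<Rightarrow> real"
  assumes norm: "morrey_norm r q \<phi> \<le> ennreal \<gamma>" and \<gamma>: "0 < \<gamma>" and \<beta>: "0 < \<beta>" "\<beta> \<le> q" and \<sigma>: "0 < \<sigma>"
    and [measurable]: "\<phi>' \<in> borel_measurable borel" and ae: "AE y in lborel. \<phi> y = \<phi>' y"
  defines "N \<equiv> real CARD('n)"
  shows "(\<integral>\<^sup>+z. ennreal (\<bar>\<phi>' z\<bar> powr \<beta>) * indicator (ball x \<sigma>) z \<partial>lborel)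
    \<le> ennreal (2 * unit_ball_vol N * \<gamma> powr \<beta> * \<sigma> powr (N - N * \<beta> / r))"
proof -
  define l where "l = \<gamma> * \<sigma> powr (- N / r)"
  define V where "V = unit_ball_vol N * \<sigma> powr N"
  have l: "0 < l" using \<gamma> \<sigma> by (simp add: l_def)
  have V: "0 < V" using \<sigma> by (simp add: V_def N_def)
  have [measurable]: "ball x \<sigma> \<in> sets borel" by simp
  have m: "(\<lambda>z. ennreal (\<bar>\<phi>' z\<bar> powr q) * indicator (ball x \<sigma>) z) \<in> borel_measurable borel"
    by (intro borel_measurable_times_ennreal borel_measurable_indicator) measurable
  have q: "(\<integral>\<^sup>+z. ennreal (\<bar>\<phi>' z\<bar> powr q) * indicator (ball x \<sigma>) z \<partial>lborel) \<le> ennreal (V * l powr q)"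
  proof -
    have "(\<integral>\<^sup>+z. ennreal (\<bar>\<phi>' z\<bar> powr q) * indicator (ball x \<sigma>) z \<partial>lborel)
       = (\<integral>\<^sup>+z. ennreal (\<bar>\<phi> z\<bar> powr q) * indicator (ball x \<sigma>) z \<partial>lborel)"
      using ae by (intro nn_integral_cong_AE) auto
    also have "\<dots> = (\<integral>\<^sup>+z\<in>ball x \<sigma>. ennreal (\<bar>\<phi> z\<bar> powr q) \<partial>lebesgue)"
      by (simp add: nn_integral_completion)
    also have "\<dots> \<le> ennreal (V * l powr q)"
      unfolding V_def l_def N_def using \<beta> by (intro morrey_norm_ball[OF norm \<gamma> _ \<sigma>]) auto
    finally show ?thesis .
  qed
  have "(\<integral>\<^sup>+z. ennreal (\<bar>\<phi>' z\<bar> powr \<beta>) * indicator (ball x \<sigma>) z \<partial>lborel)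
     \<le> (\<integral>\<^sup>+z. ennreal (l powr \<beta>) * indicator (ball x \<sigma>) z + ennreal (l powr (\<beta> - q)) * (ennreal (\<bar>\<phi>' z\<bar> powr q) * indicator (ball x \<sigma>) z) \<partial>lborel)"
  proof (intro nn_integral_mono)
    fix z
    have "\<bar>\<phi>' z\<bar> powr \<beta> \<le> l powr \<beta> + l powr (\<beta> - q) * \<bar>\<phi>' z\<bar> powr q"
      using \<beta> l by (intro le_powr_split) auto
    then show "ennreal (\<bar>\<phi>' z\<bar> powr \<beta>) * indicator (ball x \<sigma>) z \<le>
      ennreal (l powr \<beta>) * indicator (ball x \<sigma>) z + ennreal (l powr (\<beta> - q)) * (ennreal (\<bar>\<phi>' z\<bar> powr q) * indicator (ball x \<sigma>) z)"
      by (auto simp: indicator_def ennreal_mult[symmetric] ennreal_plus[symmetric] ennreal_leI simp del: ennreal_plus)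
  qed
  also have "\<dots> = ennreal (l powr \<beta>) * emeasure lborel (ball x \<sigma>) + ennreal (l powr (\<beta> - q)) * (\<integral>\<^sup>+z. ennreal (\<bar>\<phi>' z\<bar> powr q) * indicator (ball x \<sigma>) z \<partial>lborel)"
    using m by (subst nn_integral_add) (auto simp: nn_integral_cmult nn_integral_cmult_indicator)
  also have "\<dots> \<le> ennreal (l powr \<beta>) * ennreal V + ennreal (l powr (\<beta> - q)) * ennreal (V * l powr q)"
    using \<sigma> by (intro add_mono mult_left_mono q) (auto simp: emeasure_lborel_ball V_def N_def)
  also have "\<dots> = ennreal (l powr \<beta> * V + l powr (\<beta> - q) * (V * l powr q))"
    using V by (simp add: ennreal_mult[symmetric] ennreal_plus[symmetric] del: ennreal_plus)
  also have "l powr \<beta> * V + l powr (\<beta> - q) * (V * l powr q) = 2 * V * l powr \<beta>"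
    using l by (simp add: powr_diff)
  also have "\<dots> = 2 * unit_ball_vol N * \<gamma> powr \<beta> * \<sigma> powr (N - N * \<beta> / r)"
  proof -
    have "l powr \<beta> = \<gamma> powr \<beta> * \<sigma> powr (- N / r * \<beta>)"
      using \<gamma> \<sigma> by (simp add: l_def powr_mult powr_powr)
    moreover have "\<sigma> powr (N - N * \<beta> / r) = \<sigma> powr N * \<sigma> powr (- N / r * \<beta>)"
      by (simp add: powr_add[symmetric])
    ultimately show ?thesis by (simp add: V_def)
  qed
  finally show ?thesis .
qed

section \<open>From jets to solutions of the integral equation\<close>

context tonelli_scheme
begin

text \<open>Besides turning the family into one function, this passes from a Borel representative to
  the given datum, from Borel to Lebesgue measure, and from the space-time integral to the iterated
  one.\<close>

lemma solution_exists:
  fixes G :: "real^'n \<Rightarrow> real^'n \<Rightarrow> real \<Rightarrow> real" and \<phi>0 :: "real^'n \<Rightarrow> real"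
  assumes KG: "\<And>x y t. 0 < t \<Longrightarrow> K [] x y t = G x y t"
    and \<phi>0 [measurable]: "\<phi>0 \<in> borel_measurable lebesgue" and ae: "AE y in lborel. \<phi>0 y = \<phi> y"
    and \<Theta>_bounded: "\<And>\<alpha> \<tau>. length \<alpha> \<le> m \<Longrightarrow> 0 < \<tau> \<Longrightarrow> \<exists>c. \<forall>x t. \<tau> < t \<longrightarrow> \<Theta> \<alpha> x t \<le> c"
  shows "\<exists>u. is_solution m a0 G F \<phi>0 \<infinity> u \<and>
    (\<forall>\<alpha> x t. length \<alpha> \<le> m \<longrightarrow> 0 < t \<longrightarrow> \<bar>pderivs (dirs \<alpha>) (\<lambda>x. u x t) x\<bar> \<le> \<Theta> \<alpha> x t)"
proof -
  obtain w where w: "dominated w" and eq: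
    "\<And>\<alpha> x t. length \<alpha> \<le> m \<Longrightarrow> 0 < t \<Longrightarrow> w \<alpha> (x, t) = evolution (K \<alpha>) \<phi> x t + a0 * duhamel (K \<alpha>) (source w) x t"
    using jet_solution_exists by blast
  note f = source_weighted[OF w]
  have [measurable]: "source w \<in> borel_measurable borel" using f by (simp add: weighted_def)
  define u where "u x t = w [] (x, t)" for x t
  \<comment> \<open>Both components are given by integral equations with the same source, so the
    relation between their kernels is inherited. This is the first point at which components of
    different words are related.\<close>
  have der: "((\<lambda>h. w \<alpha> (x + h *\<^sub>R axis i 1, t)) has_real_derivative w (i # \<alpha>) (x, t)) (at 0)"
    if i: "length (i # \<alpha>) \<le> m" and t: "0 < t" for i \<alpha> x t
  proof -
    have "((\<lambda>h. evolution (K \<alpha>) \<phi> (x + h *\<^sub>R axis i 1) t + a0 * duhamel (K \<alpha>) (source w) (x + h *\<^sub>R axis i 1) t)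
      has_real_derivative evolution (K (i # \<alpha>)) \<phi> x t + a0 * duhamel (K (i # \<alpha>)) (source w) x t) (at 0)"
      by (intro DERIV_add DERIV_cmult evolution_has_derivative[OF i locally_bounded_potential_axioms t] duhamel_has_derivative[OF i f t])
    then show ?thesis using i t by (simp add: eq)
  qed
  have pd: "pderivs (dirs \<alpha>) (\<lambda>x. u x t) = (\<lambda>x. w \<alpha> (x, t)) \<and> pderivs_exist (dirs \<alpha>) (\<lambda>x. u x t) UNIV"
    if "length \<alpha> \<le> m" "0 < t" for \<alpha> t
    using that
  proof (induction \<alpha>)
    case Nil
    then show ?case by (simp add: u_def)
  next
    case (Cons i \<alpha>)
    have d: "((\<lambda>h. w \<alpha> (x + h *\<^sub>R axis i 1, t)) has_real_derivative w (i # \<alpha>) (x, t)) (at 0)" for x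
      by (rule der) (use Cons.prems in auto)
    have "(\<lambda>h. w \<alpha> (x + h *\<^sub>R axis i 1, t)) field_differentiable (at 0)" for x
      using d[of x] unfolding field_differentiable_def by blast
    then show ?case using Cons DERIV_imp_deriv[OF d] by auto
  qed
  \<comment> \<open>Only through this identity does \<open>source w\<close> become F along the jet
    of u, and the system for the family an equation for a single function.\<close>
  have jet: "jet m (\<lambda>y'. u y' s) y = (\<lambda>\<alpha>. if length \<alpha> \<le> m then w \<alpha> (y, s) else 0)" if "0 < s" for s y
    using pd[OF _ that] by (auto simp: jet_def fun_eq_iff)
  have w_cont: "continuous_on (UNIV \<times> {0<..}) (w \<alpha>)" if \<alpha>: "length \<alpha> \<le> m" for \<alpha>
  proof -
    interpret S: singular_kernel_with_density d L "real (length \<alpha>) / d" C "K \<alpha>" Cv b \<kappa> \<delta> \<psi>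
      by (rule singular_density[OF \<alpha>])
    interpret S': singular_kernel_with_datum d L "real (length \<alpha>) / d" C "K \<alpha>" \<phi> P by (rule datum[OF \<alpha>])
    have "continuous_on (UNIV \<times> {0<..}) (\<lambda>p. (case p of (x, t) \<Rightarrow> evolution (K \<alpha>) \<phi> x t) + a0 * (case p of (x, t) \<Rightarrow> duhamel (K \<alpha>) (source w) x t))"
      by (intro continuous_intros S.duhamel_continuous[OF f] S'.evolution_continuous)
    then show ?thesis by (rule continuous_on_eq) (auto simp: eq[OF \<alpha>])
  qed
  have integral_eq: "satisfies_integral_eq m a0 G F \<phi>0 u x t" if t: "0 < t" for x t
  proof -
    interpret S: singular_kernel_with_density d L "real (length ([] :: 'n list)) / d" C "K []" Cv b \<kappa> \<delta> \<psi>
      by (rule singular_density) simp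
    interpret S': singular_kernel_with_datum d L "real (length ([] :: 'n list)) / d" C "K []" \<phi> P by (rule datum) simp
    define H where "H s y = G x y (t - s) * F y s (jet m (\<lambda>y'. u y' s) y)" for s y
    have H: "H s y = K [] x y (t - s) * source w (y, s)" if "0 < s" "s < t" for s y
      using that by (simp add: H_def KG jet source_def)
    have G_eq: "G x y t = K [] x y t" for y using t by (simp add: KG)
    have Km: "(\<lambda>y. K [] x y t') \<in> borel_measurable lebesgue" for t'
      by (rule measurable_completion) measurable
    have lin_m: "(\<lambda>y. K [] x y t * \<phi>0 y) \<in> borel_measurable lebesgue"
      by (intro borel_measurable_times Km \<phi>0)
    have lin_ae: "AE y in lebesgue. K [] x y t * \<phi> y = K [] x y t * \<phi>0 y"
      using AE_completion[OF ae] by eventually_elim simp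
    have \<phi>m: "(\<lambda>y. K [] x y t * \<phi> y) \<in> borel_measurable lborel" by measurable
    have lin_int: "integrable lebesgue (\<lambda>y. K [] x y t * \<phi> y)"
      using S'.evolution_integrable[OF t, of x] \<phi>m by (simp add: integrable_completion)
    have 1: "integrable lebesgue (\<lambda>y. G x y t * \<phi>0 y)"
      unfolding G_eq by (rule integrable_cong_AE_imp[OF lin_int lin_m lin_ae])
    have lin_eq: "(\<integral>y. G x y t * \<phi>0 y \<partial>lebesgue) = evolution (K []) \<phi> x t"
    proof -
      have "(\<integral>y. G x y t * \<phi>0 y \<partial>lebesgue) = (\<integral>y. K [] x y t * \<phi> y \<partial>lebesgue)"
        unfolding G_eq
        by (rule integral_cong_AE[OF lin_m measurable_completion[OF \<phi>m]]) (use lin_ae in eventually_elim, rule sym)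
      also have "\<dots> = evolution (K []) \<phi> x t"
        unfolding evolution_def by (rule integral_completion[OF \<phi>m])
      finally show ?thesis .
    qed
    have Hm: "(\<lambda>y. K [] x y (t - s) * source w (y, s)) \<in> borel_measurable lborel" for s
      by measurable
    \<comment> \<open>Integrability is required for every s, whereas Fubini would give it for almost
      every s only. At a fixed s the source is bounded in space by a constant c, and the kernel has
      finite mass.\<close>
    have 2: "integrable lebesgue (H s)" if s: "0 < s" "s < t" for s
    proof -
      obtain S0 where S0: "S0 > 0" "\<And>t (x::real^'n). t > 0 \<Longrightarrow> (\<integral>\<^sup>+z. ennreal (decay_kernel d L t (x - z)) \<partial>lborel) \<le> ennreal S0"
        using decay_kernel_mass[OF dp Lp, where 'a = "real^'n"] by metis
      define c where "c = M * (s powr (\<delta> - 1) * (2 powr (real DIM(real^'n) + L) / (1 - 2 powr (- (L + b))) * \<kappa> * s powr (- b / d)))"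
      have fb: "ennreal \<bar>source w (y, s)\<bar> \<le> ennreal c" for y
      proof -
        have "ennreal \<bar>source w (y, s)\<bar> \<le> ennreal M * B (y, s)" using f by (auto simp: weighted_def)
        also have "\<dots> \<le> ennreal M * (ennreal (s powr (\<delta> - 1)) * ennreal (2 powr (real DIM(real^'n) + L) / (1 - 2 powr (- (L + b))) * \<kappa> * s powr (- b / d)))"
          unfolding parabolic_weight_def using s potential_le[OF s(1), of y] by (auto intro!: mult_left_mono)
        also have "\<dots> = ennreal c" unfolding c_def using M_nonneg by (simp add: ennreal_mult'[symmetric])
        finally show ?thesis .
      qed
      have "(\<integral>\<^sup>+y. ennreal (norm (K [] x y (t - s) * source w (y, s))) \<partial>lborel)
          \<le> (\<integral>\<^sup>+y. (ennreal C * ennreal c) * ennreal (decay_kernel d L (t - s) (x - y)) \<partial>lborel)"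
      proof (intro nn_integral_mono)
        fix y
        have "ennreal (norm (K [] x y (t - s) * source w (y, s))) = ennreal \<bar>K [] x y (t - s)\<bar> * ennreal \<bar>source w (y, s)\<bar>"
          by (simp add: abs_mult ennreal_mult)
        also have "\<dots> \<le> ennreal (C * decay_kernel d L (t - s) (x - y)) * ennreal c"
          using s S.k_bound[of "t - s" x y] by (intro mult_mono fb ennreal_leI) auto
        finally show "ennreal (norm (K [] x y (t - s) * source w (y, s))) \<le> (ennreal C * ennreal c) * ennreal (decay_kernel d L (t - s) (x - y))"
          using Cnonneg by (simp add: ennreal_mult mult_ac)
      qed
      also have "\<dots> = (ennreal C * ennreal c) * (\<integral>\<^sup>+y. ennreal (decay_kernel d L (t - s) (x - y)) \<partial>lborel)"
        by (rule nn_integral_cmult) measurable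
      also have "\<dots> \<le> (ennreal C * ennreal c) * ennreal S0" using s by (intro mult_left_mono S0) auto
      also have "\<dots> < \<infinity>" by (simp add: ennreal_mult_less_top)
      finally have "integrable lborel (\<lambda>y. K [] x y (t - s) * source w (y, s))"
        using Hm by (intro integrableI_bounded)
      then show ?thesis using Hm[of s] s by (simp add: H[OF s, abs_def] integrable_completion)
    qed
    define g where "g s = (\<integral>y. K [] x y (t - s) * source w (y, s) \<partial>lborel)" for s
    have slice: "indicator {0<..<t} s *\<^sub>R (\<integral>y. H s y \<partial>lebesgue) = g s" for s
    proof (cases "0 < s \<and> s < t")
      case True
      then show ?thesis
        using integral_completion[OF Hm[of s]] by (simp add: g_def H)
    next
      case False
      then have "(\<lambda>y. K [] x y (t - s) * source w (y, s)) = (\<lambda>y. 0)"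
        using K_zero[of "t - s"] weighted_nonpos[OF f, of s] by (cases "0 < s") auto
      then have "g s = 0" by (simp add: g_def)
      then show ?thesis using False by (auto simp: indicator_def)
    qed
    have ip: "integrable (lborel \<Otimes>\<^sub>M lborel) (\<lambda>(y, s). K [] x y (t - s) * source w (y, s))"
      using S.duhamel_integrable[OF f, of x t] by (simp add: lborel_prod)
    have gi: "integrable lborel g"
      unfolding g_def using lborel_pair.integrable_snd[OF ip] by simp
    have gm: "g \<in> borel_measurable lborel" using gi by (rule borel_measurable_integrable)
    have 3: "set_integrable lebesgue {0<..<t} (\<lambda>s. \<integral>y. H s y \<partial>lebesgue)"
      unfolding set_integrable_def slice using gi gm by (simp add: integrable_completion)
    have "(LINT s:{0<..<t}|lebesgue. \<integral>y. H s y \<partial>lebesgue) = (\<integral>s. g s \<partial>lborel)"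
      unfolding set_lebesgue_integral_def slice by (rule integral_completion[OF gm])
    also have "\<dots> = duhamel (K []) (source w) x t"
      unfolding g_def duhamel_def using lborel_pair.integral_snd[OF ip] by (simp add: lborel_prod)
    finally have 4: "(LINT s:{0<..<t}|lebesgue. \<integral>y. H s y \<partial>lebesgue) = duhamel (K []) (source w) x t" .
    have "u x t = (\<integral>y. G x y t * \<phi>0 y \<partial>lebesgue) + a0 * (LINT s:{0<..<t}|lebesgue. \<integral>y. H s y \<partial>lebesgue)"
      unfolding lin_eq 4 u_def using t by (intro eq) auto
    then show ?thesis
      unfolding satisfies_integral_eq_def Let_def using 1 2 3 unfolding H_def by auto
  qed
  have w_le: "\<bar>w \<alpha> (x, t)\<bar> \<le> \<Theta> \<alpha> x t" if "length \<alpha> \<le> m" "0 < t" for \<alpha> x t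
    using w that by (simp add: dominated_def)
  have "is_solution m a0 G F \<phi>0 \<infinity> u"
    unfolding is_solution_def Let_def
  proof (intro conjI allI impI)
    fix \<tau> :: real and \<alpha> :: "'n list" assume \<tau>: "0 < \<tau>" and \<alpha>: "length \<alpha> \<le> m"
    let ?I = "{t. \<tau> < t \<and> ereal t < \<infinity>}" and ?D = "\<lambda>(x, t). pderivs (dirs \<alpha>) (\<lambda>x. u x t) x"
    show "\<forall>t\<in>?I. pderivs_exist (dirs \<alpha>) (\<lambda>x. u x t) UNIV"
      using pd[OF \<alpha>] \<tau> by auto
    have D: "?D p = w \<alpha> p" if "p \<in> UNIV \<times> ?I" for p
      using that pd[OF \<alpha>, of "snd p"] \<tau> by (cases p) auto
    obtain c where c: "\<And>x t. \<tau> < t \<Longrightarrow> \<Theta> \<alpha> x t \<le> c" using \<Theta>_bounded[OF \<alpha> \<tau>] by blast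
    have "norm (?D p) \<le> c" if p: "p \<in> UNIV \<times> ?I" for p
    proof -
      have "\<bar>w \<alpha> (fst p, snd p)\<bar> \<le> c"
        using p \<tau> by (intro order_trans[OF w_le[OF \<alpha>] c]) auto
      then show ?thesis using D[OF p] by simp
    qed
    then show "bounded (?D ` (UNIV \<times> ?I))"
      by (auto simp: bounded_iff)
    have "continuous_on (UNIV \<times> ?I) (w \<alpha>)"
      by (rule continuous_on_subset[OF w_cont[OF \<alpha>]]) (use \<tau> in auto)
    then show "continuous_on (UNIV \<times> ?I) ?D"
      by (rule continuous_on_eq) (simp add: D[symmetric])
  next
    fix x :: "real^'n" and t :: real assume "0 < t \<and> ereal t < \<infinity>"
    then show "satisfies_integral_eq m a0 G F \<phi>0 u x t" by (intro integral_eq) simp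
  qed
  moreover have "\<bar>pderivs (dirs \<alpha>) (\<lambda>x. u x t) x\<bar> \<le> \<Theta> \<alpha> x t" if "length \<alpha> \<le> m" "0 < t" for \<alpha> x t
    using w_le[OF that] pd[OF that] by simp
  ultimately show ?thesis by blast
qed

end

section \<open>Estimate of the nonlinearity and choice of the constants\<close>

lemma block_norm_le:
  fixes z :: "'n::finite list \<Rightarrow> real"
  assumes "j \<le> m" "0 \<le> c" "\<And>\<alpha>. length \<alpha> = j \<Longrightarrow> \<bar>z \<alpha>\<bar> \<le> c"
  shows "block_norm j z \<le> real (card {\<alpha> :: 'n list. length \<alpha> \<le> m}) * c"
proof -
  have "block_norm j z \<le> (\<Sum>\<alpha> | length \<alpha> = j. \<bar>z \<alpha>\<bar>)"
    unfolding block_norm_def by (rule L2_set_le_sum_abs)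
  also have "\<dots> \<le> real (card {\<alpha> :: 'n list. length \<alpha> = j}) * c"
    by (rule sum_bounded_above) (use assms in auto)
  also have "\<dots> \<le> real (card {\<alpha> :: 'n list. length \<alpha> \<le> m}) * c"
    using assms finite_words by (intro mult_right_mono of_nat_mono card_mono) auto
  finally show ?thesis .
qed

text \<open>The case h = 0 stands apart because of the logarithm behind \<open>powr\<close>; J must
  be nonempty there, since the empty product is 1 while \<open>0 powr 0\<close> is 0.\<close>

lemma prod_scaled_powr:
  fixes h s c :: real
  assumes "finite J" "J \<noteq> {}" "0 \<le> h" "0 < s" "0 < c" "\<And>j. j \<in> J \<Longrightarrow> 0 < p j"
  shows "(\<Prod>j\<in>J. (c * (s powr (- (real j / d)) * h)) powr p j) =
    c powr (\<Sum>j\<in>J. p j) * s powr (- ((\<Sum>j\<in>J. real j * p j) / d)) * h powr (\<Sum>j\<in>J. p j)"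
proof (cases "h = 0")
  case True
  have "(\<Prod>j\<in>J. (c * (s powr (- (real j / d)) * h)) powr p j) = 0"
    using True assms by (intro prod_zero) auto
  then show ?thesis using True by simp
next
  case False
  have "(\<Prod>j\<in>J. (c * (s powr (- (real j / d)) * h)) powr p j)
      = (\<Prod>j\<in>J. c powr p j * s powr (- (real j / d) * p j) * h powr p j)"
    using assms by (intro prod.cong) (auto simp: powr_mult powr_powr)
  also have "\<dots> = c powr (\<Sum>j\<in>J. p j) * s powr (\<Sum>j\<in>J. - (real j / d) * p j) * h powr (\<Sum>j\<in>J. p j)"
    using assms False by (simp add: prod.distrib powr_sum)
  also have "(\<Sum>j\<in>J. - (real j / d) * p j) = - ((\<Sum>j\<in>J. real j * p j) / d)"
    by (simp add: sum_negf sum_divide_distrib)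
  finally show ?thesis .
qed

text \<open>\<gamma> precedes the datum, so all constants below are built from the kernel, the
  exponents and a0 alone; the datum enters only through the density \<psi>, whose growth constant
  \<kappa> depends on \<gamma>.\<close>

theorem corollary1p2:
  fixes m :: nat and d L A a0 q r0 :: real and J :: "nat set" and p :: "nat \<Rightarrow> real"
    and G :: "real^'n::finite \<Rightarrow> real^'n \<Rightarrow> real \<Rightarrow> real"
    and F :: "real^'n \<Rightarrow> real \<Rightarrow> ('n list \<Rightarrow> real) \<Rightarrow> real"
  defines "r0 \<equiv> crit_exponent CARD('n) d J p A"
  assumes "admissible_kernel m d L \<infinity> G"
    and "structure_condition m d J p A F"
    and "1 < r0"
    and "1 < q"
  shows "\<exists>\<gamma>>0. \<forall>\<phi> :: real^'n \<Rightarrow> real.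
           locally_integrable \<phi> \<and> morrey_norm r0 q \<phi> \<le> ennreal \<gamma> \<longrightarrow>
           (\<exists>u. is_solution m a0 G F \<phi> \<infinity> u \<and>
             (\<exists>C>0. \<forall>x t. \<forall>j\<le>m. 0 < t \<longrightarrow>
               grad_norm j (\<lambda>x. u x t) x
                 \<le> C * t powr (- real CARD('n) / (d * r0) - real j / d)))"
proof -
  let ?N = "real CARD('n)"
  obtain C where C: "0 < C" and jets: "kernel_jets m d L C (kernel_jet G)"
    using admissible_kernel_jets[OF assms(2)] by blast
  interpret KJ: kernel_jets m d L C "kernel_jet G" by (rule jets)
  have d: "0 < d" and L: "0 < L" using KJ.m_less KJ.Lpos by auto
  define pp where "pp = (\<Sum>j\<in>J. p j)"
  define jp where "jp = (\<Sum>j\<in>J. real j * p j)"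
  have F_cont: "continuous_on (UNIV \<times> {0..} \<times> jet_space m) (\<lambda>(x, t, z). F x t z)"
    and J: "J \<subseteq> {0..m}" and p: "\<And>j. j \<in> J \<Longrightarrow> 0 < p j" and pp: "1 < pp" and jp: "jp < d * (1 + A)"
    and F_le: "\<And>x t z. z \<in> jet_space m \<Longrightarrow> 0 < t \<Longrightarrow> \<bar>F x t z\<bar> \<le> t powr A * (\<Prod>j\<in>J. block_norm j z powr p j)"
    using assms(3) by (auto simp: structure_condition_def pp_def jp_def)
  have fJ: "finite J" using J finite_subset by blast
  have J_ne: "J \<noteq> {}" using pp by (auto simp: pp_def)
  have r0: "0 < r0" using assms(4) by simp
  have r0_eq: "?N * (pp - 1) / r0 = d * (1 + A) - jp"
    using r0 pp jp unfolding r0_def crit_exponent_def pp_def[symmetric] jp_def[symmetric] by (simp add: field_simps)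
  define e where "e = ?N / (d * r0)"
  have e: "0 < e" using d r0 by (simp add: e_def)
  \<comment> \<open>Criticality of r_0 in terms of the decay exponent e of h. It is what turns the
    power of s in the source bound into \<delta> - 1.\<close>
  have e_eq: "e * (pp - 1) = 1 + A - jp / d"
  proof -
    have "e * (pp - 1) = (?N * (pp - 1) / r0) / d" by (simp add: e_def)
    also have "\<dots> = 1 + A - jp / d" unfolding r0_eq using d by (simp add: field_simps)
    finally show ?thesis .
  qed
  \<comment> \<open>The midpoint of 1 and |p| keeps \<beta> strictly between them; the minimum with
    q allows the Morrey bound to be lowered from q to \<beta>.\<close>
  define \<beta> where "\<beta> = min q ((1 + pp) / 2)"
  have \<beta>: "1 < \<beta>" "\<beta> \<le> q" "\<beta> < pp" using assms(5) pp by (auto simp: \<beta>_def min_def)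
  define \<delta> where "\<delta> = (\<beta> - 1) * e"
  have \<delta>: "0 < \<delta>" using \<beta> e by (simp add: \<delta>_def)
  define b where "b = ?N * \<beta> / r0"
  have b: "0 \<le> b" using \<beta> r0 by (simp add: b_def)
  have b_eq: "b / d = e * \<beta>" by (simp add: b_def e_def)
  obtain S where S: "0 < S" and mass: "\<And>t (x::real^'n). 0 < t \<Longrightarrow> (\<integral>\<^sup>+z. ennreal (decay_kernel d L t (x - z)) \<partial>lborel) \<le> ennreal S"
    using decay_kernel_mass[OF d L, where 'a = "real^'n"] by metis
  obtain Cv where Cv: "0 < Cv" and conv: "\<forall>r>0. \<forall>s>0. \<forall>x z :: real^'n.
    (\<integral>\<^sup>+y. ennreal (decay_kernel d L r (x - y)) * ennreal (decay_kernel d L s (y - z)) \<partial>lborel)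
      \<le> ennreal (Cv * decay_kernel d L (r + s) (x - z))"
    using decay_kernel_convolution[OF d L, where 'a = "real^'n"] by blast
  \<comment> \<open>The constant of the potential bound times that of the ball growth of
    |\<phi>|^\<beta>, with \<gamma>^\<beta> factored out: H \<le> c0 \<gamma>^\<beta> t^(-e\<beta>),
    hence h \<le> c1 \<gamma> t^(-e).\<close>
  define c0 where "c0 = 2 powr (?N + L) / (1 - 2 powr (- (L + b))) * (2 * unit_ball_vol ?N)"
  have c0: "0 < c0"
  proof -
    have "2 powr (- (L + b)) < 1" using L b powr_less_one[of 2 "- (L + b)"] by simp
    then show ?thesis unfolding c0_def by (intro mult_pos_pos divide_pos_pos) auto
  qed
  define c1 where "c1 = c0 powr (1 / \<beta>)"
  have c1: "0 < c1" using c0 by (simp add: c1_def)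
  \<comment> \<open>The linear part is at most C (S + 1) t^(-j/d) h; the factor 2 leaves the other
    half of the region to the Duhamel part.\<close>
  define R where "R = 2 * C * (S + 1)"
  have R: "0 < R" using C S by (simp add: R_def)
  define \<Lambda> where "\<Lambda> = real (card {\<alpha> :: 'n list. length \<alpha> \<le> m})"
  have \<Lambda>: "0 < \<Lambda>"
  proof -
    have "[] \<in> {\<alpha> :: 'n list. length \<alpha> \<le> m}" by simp
    then have "{\<alpha> :: 'n list. length \<alpha> \<le> m} \<noteq> {}" by blast
    then show ?thesis unfolding \<Lambda>_def using finite_words[of m] by (simp add: card_gt_0_iff del: Collect_empty_eq)
  qed
  define Bm where "Bm = (\<Sum>j\<le>m. Beta \<delta> (1 - real j / d))"
  have Beta_nonneg: "0 \<le> Beta \<delta> (1 - real j / d)" if "j \<le> m" for j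
  proof -
    have "real j < d" using that KJ.m_less by simp
    then show ?thesis using \<delta> d by (intro Beta_real_nonneg) auto
  qed
  have Bm: "Beta \<delta> (1 - real j / d) \<le> Bm" "0 \<le> Bm" if "j \<le> m" for j
    unfolding Bm_def using that Beta_nonneg by (auto intro!: member_le_sum sum_nonneg)
  \<comment> \<open>Collects the constants of the Duhamel estimate: the powers |p| - \<beta> and
    \<beta> - 1 of c1 \<gamma> add up to |p| - 1, so that this part is at most E \<gamma>^(|p|-1)
    t^(-j/d) h.\<close>
  define E where "E = \<bar>a0\<bar> * (\<Lambda> * R) powr pp * Cv * Bm * C * c1 powr (pp - 1)"
  have E: "0 \<le> E" using Cv C Bm(2)[of 0] by (simp add: E_def)
  \<comment> \<open>Chosen so that E \<gamma>^(|p|-1) \<le> R/2; the denominator E + 1 covers E = 0,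
    which occurs for a0 = 0.\<close>
  define \<gamma> where "\<gamma> = ((R / 2) / (E + 1)) powr (1 / (pp - 1))"
  have \<gamma>: "0 < \<gamma>" using R E by (simp add: \<gamma>_def)
  have \<gamma>_small: "E * \<gamma> powr (pp - 1) \<le> R / 2"
  proof -
    have "E * \<gamma> powr (pp - 1) = (R / 2) * (E / (E + 1))" using pp R E by (simp add: \<gamma>_def powr_powr)
    also have "\<dots> \<le> (R / 2) * 1" using R E by (intro mult_left_mono) (auto simp: divide_le_eq_1)
    finally show ?thesis by simp
  qed
  define M where "M = (\<Lambda> * R) powr pp * (c1 * \<gamma>) powr (pp - \<beta>)"
  have M: "0 \<le> M" by (simp add: M_def)
  show ?thesis
  proof (intro exI[of _ \<gamma>] conjI allI impI \<gamma>)
    fix \<phi> :: "real^'n \<Rightarrow> real"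
    assume "locally_integrable \<phi> \<and> morrey_norm r0 q \<phi> \<le> ennreal \<gamma>"
    then have \<phi>: "\<phi> \<in> borel_measurable lebesgue" and norm: "morrey_norm r0 q \<phi> \<le> ennreal \<gamma>"
      by (auto intro: locally_integrable_measurable)
    obtain \<phi>' where \<phi>'[measurable]: "\<phi>' \<in> borel_measurable borel" and ae: "AE y in lborel. \<phi> y = \<phi>' y"
      using completion_ex_borel_measurable_real[OF \<phi>] by auto
    define \<psi> where "\<psi> z = \<bar>\<phi>' z\<bar> powr \<beta>" for z
    define \<kappa> where "\<kappa> = 2 * unit_ball_vol ?N * \<gamma> powr \<beta>"
    interpret BG: ball_growth_density d L Cv b \<kappa> \<delta> \<psi>
    proof unfold_locales
      show "(\<integral>\<^sup>+z. ennreal (\<psi> z) * indicator (ball x \<sigma>) z \<partial>lborel) \<le> ennreal (\<kappa> * \<sigma> powr (real DIM(real^'n) - b))"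
        if "0 < \<sigma>" for x \<sigma>
        using morrey_ball_growth[OF norm \<gamma> _ \<beta>(2) that \<phi>' ae, of x] \<beta> by (simp add: \<psi>_def \<kappa>_def b_def)
      show "\<psi> \<in> borel_measurable borel" unfolding \<psi>_def by measurable
    qed (use d L Cv conv b \<delta> in \<open>auto simp: \<kappa>_def\<close>)
    define Hr where "Hr x t = enn2real (potential d L \<psi> t x)" for x t
    define h where "h x t = Hr x t powr (1 / \<beta>)" for x t
    have Hr: "potential d L \<psi> t x = ennreal (Hr x t)" if "0 < t" for x t
      using BG.potential_finite[OF that, of x] by (simp add: Hr_def)
    have Hr0: "0 \<le> Hr x t" for x t by (simp add: Hr_def)
    have h0: "0 \<le> h x t" for x t by (simp add: h_def)
    have h_\<beta>: "h x t powr \<beta> = Hr x t" for x t using \<beta> Hr0 by (simp add: h_def powr_powr)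
    have h_le: "h x t \<le> c1 * \<gamma> * t powr (- e)" if t: "0 < t" for x t
    proof -
      have "2 powr (?N + L) / (1 - 2 powr (- (L + b))) * \<kappa> * t powr (- b / d) = c0 * \<gamma> powr \<beta> * t powr (- e * \<beta>)"
        using b_eq by (simp add: c0_def \<kappa>_def)
      then have "ennreal (Hr x t) \<le> ennreal (c0 * \<gamma> powr \<beta> * t powr (- e * \<beta>))"
        using BG.potential_le[OF t, of x] by (simp add: Hr[OF t])
      then have "Hr x t \<le> c0 * \<gamma> powr \<beta> * t powr (- e * \<beta>)"
        using c0 by (simp add: ennreal_le_iff)
      then have "h x t \<le> (c0 * \<gamma> powr \<beta> * t powr (- e * \<beta>)) powr (1 / \<beta>)"
        unfolding h_def using \<beta> Hr0 by (intro powr_mono2) auto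
      also have "\<dots> = c1 * \<gamma> * t powr (- e)"
        using c0 \<gamma> \<beta> t by (simp add: powr_mult powr_powr c1_def)
      finally show ?thesis .
    qed
    have c1\<gamma>: "0 < c1 * \<gamma>" using c1 \<gamma> by simp
    have h_powr_le: "h x t powr s \<le> (c1 * \<gamma>) powr s * t powr (- e * s)" if "0 < t" "0 \<le> s" for x t s
    proof -
      have "h x t powr s \<le> (c1 * \<gamma> * t powr (- e)) powr s"
        using h_le[OF that(1)] h0 that by (intro powr_mono2) auto
      then show ?thesis using c1\<gamma> by (simp add: powr_mult powr_powr)
    qed
    have pot: "potential d L (\<lambda>z. \<bar>\<phi>' z\<bar>) t x \<le> ennreal ((S + 1) * h x t)" if t: "0 < t" for t x
      using potential_power_mean[OF \<phi>' _ S mass[OF t, of x], of \<beta>] \<beta> BG.potential_finite[OF t, of x]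
      by (simp add: h_def Hr_def \<psi>_def[abs_def])
    define P where "P t = (S + 1) * (c1 * \<gamma> * t powr (- e))" for t
    interpret LB: locally_bounded_potential d L \<phi>' P
    proof unfold_locales
      fix t :: real and x :: "real^'n" assume t: "0 < t"
      have "(S + 1) * h x t \<le> P t" unfolding P_def using S h_le[OF t] by (intro mult_left_mono) auto
      then show "potential d L (\<lambda>z. \<bar>\<phi>' z\<bar>) t x \<le> ennreal (P t)"
        by (rule order_trans[OF pot[OF t] ennreal_leI])
    qed simp
    define \<Theta> where "\<Theta> \<alpha> x t = R * (t powr (- (real (length \<alpha>) / d)) * h x t)" for \<alpha> :: "'n list" and x t
    have \<Theta>_le: "\<Theta> \<alpha> x t \<le> R * (c1 * \<gamma>) * t powr (- e - real (length \<alpha>) / d)" if t: "0 < t" for \<alpha> x t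
    proof -
      have "\<Theta> \<alpha> x t \<le> R * (t powr (- (real (length \<alpha>) / d)) * (c1 * \<gamma> * t powr (- e)))"
        unfolding \<Theta>_def using R h_le[OF t] by (intro mult_left_mono) auto
      also have "\<dots> = R * (c1 * \<gamma>) * (t powr (- e) * t powr (- (real (length \<alpha>) / d)))" by simp
      also have "t powr (- e) * t powr (- (real (length \<alpha>) / d)) = t powr (- e - real (length \<alpha>) / d)"
        by (simp add: powr_add[symmetric])
      finally show ?thesis .
    qed
    interpret TS: tonelli_scheme m d L C "kernel_jet G" Cv b \<kappa> \<delta> \<psi> \<phi>' P a0 M F \<Theta>
    proof unfold_locales
      fix s :: real and z :: "'n list \<Rightarrow> real" and y :: "real^'n"
      assume s: "0 < s" and z: "z \<in> jet_space m" and z_le: "\<And>\<alpha>. length \<alpha> \<le> m \<Longrightarrow> \<bar>z \<alpha>\<bar> \<le> \<Theta> \<alpha> y s"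
      have bn: "block_norm j z \<le> (\<Lambda> * R) * (s powr (- (real j / d)) * h y s)" if "j \<in> J" for j
      proof -
        have j: "j \<le> m" using that J by auto
        have "block_norm j z \<le> \<Lambda> * (R * (s powr (- (real j / d)) * h y s))"
          unfolding \<Lambda>_def using R h0 j z_le by (intro block_norm_le) (auto simp: \<Theta>_def)
        then show ?thesis by (simp add: mult.assoc)
      qed
      have "\<bar>F y s z\<bar> \<le> s powr A * (\<Prod>j\<in>J. block_norm j z powr p j)" by (rule F_le[OF z s])
      also have "\<dots> \<le> s powr A * (\<Prod>j\<in>J. ((\<Lambda> * R) * (s powr (- (real j / d)) * h y s)) powr p j)"
        using bn p by (intro mult_left_mono prod_mono conjI powr_mono2) (auto simp: block_norm_def less_imp_le)
      also have "\<dots> = s powr A * ((\<Lambda> * R) powr pp * s powr (- (jp / d)) * h y s powr pp)"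
        unfolding pp_def jp_def using p \<Lambda> R by (subst prod_scaled_powr[OF fJ J_ne h0 s]) auto
      \<comment> \<open>Exactly \<beta> powers of h are kept as H, the quantity that can be
        convolved without loss; only the excess is replaced by its decay in s.\<close>
      also have "h y s powr pp = h y s powr (pp - \<beta>) * Hr y s"
        unfolding h_\<beta>[symmetric] by (simp add: powr_add[symmetric])
      also have "s powr A * ((\<Lambda> * R) powr pp * s powr (- (jp / d)) * (h y s powr (pp - \<beta>) * Hr y s))
        \<le> s powr A * ((\<Lambda> * R) powr pp * s powr (- (jp / d)) * (((c1 * \<gamma>) powr (pp - \<beta>) * s powr (- e * (pp - \<beta>))) * Hr y s))"
        using \<beta> Hr0 by (intro mult_left_mono mult_right_mono h_powr_le s) auto
      also have "\<dots> = M * ((s powr A * s powr (- (jp / d)) * s powr (- e * (pp - \<beta>))) * Hr y s)"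
        by (simp add: M_def)
      also have "s powr A * s powr (- (jp / d)) * s powr (- e * (pp - \<beta>)) = s powr (\<delta> - 1)"
      proof -
        have "A + - (jp / d) + - e * (pp - \<beta>) = \<delta> - 1"
          using e_eq by (simp add: \<delta>_def algebra_simps)
        then show ?thesis by (simp only: powr_add[symmetric])
      qed
      finally have "ennreal \<bar>F y s z\<bar> \<le> ennreal (M * (s powr (\<delta> - 1) * Hr y s))" by (rule ennreal_leI)
      also have "\<dots> = ennreal M * parabolic_weight d L \<delta> \<psi> (y, s)"
        using s M Hr0 by (simp add: parabolic_weight_def Hr ennreal_mult)
      finally show "ennreal \<bar>F y s z\<bar> \<le> ennreal M * parabolic_weight d L \<delta> \<psi> (y, s)" .
    next
      fix \<alpha> :: "'n list" and t :: real and x :: "real^'n"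
      assume \<alpha>: "length \<alpha> \<le> m" and t: "0 < t"
      let ?j = "real (length \<alpha>)"
      interpret D: singular_kernel_with_datum d L "?j / d" C "kernel_jet G \<alpha>" \<phi>' P
        by (intro singular_kernel_with_datum.intro KJ.singular \<alpha> LB.locally_bounded_potential_axioms)
      have "ennreal \<bar>evolution (kernel_jet G \<alpha>) \<phi>' x t\<bar> \<le> ennreal (C * t powr (- (?j / d))) * ennreal ((S + 1) * h x t)"
        by (rule order_trans[OF D.evolution_bound[OF t] mult_left_mono[OF pot[OF t]]]) simp
      also have "\<dots> = ennreal (\<Theta> \<alpha> x t / 2)"
        using C S h0 by (simp add: ennreal_mult[symmetric] \<Theta>_def R_def mult_ac)
      finally show "\<bar>evolution (kernel_jet G \<alpha>) \<phi>' x t\<bar> \<le> \<Theta> \<alpha> x t / 2"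
        using R h0 by (simp add: ennreal_le_iff \<Theta>_def)
    next
      fix \<alpha> :: "'n list" and t :: real and x :: "real^'n" and f
      assume \<alpha>: "length \<alpha> \<le> m" and t: "0 < t" and f: "BG.weighted M f"
      let ?j = "real (length \<alpha>)"
      interpret D: singular_kernel_with_density d L "?j / d" C "kernel_jet G \<alpha>" Cv b \<kappa> \<delta> \<psi>
        by (intro singular_kernel_with_density.intro KJ.singular \<alpha> BG.ball_growth_density_axioms)
      let ?c = "M * (Cv * Beta \<delta> (1 - ?j / d) * C) * t powr (\<delta> - ?j / d)"
      have c_le: "0 \<le> ?c" "?c \<le> M * (Cv * Bm * C) * t powr (\<delta> - ?j / d)"
        using M Cv C Beta_nonneg[OF \<alpha>] Bm(1)[OF \<alpha>] by (auto intro!: mult_left_mono mult_right_mono)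
      \<comment> \<open>The converse of the splitting used for the source: one power of h is the
        bound to be recovered, and the decay t^(-\<delta>) of the remaining \<beta> - 1 powers
        cancels the factor t^\<delta> from the time integral.\<close>
      have "Hr x t = h x t * h x t powr (\<beta> - 1)"
        unfolding h_\<beta>[symmetric] using powr_mult_base[OF h0, of x t "\<beta> - 1"] by simp
      also have "\<dots> \<le> h x t * ((c1 * \<gamma>) powr (\<beta> - 1) * t powr (- e * (\<beta> - 1)))"
        using \<beta> by (intro mult_left_mono h_powr_le t h0) auto
      finally have Hr_le: "Hr x t \<le> h x t * ((c1 * \<gamma>) powr (\<beta> - 1) * t powr (- \<delta>))"
        by (simp add: \<delta>_def mult.commute)
      have "ennreal \<bar>duhamel (kernel_jet G \<alpha>) f x t\<bar> \<le> ennreal (?c * Hr x t)"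
        using D.duhamel_bound[OF f t, of x] c_le(1) Hr0 by (simp add: Hr[OF t] ennreal_mult)
      then have "\<bar>duhamel (kernel_jet G \<alpha>) f x t\<bar> \<le> ?c * Hr x t"
        using c_le(1) Hr0 by (simp add: ennreal_le_iff)
      also have "\<dots> \<le> (M * (Cv * Bm * C) * t powr (\<delta> - ?j / d)) * (h x t * ((c1 * \<gamma>) powr (\<beta> - 1) * t powr (- \<delta>)))"
        by (rule mult_mono[OF c_le(2) Hr_le order_trans[OF c_le] Hr0])
      also have "\<dots> = ((\<Lambda> * R) powr pp * Cv * Bm * C * ((c1 * \<gamma>) powr (pp - \<beta>) * (c1 * \<gamma>) powr (\<beta> - 1)))
          * ((t powr (\<delta> - ?j / d) * t powr (- \<delta>)) * h x t)"
        unfolding M_def by (simp only: mult_ac)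
      also have "(c1 * \<gamma>) powr (pp - \<beta>) * (c1 * \<gamma>) powr (\<beta> - 1) = c1 powr (pp - 1) * \<gamma> powr (pp - 1)"
        unfolding powr_add[symmetric] using c1 \<gamma> by (simp add: powr_mult)
      also have "t powr (\<delta> - ?j / d) * t powr (- \<delta>) = t powr (- (?j / d))"
        by (simp add: powr_add[symmetric])
      finally have "\<bar>a0\<bar> * \<bar>duhamel (kernel_jet G \<alpha>) f x t\<bar> \<le> \<bar>a0\<bar> * (((\<Lambda> * R) powr pp * Cv * Bm * C * (c1 powr (pp - 1) * \<gamma> powr (pp - 1)))
          * (t powr (- (?j / d)) * h x t))"
        by (rule mult_left_mono) simp
      also have "\<dots> = (E * \<gamma> powr (pp - 1)) * (t powr (- (?j / d)) * h x t)"
        unfolding E_def by (simp only: mult_ac)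
      also have "\<dots> \<le> R / 2 * (t powr (- (?j / d)) * h x t)"
        using \<gamma>_small h0 by (intro mult_right_mono) auto
      finally show "\<bar>a0 * duhamel (kernel_jet G \<alpha>) f x t\<bar> \<le> \<Theta> \<alpha> x t / 2"
        by (simp add: \<Theta>_def abs_mult)
    qed (use M F_cont in auto)
    have "\<exists>c. \<forall>x t. \<tau> < t \<longrightarrow> \<Theta> \<alpha> x t \<le> c" if \<tau>: "0 < \<tau>" for \<alpha> \<tau>
    proof (intro exI allI impI)
      fix x :: "real^'n" and t assume t: "\<tau> < t"
      have "\<Theta> \<alpha> x t \<le> R * (c1 * \<gamma>) * t powr (- e - real (length \<alpha>) / d)" using t \<tau> by (intro \<Theta>_le) auto
      also have "\<dots> \<le> R * (c1 * \<gamma>) * \<tau> powr (- e - real (length \<alpha>) / d)"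
      proof -
        have "0 \<le> real (length \<alpha>) / d" using d by simp
        then show ?thesis using t \<tau> R c1\<gamma> e by (intro mult_left_mono powr_mono2') auto
      qed
      finally show "\<Theta> \<alpha> x t \<le> R * (c1 * \<gamma>) * \<tau> powr (- e - real (length \<alpha>) / d)" .
    qed
    then obtain u where u: "is_solution m a0 G F \<phi> \<infinity> u"
      and u_le: "\<And>\<alpha> x t. length \<alpha> \<le> m \<Longrightarrow> 0 < t \<Longrightarrow> \<bar>pderivs (dirs \<alpha>) (\<lambda>x. u x t) x\<bar> \<le> \<Theta> \<alpha> x t"
      using TS.solution_exists[of G \<phi>, OF _ \<phi> ae] by (auto simp: kernel_jet_def)
    have "grad_norm j (\<lambda>x. u x t) x \<le> (\<Lambda> * (R * (c1 * \<gamma>))) * t powr (- ?N / (d * r0) - real j / d)"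
      if j: "j \<le> m" and t: "0 < t" for x t j
    proof -
      have "grad_norm j (\<lambda>x. u x t) x \<le> \<Lambda> * (R * (c1 * \<gamma>) * t powr (- e - real j / d))"
        unfolding grad_norm_def \<Lambda>_def
      proof (rule block_norm_le[OF j])
        show "\<bar>pderivs (dirs \<alpha>) (\<lambda>x. u x t) x\<bar> \<le> R * (c1 * \<gamma>) * t powr (- e - real j / d)" if "length \<alpha> = j" for \<alpha>
          using order_trans[OF u_le[OF _ t] \<Theta>_le[OF t], of \<alpha> x] that j by simp
      qed (use R c1\<gamma> in simp)
      then show ?thesis by (simp add: e_def mult.assoc)
    qed
    moreover have "0 < \<Lambda> * (R * (c1 * \<gamma>))" using \<Lambda> R c1\<gamma> by simp
    ultimately show "\<exists>u. is_solution m a0 G F \<phi> \<infinity> u \<and>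
             (\<exists>C>0. \<forall>x t. \<forall>j\<le>m. 0 < t \<longrightarrow>
               grad_norm j (\<lambda>x. u x t) x \<le> C * t powr (- real CARD('n) / (d * r0) - real j / d))"
      using u by blast
  qed
qed

end
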